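(* Let Assumptions 1, 2 and 3 of the context hold and let $x_0\in\mathsf X_0$. In addition, let the matrices $\{Y_k^i=R_k^{ii}+{B_k^i}'E_{k+1}^iB_k^i,\ k\in\mathsf K_l,\ i\in\mathsf N\}$ be positive definite. Then the joint GOLNE strategy profile of DGC is given by $$\mathsf u_{\mathsf K}^\star=\mathsf F\,\boldsymbol\mu_{\mathsf K}^\star+\mathsf P(x_0),$$ where $\boldsymbol\mu_{\mathsf K}^\star$ is a solution of the linear complementarity problem $$\mathrm{LCP}(x_0):\qquad 0\le\mathsf M\,\boldsymbol\mu_{\mathsf K}^\star+\mathsf q(x_0)\ \perp\ \boldsymbol\mu_{\mathsf K}^\star\ge0,$$ that is, a joint strategy profile $\mathsf u_{\mathsf K}^\star$ is a GOLNE if and only if it has this form for some solution $\boldsymbol\mu_{\mathsf K}^\star$ of $\mathrm{LCP}(x_0)$. Here $$\mathsf M=\mathsf M_{\mathsf K}\boldsymbol\Phi_2+\mathsf N_{\mathsf K}\boldsymbol\Psi_2+\tilde{\mathsf N}_{\mathsf K},\quad \mathsf q(x_0)=\mathsf M_{\mathsf K}\boldsymbol\Phi_0x_0+(\mathsf M_{\mathsf K}\boldsymbol\Phi_1+\mathsf N_{\mathsf K}\boldsymbol\Psi_1)\mathbf p_{\mathsf K}+\mathbf r_{\mathsf K},$$ $$\mathsf F=\mathbf F_{\mathsf K}\boldsymbol\Phi_2+\overline{\mathbf F}_{\mathsf K}\boldsymbol\Psi_2+\tilde{\mathbf F}_{\mathsf K},\quad \mathsf P(x_0)=\mathbf F_{\mathsf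 K}\boldsymbol\Phi_0x_0+(\mathbf F_{\mathsf K}\boldsymbol\Phi_1+\overline{\mathbf F}_{\mathsf K}\boldsymbol\Psi_1)\mathbf p_{\mathsf K},$$ with all matrices and vectors on the right-hand sides as defined in the context.
   Context: Notation. A prime denotes transpose; $\|a\|_A:=a'Aa$; $\mathrm{col}\{\cdot\}$ stacks vectors or matrices vertically; $\oplus$ forms block diagonal matrices; $\otimes$ is the Kronecker product; $\mathbf I$, $\mathbf 0$ are identity and zero matrices of appropriate size; $[\cdot]_i$, $[\cdot]_{k\tau}$ denote blocks; $0\le x\perp y\ge0$ means $x\ge0$, $y\ge0$ (componentwise) and $x'y=0$. $\mathsf N=\{1,\dots,N\}$ (players), $\mathsf K=\{0,\dots,K\}$, $\mathsf K_l=\mathsf K\setminus\{K\}$, $\mathsf K_r=\mathsf K\setminus\{0\}$, $-i=\mathsf N\setminus\{i\}$. The game (DGC). The state $x_k\in\mathbb R^n$ evolves as $x_{k+1}=A_kx_k+\sum_{i\in\mathsf N}B_k^iu_k^i$, $k\in\mathsf K_l$, with given $x_0\in\mathbb R^n$, where $A_k\in\mathbb R^{n\times n}$, $B_k^i\in\mathbb R^{n\times m_i}$ and $u_k^i\in\mathbb R^{m_i}$ is player $i$'s action. Put $\mathsf u_k=\mathrm{col}\{u_k^i\}_{i=1}^N\in\mathbb R^m$, $m=\sum_im_i$. Player $i$'s constraints are $M_k^ix_k+N_k^i\mathsf u_k+r_k^i\ge0$, $k\in\mathsf K_l$, with $M_k^i\in\mathbb R^{c_i\times n}$, $N_k^i\in\mathbb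 R^{c_i\times m}$, $r_k^i\in\mathbb R^{c_i}$; $[N_k^i]_j\in\mathbb R^{c_i\times m_j}$ is the block of columns of $N_k^i$ multiplying $u_k^j$. Player $i$'s strategy is $\mathsf u^i=\mathrm{col}\{u_k^i\}_{k=0}^{K-1}$, and $\mathsf u^{-i}$ collects the strategies of the other players. Player $i$ minimizes $$J^i(\mathsf u^i,\mathsf u^{-i})=\tfrac12\|x_K\|_{Q_K^i}+{p_K^i}'x_K+\tfrac12\sum_{k\in\mathsf K_l}\Big(\|x_k\|_{Q_k^i}+2{p_k^i}'x_k+\sum_{j\in\mathsf N}\|u_k^j\|_{R_k^{ij}}\Big),$$ with $Q_k^i\in\mathbb R^{n\times n}$ symmetric, $p_k^i\in\mathbb R^n$, $R_k^{ij}\in\mathbb R^{m_j\times m_j}$, $R_k^{ii}$ symmetric. $R(x_0)$ is the set of joint strategies $(\mathsf u^i,\mathsf u^{-i})\in\mathbb R^{Km}$ for which, with the state generated from $x_0$, all players' constraints hold at all $k\in\mathsf K_l$; $\Omega=\{(x_0,(\mathsf u^i,\mathsf u^{-i})):(\mathsf u^i,\mathsf u^{-i})\in R(x_0)\}$; $\mathsf X_0=\{x_0\in\mathbb R^n: R(x_0)\ne\emptyset\}$; $\mathsf U^i(\mathsf u^{-i})=\{\mathsf u^i\in\mathbb R^{Km_i}:(\mathsf u^i,\mathsf u^{-i})\in R(x_0)\}$. GOLNE. A profile $\mathsf u^\star\in R(x_0)$ is a generalized open-loop Nash equilibrium (GOLNE) for DGC if for each $i\in\mathsf N$: $J^i(\mathsf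 u^{i\star},\mathsf u^{-i\star})\le J^i(\mathsf u^i,\mathsf u^{-i\star})$ for all $\mathsf u^i\in\mathsf U^i(\mathsf u^{-i\star})$. Assumption 1. (i) $\Omega\ne\emptyset$, and for every $x_0\in\mathsf X_0$, $R(x_0)$ is bounded. (ii) The matrices $[N_k^i]_i$, $k\in\mathsf K_l$, $i\in\mathsf N$, have full rank. (iii) The matrices $R_k^{ii}$, $k\in\mathsf K_l$, $i\in\mathsf N$, are positive definite. Assumption 2. For each $i\in\mathsf N$ the backward symmetric matrix Riccati equation $$E_k^i=A_k'E_{k+1}^iA_k+Q_k^i-A_k'E_{k+1}^iB_k^i(Y_k^i)^{-1}{B_k^i}'E_{k+1}^iA_k,\quad E_K^i=Q_K^i,$$ admits a solution $\{E_k^i,\ k\in\mathsf K\}$, and thus the matrices $Y_k^i=R_k^{ii}+{B_k^i}'E_{k+1}^iB_k^i$, $k\in\mathsf K_l$, $i\in\mathsf N$, are invertible. Assumption 3. The solution $\{P_k^i\in\mathbb R^{n\times n},\ k\in\mathsf K\}$ of the Riccati difference equation $$P_k^i=Q_k^i+A_k'P_{k+1}^i\Lambda_k^{-1}A_k,\quad P_K^i=Q_K^i,\quad \Lambda_k:=\mathbf I+\sum_{j\in\mathsf N}B_k^j(R_k^{jj})^{-1}{B_k^j}'P_{k+1}^j,$$ exists for all $i\in\mathsf N$ (and thus the matrices $\Lambda_k$, $k\in\mathsf K_l$, are invertible). Stage-wise matrices ($k\in\mathsf K_l$ unless indicated). $\mathbf R_k=\oplus_{i=1}^NR_k^{ii}$,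 $\mathbf B_k=\oplus_{i=1}^NB_k^i$, $\mathbf N_k=\oplus_{i=1}^N[N_k^i]_i$, $\mathbf M_k=\oplus_{i=1}^NM_k^i$, $\overline{\mathbf M}_k=\mathrm{col}\{M_k^i\}_{i=1}^N$, $\overline{\mathbf N}_k=\mathrm{col}\{N_k^i\}_{i=1}^N$, $\mathbf r_k=\mathrm{col}\{r_k^i\}_{i=1}^N$; $\mathbf p_k=\mathrm{col}\{p_k^i\}_{i=1}^N$, $P_k=\mathrm{col}\{P_k^i\}_{i=1}^N$ ($k\in\mathsf K$). $\mathbf G_k=\Lambda_k^{-1}A_k$; $\overline{\mathbf G}_{k+1}\in\mathbb R^{n\times Nn}$ has $i$-th column block $-\Lambda_k^{-1}B_k^i(R_k^{ii})^{-1}{B_k^i}'$; $\tilde{\mathbf G}_k\in\mathbb R^{n\times c}$ ($c=\sum_ic_i$) has $i$-th column block $\Lambda_k^{-1}B_k^i(R_k^{ii})^{-1}[N_k^i]_i'$. $\mathbf F_k=-\mathbf R_k^{-1}\mathbf B_k'P_{k+1}\mathbf G_k$, $\overline{\mathbf F}_{k+1}=-\mathbf R_k^{-1}\mathbf B_k'(\mathbf I+P_{k+1}\overline{\mathbf G}_{k+1})$, $\tilde{\mathbf F}_k=\mathbf R_k^{-1}(\mathbf N_k'-\mathbf B_k'P_{k+1}\tilde{\mathbf G}_k)$. $\mathbf H_{k+1}=(\mathbf I_N\otimes A_k')(\mathbf I+P_{k+1}\overline{\mathbf G}_{k+1})$, $\overline{\mathbf H}_k=(\mathbf I_N\otimes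 A_k')P_{k+1}\tilde{\mathbf G}_k-\mathbf M_k'$. Transition matrices. $\phi(k,\tau)=\mathbf G_{k-1}\mathbf G_{k-2}\cdots\mathbf G_\tau$ for $k>\tau$, $\phi(k,k)=\mathbf I$; $\varphi(k,\tau)=\mathbf H_{k+1}\mathbf H_{k+2}\cdots\mathbf H_\tau$ for $k<\tau$, $\varphi(k,k)=\mathbf I$ (indices in $\mathsf K$). Aggregated quantities. $\mathsf u_{\mathsf K}^\star=\mathrm{col}\{\mathsf u_k^\star\}_{k=0}^{K-1}$ with $\mathsf u_k^\star=\mathrm{col}\{u_k^{i\star}\}_{i=1}^N$; $\boldsymbol\mu_{\mathsf K}^\star=\mathrm{col}\{\boldsymbol\mu_k^\star\}_{k=0}^{K-1}$ with $\boldsymbol\mu_k^\star=\mathrm{col}\{\mu_k^{i\star}\}_{i=1}^N\in\mathbb R^c$; $\mathbf p_{\mathsf K}=\mathrm{col}\{\mathbf p_{k+1}\}_{k=0}^{K-1}$; $\mathbf r_{\mathsf K}=\mathrm{col}\{\mathbf r_k\}_{k=0}^{K-1}$; $\mathbf F_{\mathsf K}=\oplus_{k=0}^{K-1}\mathbf F_k$, $\overline{\mathbf F}_{\mathsf K}=\oplus_{k=0}^{K-1}\overline{\mathbf F}_{k+1}$, $\tilde{\mathbf F}_{\mathsf K}=\oplus_{k=0}^{K-1}\tilde{\mathbf F}_k$; $\mathsf M_{\mathsf K}=\oplus_{k=0}^{K-1}(\overline{\mathbf M}_k+\overline{\mathbf N}_k\mathbf F_k)$, $\mathsf N_{\mathsf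 K}=\oplus_{k=0}^{K-1}\overline{\mathbf N}_k\overline{\mathbf F}_{k+1}$, $\tilde{\mathsf N}_{\mathsf K}=\oplus_{k=0}^{K-1}\overline{\mathbf N}_k\tilde{\mathbf F}_k$. Block matrices, with block indices $k,\tau\in\mathsf K_r=\{1,\dots,K\}$: $[\boldsymbol\Phi_0]_k=\phi(k-1,0)$. $[\boldsymbol\Phi_1]_{1\tau}=\mathbf 0$, and $[\boldsymbol\Phi_1]_{k\tau}=\sum_{\rho=1}^{\min(k-1,\tau)}\phi(k-1,\rho)\overline{\mathbf G}_\rho\varphi(\rho,\tau)$ for $k>1$. $[\boldsymbol\Phi_2]_{1\tau}=\mathbf 0$; $[\boldsymbol\Phi_2]_{k1}=\phi(k-1,1)\tilde{\mathbf G}_0$ for $k>1$; for $1<\tau<k$, $[\boldsymbol\Phi_2]_{k\tau}=\big(\sum_{\rho=1}^{\tau-1}\phi(k-1,\rho)\overline{\mathbf G}_\rho\varphi(\rho,\tau-1)\big)\overline{\mathbf H}_{\tau-1}+\phi(k-1,\tau)\tilde{\mathbf G}_{\tau-1}$; for $\tau\ge k>1$, $[\boldsymbol\Phi_2]_{k\tau}=\big(\sum_{\rho=1}^{k-1}\phi(k-1,\rho)\overline{\mathbf G}_\rho\varphi(\rho,\tau-1)\big)\overline{\mathbf H}_{\tau-1}$. $[\boldsymbol\Psi_1]_{k\tau}=\varphi(k,\tau)$ for $\tau\ge k$ and $\mathbf 0$ for $\tau<k$. $[\boldsymbol\Psi_2]_{k\tau}=\varphi(k,\tau-1)\overline{\mathbf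 H}_{\tau-1}$ for $\tau>k$ and $\mathbf 0$ for $\tau\le k$.
   Formalization: The "only if" fails for GOLNE as defined, where deviations must meet all players' constraints. The equivalence is stated for profiles in R(x_0) where each player is optimal subject to that player's own constraints only; the "if" half is also stated for GOLNE as defined. *)

theory Defs
  imports "Jordan_Normal_Form.DL_Rank" "Jordan_Normal_Form.Gauss_Jordan_Elimination"
begin

section \<open>Matrix notation\<close>

definition minv :: "real mat \<Rightarrow> real mat" where
  "minv A = the (mat_inverse A)"

definition pos_def :: "real mat \<Rightarrow> bool" where
  "pos_def A \<longleftrightarrow> A\<^sup>T = A \<and>
     (\<forall>v \<in> carrier_vec (dim_row A). v \<noteq> 0\<^sub>v (dim_row A) \<longrightarrow> v \<bullet> (A *\<^sub>v v) > 0)"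

definition full_rank :: "real mat \<Rightarrow> bool" where
  "full_rank A \<longleftrightarrow> vec_space.rank (dim_row A) A = min (dim_row A) (dim_col A)"

definition quad :: "real mat \<Rightarrow> real vec \<Rightarrow> real" where
  "quad A a = a \<bullet> (A *\<^sub>v a)"

definition mat_sum :: "nat \<Rightarrow> nat \<Rightarrow> ('i \<Rightarrow> real mat) \<Rightarrow> 'i set \<Rightarrow> real mat" where
  "mat_sum nr nc f S = mat nr nc (\<lambda>ab. \<Sum>s\<in>S. f s $$ ab)"

text \<open>Vertical and horizontal stacking.  The argument \<open>nc\<close> (\<open>nr\<close>) is the common number of
  columns (rows) of the blocks; it is needed for empty lists of blocks.\<close>

definition vec_stack :: "real vec list \<Rightarrow> real vec" where
  "vec_stack vs = foldr (@\<^sub>v) vs vNil"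

definition vstack :: "nat \<Rightarrow> real mat list \<Rightarrow> real mat" where
  "vstack nc Bs = foldr (@\<^sub>r) Bs (0\<^sub>m 0 nc)"

definition hstack :: "nat \<Rightarrow> real mat list \<Rightarrow> real mat" where
  "hstack nr Bs = (vstack nr (map transpose_mat Bs))\<^sup>T"

text \<open>A \<open>K \<times> K\<close> array of blocks with \<open>bc\<close> columns and \<open>br\<close> rows each,
  block indices running from \<open>1\<close> to \<open>K\<close>.\<close>

definition block_array :: "nat \<Rightarrow> nat \<Rightarrow> nat \<Rightarrow> (nat \<Rightarrow> nat \<Rightarrow> real mat) \<Rightarrow> real mat" where
  "block_array K br bc f =
     vstack (K * bc) (map (\<lambda>k. hstack br (map (\<lambda>\<tau>. f k \<tau>) [1..<Suc K])) [1..<Suc K])"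

definition kron :: "real mat \<Rightarrow> real mat \<Rightarrow> real mat" where
  "kron A B = mat (dim_row A * dim_row B) (dim_col A * dim_col B)
     (\<lambda>(a, b). A $$ (a div dim_row B, b div dim_col B) * B $$ (a mod dim_row B, b mod dim_col B))"


section \<open>The game\<close>

text \<open>Players are numbered \<open>0, \<dots>, N - 1\<close>.  Families indexed by a player and a stage take the
  player first: \<open>Bm G i k\<close> is \<open>B\<^sub>k\<^sup>i\<close>, and \<open>Rm G i j k\<close> is \<open>R\<^sub>k\<^sup>i\<^sup>j\<close>.
  The values at indices outside the ranges of \<open>dgc_wf\<close> are irrelevant.\<close>

record dgc =
  hor :: nat
  npl :: nat
  nx :: nat
  nu :: "nat \<Rightarrow> nat"
  nc :: "nat \<Rightarrow> nat"
  Am :: "nat \<Rightarrow> real mat"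
  Bm :: "nat \<Rightarrow> nat \<Rightarrow> real mat"
  Mm :: "nat \<Rightarrow> nat \<Rightarrow> real mat"
  Nm :: "nat \<Rightarrow> nat \<Rightarrow> real mat"
  rv :: "nat \<Rightarrow> nat \<Rightarrow> real vec"
  Qm :: "nat \<Rightarrow> nat \<Rightarrow> real mat"
  pv :: "nat \<Rightarrow> nat \<Rightarrow> real vec"
  Rm :: "nat \<Rightarrow> nat \<Rightarrow> nat \<Rightarrow> real mat"

definition nu_tot :: "dgc \<Rightarrow> nat" where
  "nu_tot G = (\<Sum>i<npl G. nu G i)"

definition nc_tot :: "dgc \<Rightarrow> nat" where
  "nc_tot G = (\<Sum>i<npl G. nc G i)"

definition dgc_wf :: "dgc \<Rightarrow> bool" where
  "dgc_wf G \<longleftrightarrow>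
     (\<forall>k<hor G. Am G k \<in> carrier_mat (nx G) (nx G)) \<and>
     (\<forall>i<npl G. \<forall>k<hor G.
        Bm G i k \<in> carrier_mat (nx G) (nu G i) \<and>
        Mm G i k \<in> carrier_mat (nc G i) (nx G) \<and>
        Nm G i k \<in> carrier_mat (nc G i) (nu_tot G) \<and>
        rv G i k \<in> carrier_vec (nc G i) \<and>
        (\<forall>j<npl G. Rm G i j k \<in> carrier_mat (nu G j) (nu G j)) \<and>
        (Rm G i i k)\<^sup>T = Rm G i i k) \<and>
     (\<forall>i<npl G. \<forall>k\<le>hor G.
        Qm G i k \<in> carrier_mat (nx G) (nx G) \<and> (Qm G i k)\<^sup>T = Qm G i k \<and>
        pv G i k \<in> carrier_vec (nx G))"

text \<open>\<open>[N\<^sub>k\<^sup>i]\<^sub>j\<close>: the columns of \<open>N\<^sub>k\<^sup>i\<close> that multiply \<open>u\<^sub>k\<^sup>j\<close>.\<close>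

definition Nblk :: "dgc \<Rightarrow> nat \<Rightarrow> nat \<Rightarrow> nat \<Rightarrow> real mat" where
  "Nblk G i j k = mat (nc G i) (nu G j) (\<lambda>(a, b). Nm G i k $$ (a, (\<Sum>l<j. nu G l) + b))"

text \<open>A strategy of one player maps stages to actions; a profile \<open>u\<close> gives \<open>u\<^sub>k\<^sup>i\<close> as \<open>u i k\<close>.\<close>

type_synonym strategy = "nat \<Rightarrow> real vec"
type_synonym profile = "nat \<Rightarrow> strategy"

definition strategies :: "dgc \<Rightarrow> nat \<Rightarrow> strategy set" where
  "strategies G i = {v. \<forall>k<hor G. v k \<in> carrier_vec (nu G i)}"

definition ustage :: "dgc \<Rightarrow> profile \<Rightarrow> nat \<Rightarrow> real vec" where
  "ustage G u k = vec_stack (map (\<lambda>i. u i k) [0..<npl G])"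

definition uK :: "dgc \<Rightarrow> profile \<Rightarrow> real vec" where
  "uK G u = vec_stack (map (ustage G u) [0..<hor G])"

primrec state :: "dgc \<Rightarrow> real vec \<Rightarrow> profile \<Rightarrow> nat \<Rightarrow> real vec" where
  "state G x0 u 0 = x0"
| "state G x0 u (Suc k) = Am G k *\<^sub>v state G x0 u k
     + finsum_vec TYPE(real) (nx G) (\<lambda>i. Bm G i k *\<^sub>v u i k) {..<npl G}"

definition constr :: "dgc \<Rightarrow> real vec \<Rightarrow> profile \<Rightarrow> nat \<Rightarrow> nat \<Rightarrow> bool" where
  "constr G x0 u i k \<longleftrightarrow>
     0\<^sub>v (nc G i) \<le> Mm G i k *\<^sub>v state G x0 u k + Nm G i k *\<^sub>v ustage G u k + rv G i k"

definition cost :: "dgc \<Rightarrow> real vec \<Rightarrow> nat \<Rightarrow> profile \<Rightarrow> real" where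
  "cost G x0 i u = (let x = state G x0 u; K = hor G in
     1/2 * quad (Qm G i K) (x K) + pv G i K \<bullet> x K
     + 1/2 * (\<Sum>k<K. quad (Qm G i k) (x k) + 2 * (pv G i k \<bullet> x k)
                      + (\<Sum>j<npl G. quad (Rm G i j k) (u j k))))"

definition feasible :: "dgc \<Rightarrow> real vec \<Rightarrow> profile set" where
  "feasible G x0 = {u. (\<forall>i<npl G. u i \<in> strategies G i) \<and>
                       (\<forall>i<npl G. \<forall>k<hor G. constr G x0 u i k)}"

definition Omega :: "dgc \<Rightarrow> (real vec \<times> profile) set" where
  "Omega G = {(x0, u). x0 \<in> carrier_vec (nx G) \<and> u \<in> feasible G x0}"

definition X0 :: "dgc \<Rightarrow> real vec set" where
  "X0 G = {x0 \<in> carrier_vec (nx G). feasible G x0 \<noteq> {}}"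

definition admissible :: "dgc \<Rightarrow> real vec \<Rightarrow> nat \<Rightarrow> profile \<Rightarrow> strategy set" where
  "admissible G x0 i u = {v. u(i := v) \<in> feasible G x0}"

definition golne :: "dgc \<Rightarrow> real vec \<Rightarrow> profile \<Rightarrow> bool" where
  "golne G x0 u \<longleftrightarrow> u \<in> feasible G x0 \<and>
     (\<forall>i<npl G. \<forall>v \<in> admissible G x0 i u. cost G x0 i u \<le> cost G x0 i (u(i := v)))"

text \<open>In \<open>golne\<close> a deviation of player \<open>i\<close> must also respect the constraints of the other
  players.  The complementarity problem below has multipliers only for the dependence of
  player \<open>i\<close>'s constraints on player \<open>i\<close>'s own strategy, so its solutions are the feasible
  profiles at which every player is optimal subject to the player's own constraints.
  This implies \<open>golne\<close>, but the converse fails in general.  Two players, one stage, \<open>A = B = 0\<close>,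
  \<open>Q = 0\<close>, \<open>p = 0\<close>, \<open>R\<^sup>1\<^sup>1 = R\<^sup>2\<^sup>2 = 1\<close>, player 1 subject to \<open>-10 \<le> u\<^sup>1 \<le> 10\<close> and player 2 to
  \<open>u\<^sup>1 + u\<^sup>2 \<ge> 1\<close>, \<open>u\<^sup>2 \<le> 10\<close>: then \<open>u\<^sup>1 = u\<^sup>2 = 1/2\<close> is a \<open>golne\<close>, while the complementarity
  problem only yields \<open>u\<^sup>1 = 0\<close>, \<open>u\<^sup>2 = 1\<close>.  The two notions agree, for example, when all
  players have the same constraints.\<close>

definition admissible_own :: "dgc \<Rightarrow> real vec \<Rightarrow> nat \<Rightarrow> profile \<Rightarrow> strategy set" where
  "admissible_own G x0 i u =
     {v \<in> strategies G i. \<forall>k<hor G. constr G x0 (u(i := v)) i k}"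

definition golne_own :: "dgc \<Rightarrow> real vec \<Rightarrow> profile \<Rightarrow> bool" where
  "golne_own G x0 u \<longleftrightarrow> u \<in> feasible G x0 \<and>
     (\<forall>i<npl G. \<forall>v \<in> admissible_own G x0 i u. cost G x0 i u \<le> cost G x0 i (u(i := v)))"


section \<open>Standing assumptions\<close>

definition assumption1 :: "dgc \<Rightarrow> bool" where
  "assumption1 G \<longleftrightarrow>
     Omega G \<noteq> {} \<and>
     (\<forall>x0 \<in> X0 G. \<exists>C. \<forall>u \<in> feasible G x0. \<forall>a < dim_vec (uK G u). \<bar>uK G u $ a\<bar> \<le> C) \<and>
     (\<forall>i<npl G. \<forall>k<hor G. full_rank (Nblk G i i k)) \<and>
     (\<forall>i<npl G. \<forall>k<hor G. pos_def (Rm G i i k))"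

definition Ym :: "dgc \<Rightarrow> (nat \<Rightarrow> nat \<Rightarrow> real mat) \<Rightarrow> nat \<Rightarrow> nat \<Rightarrow> real mat" where
  "Ym G E i k = Rm G i i k + (Bm G i k)\<^sup>T * E i (Suc k) * Bm G i k"

definition riccati_symmetric :: "dgc \<Rightarrow> (nat \<Rightarrow> nat \<Rightarrow> real mat) \<Rightarrow> bool" where
  "riccati_symmetric G E \<longleftrightarrow> (\<forall>i<npl G.
     (\<forall>k\<le>hor G. E i k \<in> carrier_mat (nx G) (nx G)) \<and>
     E i (hor G) = Qm G i (hor G) \<and>
     (\<forall>k<hor G. invertible_mat (Ym G E i k) \<and>
        E i k = (Am G k)\<^sup>T * E i (Suc k) * Am G k + Qm G i k
          - (Am G k)\<^sup>T * E i (Suc k) * Bm G i k * minv (Ym G E i k)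
              * (Bm G i k)\<^sup>T * E i (Suc k) * Am G k))"

definition Lam :: "dgc \<Rightarrow> (nat \<Rightarrow> nat \<Rightarrow> real mat) \<Rightarrow> nat \<Rightarrow> real mat" where
  "Lam G P k = 1\<^sub>m (nx G) + mat_sum (nx G) (nx G)
     (\<lambda>j. Bm G j k * minv (Rm G j j k) * (Bm G j k)\<^sup>T * P j (Suc k)) {..<npl G}"

definition riccati_nash :: "dgc \<Rightarrow> (nat \<Rightarrow> nat \<Rightarrow> real mat) \<Rightarrow> bool" where
  "riccati_nash G P \<longleftrightarrow>
     (\<forall>k<hor G. invertible_mat (Lam G P k)) \<and>
     (\<forall>i<npl G.
        (\<forall>k\<le>hor G. P i k \<in> carrier_mat (nx G) (nx G)) \<and>
        P i (hor G) = Qm G i (hor G) \<and>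
        (\<forall>k<hor G. P i k =
           Qm G i k + (Am G k)\<^sup>T * P i (Suc k) * minv (Lam G P k) * Am G k))"


section \<open>Stage-wise matrices\<close>

definition bR :: "dgc \<Rightarrow> nat \<Rightarrow> real mat" where
  "bR G k = diag_block_mat (map (\<lambda>i. Rm G i i k) [0..<npl G])"

definition bB :: "dgc \<Rightarrow> nat \<Rightarrow> real mat" where
  "bB G k = diag_block_mat (map (\<lambda>i. Bm G i k) [0..<npl G])"

definition bN :: "dgc \<Rightarrow> nat \<Rightarrow> real mat" where
  "bN G k = diag_block_mat (map (\<lambda>i. Nblk G i i k) [0..<npl G])"

definition bM :: "dgc \<Rightarrow> nat \<Rightarrow> real mat" where
  "bM G k = diag_block_mat (map (\<lambda>i. Mm G i k) [0..<npl G])"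

definition Mbar :: "dgc \<Rightarrow> nat \<Rightarrow> real mat" where
  "Mbar G k = vstack (nx G) (map (\<lambda>i. Mm G i k) [0..<npl G])"

definition Nbar :: "dgc \<Rightarrow> nat \<Rightarrow> real mat" where
  "Nbar G k = vstack (nu_tot G) (map (\<lambda>i. Nm G i k) [0..<npl G])"

definition br :: "dgc \<Rightarrow> nat \<Rightarrow> real vec" where
  "br G k = vec_stack (map (\<lambda>i. rv G i k) [0..<npl G])"

definition bp :: "dgc \<Rightarrow> nat \<Rightarrow> real vec" where
  "bp G k = vec_stack (map (\<lambda>i. pv G i k) [0..<npl G])"

definition Pcol :: "dgc \<Rightarrow> (nat \<Rightarrow> nat \<Rightarrow> real mat) \<Rightarrow> nat \<Rightarrow> real mat" where
  "Pcol G P k = vstack (nx G) (map (\<lambda>i. P i k) [0..<npl G])"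

text \<open>The quantities \<open>Gbar\<close>, \<open>Fbar\<close> and \<open>Hm\<close>, written with index \<open>k + 1\<close> on paper, are
  given as functions of \<open>l = k + 1 \<ge> 1\<close>.\<close>

definition Gm :: "dgc \<Rightarrow> (nat \<Rightarrow> nat \<Rightarrow> real mat) \<Rightarrow> nat \<Rightarrow> real mat" where
  "Gm G P k = minv (Lam G P k) * Am G k"

definition Gbar :: "dgc \<Rightarrow> (nat \<Rightarrow> nat \<Rightarrow> real mat) \<Rightarrow> nat \<Rightarrow> real mat" where
  "Gbar G P l = (let k = l - 1 in hstack (nx G)
     (map (\<lambda>i. - (minv (Lam G P k) * Bm G i k * minv (Rm G i i k) * (Bm G i k)\<^sup>T)) [0..<npl G]))"

definition Gtil :: "dgc \<Rightarrow> (nat \<Rightarrow> nat \<Rightarrow> real mat) \<Rightarrow> nat \<Rightarrow> real mat" where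
  "Gtil G P k = hstack (nx G)
     (map (\<lambda>i. minv (Lam G P k) * Bm G i k * minv (Rm G i i k) * (Nblk G i i k)\<^sup>T) [0..<npl G])"

definition Fm :: "dgc \<Rightarrow> (nat \<Rightarrow> nat \<Rightarrow> real mat) \<Rightarrow> nat \<Rightarrow> real mat" where
  "Fm G P k = - (minv (bR G k) * (bB G k)\<^sup>T * Pcol G P (Suc k) * Gm G P k)"

definition Fbar :: "dgc \<Rightarrow> (nat \<Rightarrow> nat \<Rightarrow> real mat) \<Rightarrow> nat \<Rightarrow> real mat" where
  "Fbar G P l = (let k = l - 1 in
     - (minv (bR G k) * (bB G k)\<^sup>T * (1\<^sub>m (npl G * nx G) + Pcol G P l * Gbar G P l)))"

definition Ftil :: "dgc \<Rightarrow> (nat \<Rightarrow> nat \<Rightarrow> real mat) \<Rightarrow> nat \<Rightarrow> real mat" where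
  "Ftil G P k = minv (bR G k) * ((bN G k)\<^sup>T - (bB G k)\<^sup>T * Pcol G P (Suc k) * Gtil G P k)"

definition Hm :: "dgc \<Rightarrow> (nat \<Rightarrow> nat \<Rightarrow> real mat) \<Rightarrow> nat \<Rightarrow> real mat" where
  "Hm G P l = (let k = l - 1 in
     kron (1\<^sub>m (npl G)) ((Am G k)\<^sup>T) * (1\<^sub>m (npl G * nx G) + Pcol G P l * Gbar G P l))"

definition Hbar :: "dgc \<Rightarrow> (nat \<Rightarrow> nat \<Rightarrow> real mat) \<Rightarrow> nat \<Rightarrow> real mat" where
  "Hbar G P k = kron (1\<^sub>m (npl G)) ((Am G k)\<^sup>T) * Pcol G P (Suc k) * Gtil G P k - (bM G k)\<^sup>T"

text \<open>\<open>phi G P k \<tau> = G\<^sub>k\<^sub>-\<^sub>1 \<dots> G\<^sub>\<tau>\<close> for \<open>k \<ge> \<tau>\<close> and \<open>vphi G P k \<tau> = H\<^sub>k\<^sub>+\<^sub>1 \<dots> H\<^sub>\<tau>\<close> for \<open>k \<le> \<tau>\<close>;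
  other arguments are not used.\<close>

fun phi :: "dgc \<Rightarrow> (nat \<Rightarrow> nat \<Rightarrow> real mat) \<Rightarrow> nat \<Rightarrow> nat \<Rightarrow> real mat" where
  "phi G P 0 \<tau> = 1\<^sub>m (nx G)"
| "phi G P (Suc k) \<tau> = (if \<tau> \<le> k then Gm G P k * phi G P k \<tau> else 1\<^sub>m (nx G))"

fun vphi :: "dgc \<Rightarrow> (nat \<Rightarrow> nat \<Rightarrow> real mat) \<Rightarrow> nat \<Rightarrow> nat \<Rightarrow> real mat" where
  "vphi G P k 0 = 1\<^sub>m (npl G * nx G)"
| "vphi G P k (Suc \<tau>) = (if k \<le> \<tau> then vphi G P k \<tau> * Hm G P (Suc \<tau>) else 1\<^sub>m (npl G * nx G))"


section \<open>Aggregated quantities\<close>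

definition pK :: "dgc \<Rightarrow> real vec" where
  "pK G = vec_stack (map (\<lambda>k. bp G (Suc k)) [0..<hor G])"

definition rK :: "dgc \<Rightarrow> real vec" where
  "rK G = vec_stack (map (br G) [0..<hor G])"

definition FK :: "dgc \<Rightarrow> (nat \<Rightarrow> nat \<Rightarrow> real mat) \<Rightarrow> real mat" where
  "FK G P = diag_block_mat (map (Fm G P) [0..<hor G])"

definition FbarK :: "dgc \<Rightarrow> (nat \<Rightarrow> nat \<Rightarrow> real mat) \<Rightarrow> real mat" where
  "FbarK G P = diag_block_mat (map (\<lambda>k. Fbar G P (Suc k)) [0..<hor G])"

definition FtilK :: "dgc \<Rightarrow> (nat \<Rightarrow> nat \<Rightarrow> real mat) \<Rightarrow> real mat" where
  "FtilK G P = diag_block_mat (map (Ftil G P) [0..<hor G])"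

definition MK :: "dgc \<Rightarrow> (nat \<Rightarrow> nat \<Rightarrow> real mat) \<Rightarrow> real mat" where
  "MK G P = diag_block_mat (map (\<lambda>k. Mbar G k + Nbar G k * Fm G P k) [0..<hor G])"

definition NK :: "dgc \<Rightarrow> (nat \<Rightarrow> nat \<Rightarrow> real mat) \<Rightarrow> real mat" where
  "NK G P = diag_block_mat (map (\<lambda>k. Nbar G k * Fbar G P (Suc k)) [0..<hor G])"

definition NtilK :: "dgc \<Rightarrow> (nat \<Rightarrow> nat \<Rightarrow> real mat) \<Rightarrow> real mat" where
  "NtilK G P = diag_block_mat (map (\<lambda>k. Nbar G k * Ftil G P k) [0..<hor G])"

definition Phi0 :: "dgc \<Rightarrow> (nat \<Rightarrow> nat \<Rightarrow> real mat) \<Rightarrow> real mat" where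
  "Phi0 G P = vstack (nx G) (map (\<lambda>k. phi G P (k - 1) 0) [1..<Suc (hor G)])"

definition Phi1 :: "dgc \<Rightarrow> (nat \<Rightarrow> nat \<Rightarrow> real mat) \<Rightarrow> real mat" where
  "Phi1 G P = (let n = nx G; Nn = npl G * nx G in block_array (hor G) n Nn (\<lambda>k \<tau>.
     if k = 1 then 0\<^sub>m n Nn
     else mat_sum n Nn (\<lambda>\<rho>. phi G P (k - 1) \<rho> * Gbar G P \<rho> * vphi G P \<rho> \<tau>) {1..min (k - 1) \<tau>}))"

definition Phi2 :: "dgc \<Rightarrow> (nat \<Rightarrow> nat \<Rightarrow> real mat) \<Rightarrow> real mat" where
  "Phi2 G P = (let n = nx G; Nn = npl G * nx G in block_array (hor G) n (nc_tot G) (\<lambda>k \<tau>.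
     if k = 1 then 0\<^sub>m n (nc_tot G)
     else if \<tau> = 1 then phi G P (k - 1) 1 * Gtil G P 0
     else if \<tau> < k then
       mat_sum n Nn (\<lambda>\<rho>. phi G P (k - 1) \<rho> * Gbar G P \<rho> * vphi G P \<rho> (\<tau> - 1)) {1..\<tau> - 1}
         * Hbar G P (\<tau> - 1)
       + phi G P (k - 1) \<tau> * Gtil G P (\<tau> - 1)
     else
       mat_sum n Nn (\<lambda>\<rho>. phi G P (k - 1) \<rho> * Gbar G P \<rho> * vphi G P \<rho> (\<tau> - 1)) {1..k - 1}
         * Hbar G P (\<tau> - 1)))"

definition Psi1 :: "dgc \<Rightarrow> (nat \<Rightarrow> nat \<Rightarrow> real mat) \<Rightarrow> real mat" where
  "Psi1 G P = (let Nn = npl G * nx G in block_array (hor G) Nn Nn (\<lambda>k \<tau>.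
     if k \<le> \<tau> then vphi G P k \<tau> else 0\<^sub>m Nn Nn))"

definition Psi2 :: "dgc \<Rightarrow> (nat \<Rightarrow> nat \<Rightarrow> real mat) \<Rightarrow> real mat" where
  "Psi2 G P = (let Nn = npl G * nx G in block_array (hor G) Nn (nc_tot G) (\<lambda>k \<tau>.
     if k < \<tau> then vphi G P k (\<tau> - 1) * Hbar G P (\<tau> - 1) else 0\<^sub>m Nn (nc_tot G)))"


section \<open>The linear complementarity problem\<close>

definition lcp_M :: "dgc \<Rightarrow> (nat \<Rightarrow> nat \<Rightarrow> real mat) \<Rightarrow> real mat" where
  "lcp_M G P = MK G P * Phi2 G P + NK G P * Psi2 G P + NtilK G P"

definition lcp_q :: "dgc \<Rightarrow> (nat \<Rightarrow> nat \<Rightarrow> real mat) \<Rightarrow> real vec \<Rightarrow> real vec" where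
  "lcp_q G P x0 = MK G P * Phi0 G P *\<^sub>v x0
     + (MK G P * Phi1 G P + NK G P * Psi1 G P) *\<^sub>v pK G + rK G"

definition sol_F :: "dgc \<Rightarrow> (nat \<Rightarrow> nat \<Rightarrow> real mat) \<Rightarrow> real mat" where
  "sol_F G P = FK G P * Phi2 G P + FbarK G P * Psi2 G P + FtilK G P"

definition sol_P :: "dgc \<Rightarrow> (nat \<Rightarrow> nat \<Rightarrow> real mat) \<Rightarrow> real vec \<Rightarrow> real vec" where
  "sol_P G P x0 = FK G P * Phi0 G P *\<^sub>v x0
     + (FK G P * Phi1 G P + FbarK G P * Psi1 G P) *\<^sub>v pK G"

definition lcp_solution :: "real mat \<Rightarrow> real vec \<Rightarrow> real vec \<Rightarrow> bool" where
  "lcp_solution M q \<mu> \<longleftrightarrow> \<mu> \<in> carrier_vec (dim_vec q) \<and>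
     0\<^sub>v (dim_vec q) \<le> M *\<^sub>v \<mu> + q \<and> 0\<^sub>v (dim_vec q) \<le> \<mu> \<and> (M *\<^sub>v \<mu> + q) \<bullet> \<mu> = 0"

end

theory Submission
  imports Defs
begin

text \<open>
  For a fixed profile of the others, player \<open>i\<close>'s cost along the own deviations \<open>d\<close> is
  \<open>J + slope d + curvature d / 2\<close>. Completing squares with the symmetric Riccati solution \<open>E\<close> writes
  the curvature as a sum of terms \<open>\<parallel>d\<^sub>k + \<dots>\<parallel>\<close> weighted by \<open>Y\<^sub>k\<^sup>i\<close>, so it is nonnegative and the KKT
  conditions are sufficient; Farkas' lemma applied to the linearised active constraints makes them
  necessary. No constraint qualification is needed because all constraints are affine.

  Given multipliers \<open>\<mu>\<close>, the costates of the stationarity conditions of all players are sought in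
  the form \<open>\<lambda>\<^sub>k\<^sup>i = P\<^sub>k\<^sup>i x\<^sub>k + \<beta>\<^sub>k\<^sup>i\<close>. The Riccati equation for \<open>P\<close> decouples the two-point boundary
  value problem into a backward recursion for \<open>\<beta>\<close> and a forward recursion for \<open>x\<close>; the matrices
  \<open>\<Psi>\<^sub>1\<close>, \<open>\<Psi>\<^sub>2\<close> and \<open>\<Phi>\<^sub>0\<close>, \<open>\<Phi>\<^sub>1\<close>, \<open>\<Phi>\<^sub>2\<close> are their solution operators. Stationarity is
  therefore \<open>u = F \<mu> + P(x\<^sub>0)\<close>, the constraint values along this profile are \<open>M \<mu> + q(x\<^sub>0)\<close>, and
  what remains of the KKT conditions is the complementarity problem.
\<close>

section \<open>Block vectors and matrices\<close>

text \<open>Two Riccati equations enter for different reasons. \<open>E\<close> belongs to one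
  player with the inputs of all others frozen and only controls the sign of that player's curvature.
  \<open>P\<close> couples all players and serves to solve the stationarity system explicitly. The
  obstacle in the coupled system is that a stationary input at stage k involves the costate at k+1,
  hence the state that this very input helps to produce. With the ansatz for the costates this
  becomes a linear fixed-point equation for the next state, and \<open>Lam\<close> is precisely its
  matrix; the inverses of \<open>Lam\<close> in \<open>Gm\<close>, \<open>Gbar\<close> and
  \<open>Gtil\<close> come from there. Each player has multipliers for the player's own constraints
  only. The equilibrium notion that matches them is \<open>golne_own\<close>; \<open>golne\<close>
  follows because it admits fewer deviations. The block matrices are handled through their action on
  stacked vectors, which replaces computations with flat indices.\<close>

definition vsum :: "nat \<Rightarrow> ('i \<Rightarrow> real vec) \<Rightarrow> 'i set \<Rightarrow> real vec" where
  "vsum n f S = vec n (\<lambda>a. \<Sum>s\<in>S. f s $ a)"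

lemma vsum_carrier [simp]: "vsum n f S \<in> carrier_vec n"
  by (simp add: vsum_def)

lemma dim_vsum [simp]: "dim_vec (vsum n f S) = n"
  by (simp add: vsum_def)

lemma index_vsum [simp]: "a < n \<Longrightarrow> vsum n f S $ a = (\<Sum>s\<in>S. f s $ a)"
  by (simp add: vsum_def)

lemma vsum_cong: "S = T \<Longrightarrow> (\<And>s. s \<in> T \<Longrightarrow> f s = g s) \<Longrightarrow> vsum n f S = vsum n g T"
  by (simp add: vsum_def)

text \<open>\<open>finsum_vec\<close> comes from \<open>state\<close> and is controlled only for
  summands of the right dimension. The componentwise \<open>vsum\<close> is total, so its entries
  can be rewritten without carrier conditions.\<close>

lemma finsum_vec_vsum:
  assumes "finite S" "\<And>s. s \<in> S \<Longrightarrow> f s \<in> carrier_vec n"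
  shows "finsum_vec TYPE(real) n f S = vsum n f S"
proof (rule eq_vecI)
  have c: "f \<in> S \<rightarrow> carrier_vec n" using assms by auto
  have d: "finsum_vec TYPE(real) n f S \<in> carrier_vec n"
    using finsum_vec_closed[OF c] by simp
  then show "dim_vec (finsum_vec TYPE(real) n f S) = dim_vec (vsum n f S)" by simp
  show "finsum_vec TYPE(real) n f S $ a = vsum n f S $ a" if "a < dim_vec (vsum n f S)" for a
    using that index_finsum_vec[OF assms(1) _ c] by simp
qed

lemma mult_mat_vec_index_sum:
  fixes A :: "real mat"
  assumes "A \<in> carrier_mat r c" "v \<in> carrier_vec c" "a < r"
  shows "(A *\<^sub>v v) $ a = (\<Sum>b<c. A $$ (a, b) * v $ b)"
  using assms by (auto simp: scalar_prod_def lessThan_atLeast0)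

lemma mult_mat_vsum:
  assumes "A \<in> carrier_mat r n" "\<And>s. s \<in> S \<Longrightarrow> f s \<in> carrier_vec n"
  shows "A *\<^sub>v vsum n f S = vsum r (\<lambda>s. A *\<^sub>v f s) S"
proof (rule eq_vecI)
  fix a assume "a < dim_vec (vsum r (\<lambda>s. A *\<^sub>v f s) S)"
  then have a: "a < r" by simp
  have "(A *\<^sub>v vsum n f S) $ a = (\<Sum>b<n. A $$ (a, b) * (\<Sum>s\<in>S. f s $ b))"
    unfolding mult_mat_vec_index_sum[OF assms(1) vsum_carrier a] by (intro sum.cong) auto
  also have "\<dots> = (\<Sum>s\<in>S. \<Sum>b<n. A $$ (a, b) * f s $ b)"
    by (subst sum.swap) (simp add: sum_distrib_left)
  also have "\<dots> = (\<Sum>s\<in>S. (A *\<^sub>v f s) $ a)"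
    using assms(2) by (intro sum.cong refl mult_mat_vec_index_sum[OF assms(1) _ a, symmetric])
  finally show "(A *\<^sub>v vsum n f S) $ a = vsum r (\<lambda>s. A *\<^sub>v f s) S $ a" using a by simp
qed (use assms in auto)

lemma mat_sum_carrier [simp]: "mat_sum nr cl f S \<in> carrier_mat nr cl"
  by (simp add: mat_sum_def)

lemma mat_sum_mult_vec:
  assumes "v \<in> carrier_vec c" "\<And>s. s \<in> S \<Longrightarrow> f s \<in> carrier_mat r c"
  shows "mat_sum r c f S *\<^sub>v v = vsum r (\<lambda>s. f s *\<^sub>v v) S"
proof (rule eq_vecI)
  fix a assume "a < dim_vec (vsum r (\<lambda>s. f s *\<^sub>v v) S)"
  then have a: "a < r" by simp
  have "(mat_sum r c f S *\<^sub>v v) $ a = (\<Sum>b<c. (\<Sum>s\<in>S. f s $$ (a, b)) * v $ b)"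
    unfolding mult_mat_vec_index_sum[OF mat_sum_carrier assms(1) a] using a by (simp add: mat_sum_def)
  also have "\<dots> = (\<Sum>s\<in>S. \<Sum>b<c. f s $$ (a, b) * v $ b)"
    by (subst sum.swap) (simp add: sum_distrib_right)
  also have "\<dots> = (\<Sum>s\<in>S. (f s *\<^sub>v v) $ a)"
    using assms by (intro sum.cong refl mult_mat_vec_index_sum[OF _ _ a, symmetric])
  finally show "(mat_sum r c f S *\<^sub>v v) $ a = vsum r (\<lambda>s. f s *\<^sub>v v) S $ a" using a by simp
qed (auto simp: mat_sum_def)

text \<open>A product acts column by column, and the columns of \<open>mat_sum\<close> are the
  \<open>vsum\<close> of the columns, so \<open>mult_mat_vsum\<close> applies.\<close>

lemma mat_sum_mult_left:
  assumes "A \<in> carrier_mat n r" "\<And>s. s \<in> S \<Longrightarrow> f s \<in> carrier_mat r c"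
  shows "A * mat_sum r c f S = mat_sum n c (\<lambda>s. A * f s) S"
proof (rule eq_matI)
  fix a b assume "a < dim_row (mat_sum n c (\<lambda>s. A * f s) S)" "b < dim_col (mat_sum n c (\<lambda>s. A * f s) S)"
  then have ab: "a < n" "b < c" by (auto simp: mat_sum_def)
  have f: "dim_row (f s) = r" "dim_col (f s) = c" "col (f s) b \<in> carrier_vec r" if "s \<in> S" for s
    using assms(2)[OF that] by auto
  have "col (mat_sum r c f S) b = vsum r (\<lambda>s. col (f s) b) S"
    using ab f by (intro eq_vecI) (auto simp: mat_sum_def)
  then have "(A * mat_sum r c f S) $$ (a, b) = (A *\<^sub>v vsum r (\<lambda>s. col (f s) b) S) $ a"
    using assms(1) ab by (simp add: mat_sum_def)
  also have "\<dots> = (\<Sum>s\<in>S. (A * f s) $$ (a, b))"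
    by (subst mult_mat_vsum[OF assms(1) f(3)]) (use assms(1) ab f in auto)
  finally show "(A * mat_sum r c f S) $$ (a, b) = mat_sum n c (\<lambda>s. A * f s) S $$ (a, b)"
    using ab by (simp add: mat_sum_def)
qed (use assms in \<open>auto simp: mat_sum_def\<close>)

lemma mat_sum_insert:
  assumes "finite S" "s \<notin> S" "f s \<in> carrier_mat nr cl"
  shows "mat_sum nr cl f (insert s S) = mat_sum nr cl f S + f s"
  using assms by (intro eq_matI) (auto simp: mat_sum_def)

lemma mat_sum_cong: "S = T \<Longrightarrow> (\<And>s. s \<in> T \<Longrightarrow> f s = g s) \<Longrightarrow> mat_sum nr cl f S = mat_sum nr cl g T"
  by (simp add: mat_sum_def)

lemma mat_sum_empty [simp]: "mat_sum nr cl f {} = 0\<^sub>m nr cl"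
  by (intro eq_matI) (auto simp: mat_sum_def)

section \<open>Stacked vectors\<close>

lemma dim_append_vec [simp]: "dim_vec (v @\<^sub>v w) = dim_vec v + dim_vec w"
  by (simp add: append_vec_def Let_def)

abbreviation stack :: "nat \<Rightarrow> (nat \<Rightarrow> real vec) \<Rightarrow> real vec" where
  "stack N v \<equiv> vec_stack (map v [0..<N])"

lemma dim_vec_stack: "dim_vec (vec_stack vs) = sum_list (map dim_vec vs)"
  by (induction vs) (auto simp: vec_stack_def)

lemma vec_stack_Nil [simp]: "vec_stack [] = vNil"
  by (simp add: vec_stack_def)

lemma vec_stack_Cons [simp]: "vec_stack (v # vs) = v @\<^sub>v vec_stack vs"
  by (simp add: vec_stack_def)

lemma dim_vec_stack_map:
  assumes "\<And>i. i < N \<Longrightarrow> v i \<in> carrier_vec (d i)"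
  shows "dim_vec (stack N v) = (\<Sum>i<N. d i)"
proof -
  have "map dim_vec (map v [0..<N]) = map d [0..<N]"
    using assms by auto
  then show ?thesis by (simp only: dim_vec_stack interv_sum_list_conv_sum_set_nat) (simp add: lessThan_atLeast0)
qed

lemma vec_stack_carrier:
  assumes "\<And>i. i < N \<Longrightarrow> v i \<in> carrier_vec (d i)"
  shows "stack N v \<in> carrier_vec (\<Sum>i<N. d i)"
  using dim_vec_stack_map[of N v d] assms by (metis carrier_vec_dim_vec)

text \<open>Stacks are folded from the front, so inductions over them peel off block 0 and shift the
  remaining family by \<open>Suc\<close>; hence their generalisation over the family and its
  dimensions.\<close>

lemma map_upt_Suc_conv: "map v [0..<Suc N] = v 0 # map (\<lambda>i. v (Suc i)) [0..<N]"
  by (metis map_upt_Suc)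

text \<open>Lets an arbitrary vector of the right length be read as blocks: a solution of the
  complementarity problem splits into stages and players, a costate offset into players.\<close>

lemma vec_stack_surj:
  assumes "v \<in> carrier_vec (\<Sum>i<N. d i)"
  shows "\<exists>w. (\<forall>i<N. w i \<in> carrier_vec (d i)) \<and> v = stack N w"
  using assms
proof (induction N arbitrary: v d)
  case 0
  then show ?case by (auto intro!: exI[of _ undefined] eq_vecI)
next
  case (Suc N)
  let ?v1 = "vec_first v (d 0)" and ?v2 = "vec_last v (\<Sum>i<N. d (Suc i))"
  have s: "(\<Sum>i<Suc N. d i) = d 0 + (\<Sum>i<N. d (Suc i))" by (rule sum.lessThan_Suc_shift)
  then have v: "?v1 @\<^sub>v ?v2 = v" using Suc.prems by (intro vec_first_last_append) auto
  obtain w where w: "\<forall>i<N. w i \<in> carrier_vec (d (Suc i))" "?v2 = stack N w"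
    using Suc.IH[of ?v2 "\<lambda>i. d (Suc i)"] by auto
  show ?case
    \<comment> \<open>The witness puts the first block at index 0 and moves the blocks of the tail
      up by one.\<close>
    using w v by (intro exI[of _ "case_nat ?v1 w"])
      (auto simp: map_upt_Suc_conv simp del: upt_Suc split: nat.split)
qed

lemma vec_stack_eq_iff:
  assumes "\<And>i. i < N \<Longrightarrow> v i \<in> carrier_vec (d i)" "\<And>i. i < N \<Longrightarrow> w i \<in> carrier_vec (d i)"
  shows "stack N v = stack N w \<longleftrightarrow> (\<forall>i<N. v i = w i)"
  using assms
proof (induction N arbitrary: v w d)
  case (Suc N)
  have "v 0 \<in> carrier_vec (d 0)" "w 0 \<in> carrier_vec (d 0)" using Suc.prems by auto
  then have "stack (Suc N) v = stack (Suc N) w \<longleftrightarrow>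
    v 0 = w 0 \<and> stack N (\<lambda>i. v (Suc i)) = stack N (\<lambda>i. w (Suc i))"
    unfolding map_upt_Suc_conv vec_stack_Cons by (rule append_vec_eq)
  also have "\<dots> \<longleftrightarrow> v 0 = w 0 \<and> (\<forall>i<N. v (Suc i) = w (Suc i))"
    using Suc.IH[of "\<lambda>i. v (Suc i)" "\<lambda>i. d (Suc i)" "\<lambda>i. w (Suc i)"] Suc.prems by auto
  also have "\<dots> \<longleftrightarrow> (\<forall>i<Suc N. v i = w i)" by (simp add: less_Suc_eq_0_disj) blast
  finally show ?case .
qed simp

lemma vec_stack_add:
  assumes "\<And>i. i < N \<Longrightarrow> v i \<in> carrier_vec (d i)" "\<And>i. i < N \<Longrightarrow> w i \<in> carrier_vec (d i)"
  shows "stack N v + stack N w = stack N (\<lambda>i. v i + w i)"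
  using assms
proof (induction N arbitrary: v w d)
  case (Suc N)
  have c: "v 0 \<in> carrier_vec (d 0)" "w 0 \<in> carrier_vec (d 0)" using Suc.prems by auto
  have "stack N (\<lambda>i. v (Suc i)) \<in> carrier_vec (\<Sum>i<N. d (Suc i))"
    "stack N (\<lambda>i. w (Suc i)) \<in> carrier_vec (\<Sum>i<N. d (Suc i))"
    using Suc.prems by (auto intro!: vec_stack_carrier)
  then have "stack (Suc N) v + stack (Suc N) w
    = (v 0 + w 0) @\<^sub>v (stack N (\<lambda>i. v (Suc i)) + stack N (\<lambda>i. w (Suc i)))"
    unfolding map_upt_Suc_conv vec_stack_Cons using c by (intro append_vec_add) auto
  then show ?case
    using Suc.IH[of "\<lambda>i. v (Suc i)" "\<lambda>i. d (Suc i)" "\<lambda>i. w (Suc i)"] Suc.prems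
    by (simp add: map_upt_Suc_conv del: upt_Suc)
qed (auto intro!: eq_vecI)

lemma vec_stack_scalar_prod:
  assumes "\<And>i. i < N \<Longrightarrow> v i \<in> carrier_vec (d i)" "\<And>i. i < N \<Longrightarrow> w i \<in> carrier_vec (d i)"
  shows "stack N v \<bullet> stack N w = (\<Sum>i<N. v i \<bullet> w i)"
  using assms
proof (induction N arbitrary: v w d)
  case (Suc N)
  have c: "v 0 \<in> carrier_vec (d 0)" "w 0 \<in> carrier_vec (d 0)" using Suc.prems by auto
  have "stack N (\<lambda>i. v (Suc i)) \<in> carrier_vec (\<Sum>i<N. d (Suc i))"
    "stack N (\<lambda>i. w (Suc i)) \<in> carrier_vec (\<Sum>i<N. d (Suc i))"
    using Suc.prems by (auto intro!: vec_stack_carrier)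
  then have "stack (Suc N) v \<bullet> stack (Suc N) w
    = v 0 \<bullet> w 0 + stack N (\<lambda>i. v (Suc i)) \<bullet> stack N (\<lambda>i. w (Suc i))"
    unfolding map_upt_Suc_conv vec_stack_Cons using c by (intro scalar_prod_append) auto
  then show ?case
    using Suc.IH[of "\<lambda>i. v (Suc i)" "\<lambda>i. d (Suc i)" "\<lambda>i. w (Suc i)"] Suc.prems
    by (simp add: sum.lessThan_Suc_shift del: upt_Suc sum.lessThan_Suc)
qed (auto simp: scalar_prod_def)

lemma append_vec_nonneg_iff:
  "(0\<^sub>v (n1 + n2) :: real vec) \<le> v @\<^sub>v w \<longleftrightarrow> 0\<^sub>v n1 \<le> v \<and> 0\<^sub>v n2 \<le> w"
  if "v \<in> carrier_vec n1" "w \<in> carrier_vec n2"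
proof -
  have "(\<forall>i<n1 + n2. 0 \<le> (v @\<^sub>v w) $ i) \<longleftrightarrow> (\<forall>i<n1. 0 \<le> v $ i) \<and> (\<forall>j<n2. 0 \<le> w $ j)"
  proof (intro iffI conjI allI impI)
    assume h: "\<forall>i<n1 + n2. 0 \<le> (v @\<^sub>v w) $ i"
    show "0 \<le> v $ i" if "i < n1" for i using h[rule_format, of i] that \<open>v \<in> _\<close> by simp
    show "0 \<le> w $ j" if "j < n2" for j
      using h[rule_format, of "n1 + j"] that \<open>v \<in> _\<close> \<open>w \<in> _\<close> by simp
  qed (use that in auto)
  then show ?thesis using that by (auto simp: less_eq_vec_def)
qed

lemma vec_stack_nonneg_iff:
  assumes "\<And>i. i < N \<Longrightarrow> v i \<in> carrier_vec (d i)"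
  shows "0\<^sub>v (\<Sum>i<N. d i) \<le> stack N v \<longleftrightarrow> (\<forall>i<N. 0\<^sub>v (d i) \<le> v i)"
  using assms
proof (induction N arbitrary: v d)
  case (Suc N)
  have "stack N (\<lambda>i. v (Suc i)) \<in> carrier_vec (\<Sum>i<N. d (Suc i))"
    using Suc.prems by (auto intro!: vec_stack_carrier)
  moreover have "v 0 \<in> carrier_vec (d 0)" using Suc.prems by auto
  ultimately have "0\<^sub>v (\<Sum>i<Suc N. d i) \<le> stack (Suc N) v \<longleftrightarrow> 0\<^sub>v (d 0) \<le> v 0 \<and>
    0\<^sub>v (\<Sum>i<N. d (Suc i)) \<le> stack N (\<lambda>i. v (Suc i))"
    unfolding sum.lessThan_Suc_shift map_upt_Suc_conv vec_stack_Cons by (rule append_vec_nonneg_iff[rotated])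
  also have "\<dots> \<longleftrightarrow> 0\<^sub>v (d 0) \<le> v 0 \<and> (\<forall>i<N. 0\<^sub>v (d (Suc i)) \<le> v (Suc i))"
    using Suc.IH[of "\<lambda>i. v (Suc i)" "\<lambda>i. d (Suc i)"] Suc.prems by auto
  also have "\<dots> \<longleftrightarrow> (\<forall>i<Suc N. 0\<^sub>v (d i) \<le> v i)" by (simp add: less_Suc_eq_0_disj) blast
  finally show ?case .
qed (simp add: less_eq_vec_def)

section \<open>Stacked matrices and block arrays\<close>

lemma vstack_Cons [simp]: "vstack cl (B # Bs) = B @\<^sub>r vstack cl Bs"
  by (simp add: vstack_def)

lemma vstack_Nil [simp]: "vstack cl [] = 0\<^sub>m 0 cl"
  by (simp add: vstack_def)

lemma vstack_carrier:
  assumes "\<And>i. i < N \<Longrightarrow> B i \<in> carrier_mat (d i) cl"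
  shows "vstack cl (map B [0..<N]) \<in> carrier_mat (\<Sum>i<N. d i) cl"
  using assms
proof (induction N arbitrary: B d)
  case (Suc N)
  have "vstack cl (map (\<lambda>i. B (Suc i)) [0..<N]) \<in> carrier_mat (\<Sum>i<N. d (Suc i)) cl"
    using Suc.IH[of "\<lambda>i. B (Suc i)" "\<lambda>i. d (Suc i)"] Suc.prems by auto
  then show ?case
    unfolding map_upt_Suc_conv vstack_Cons sum.lessThan_Suc_shift
    using Suc.prems[of 0] by (intro carrier_append_rows) auto
qed auto

lemma vstack_mult_vec:
  assumes "\<And>i. i < N \<Longrightarrow> B i \<in> carrier_mat (d i) cl" "x \<in> carrier_vec cl"
  shows "vstack cl (map B [0..<N]) *\<^sub>v x = stack N (\<lambda>i. B i *\<^sub>v x)"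
  using assms(1)
proof (induction N arbitrary: B d)
  case (Suc N)
  have "vstack cl (map (\<lambda>i. B (Suc i)) [0..<N]) \<in> carrier_mat (\<Sum>i<N. d (Suc i)) cl"
    using Suc.prems by (intro vstack_carrier) auto
  then have "vstack cl (map B [0..<Suc N]) *\<^sub>v x = B 0 *\<^sub>v x @\<^sub>v vstack cl (map (\<lambda>i. B (Suc i)) [0..<N]) *\<^sub>v x"
    unfolding map_upt_Suc_conv vstack_Cons using Suc.prems[of 0] assms(2) by (intro mat_mult_append) auto
  then show ?case
    unfolding map_upt_Suc_conv[of "\<lambda>i. B i *\<^sub>v x"]
    using Suc.IH[of "\<lambda>i. B (Suc i)" "\<lambda>i. d (Suc i)"] Suc.prems by simp
qed (auto intro!: eq_vecI)

lemma hstack_carrier: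
  assumes "\<And>i. i < N \<Longrightarrow> B i \<in> carrier_mat nr (d i)"
  shows "hstack nr (map B [0..<N]) \<in> carrier_mat nr (\<Sum>i<N. d i)"
  unfolding hstack_def map_map o_def using assms by (intro transpose_carrier_mat[THEN iffD2] vstack_carrier) auto

text \<open>\<open>hstack\<close> is encoded as a transposed vertical stack. A column of the stacked
  matrix is a concatenation of columns, and its scalar product with a concatenated vector
  splits.\<close>

lemma transpose_append_rows_mult:
  fixes A B :: "real mat"
  assumes "A \<in> carrier_mat n1 cl" "B \<in> carrier_mat n2 cl" "x \<in> carrier_vec n1" "y \<in> carrier_vec n2"
  shows "(A @\<^sub>r B)\<^sup>T *\<^sub>v (x @\<^sub>v y) = A\<^sup>T *\<^sub>v x + B\<^sup>T *\<^sub>v y"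
proof (rule eq_vecI)
  fix a assume "a < dim_vec (A\<^sup>T *\<^sub>v x + B\<^sup>T *\<^sub>v y)"
  then have a: "a < cl" using assms by auto
  have AB: "A @\<^sub>r B \<in> carrier_mat (n1 + n2) cl" using assms by auto
  have "col (A @\<^sub>r B) a = col A a @\<^sub>v col B a"
    using a assms AB by (intro eq_vecI) (auto simp: append_rows_def)
  then have "((A @\<^sub>r B)\<^sup>T *\<^sub>v (x @\<^sub>v y)) $ a = (col A a @\<^sub>v col B a) \<bullet> (x @\<^sub>v y)"
    using a AB by auto
  also have "\<dots> = col A a \<bullet> x + col B a \<bullet> y" using assms by (intro scalar_prod_append) auto
  finally show "((A @\<^sub>r B)\<^sup>T *\<^sub>v (x @\<^sub>v y)) $ a = (A\<^sup>T *\<^sub>v x + B\<^sup>T *\<^sub>v y) $ a" using a assms by auto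
qed (use assms carrier_matD[OF carrier_append_rows[OF assms(1,2)]] in auto)

lemma hstack_mult_vec_stack:
  assumes "\<And>i. i < N \<Longrightarrow> B i \<in> carrier_mat nr (d i)" "\<And>i. i < N \<Longrightarrow> v i \<in> carrier_vec (d i)"
  shows "hstack nr (map B [0..<N]) *\<^sub>v stack N v = vsum nr (\<lambda>i. B i *\<^sub>v v i) {..<N}"
  using assms
proof (induction N arbitrary: B v d)
  case 0
  then show ?case by (auto intro!: eq_vecI simp: hstack_def)
next
  case (Suc N)
  have B: "B 0 \<in> carrier_mat nr (d 0)" "v 0 \<in> carrier_vec (d 0)" using Suc.prems by auto
  have "vstack nr (map (\<lambda>i. (B (Suc i))\<^sup>T) [0..<N]) \<in> carrier_mat (\<Sum>i<N. d (Suc i)) nr"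
    using Suc.prems by (intro vstack_carrier) auto
  moreover have "stack N (\<lambda>i. v (Suc i)) \<in> carrier_vec (\<Sum>i<N. d (Suc i))"
    using Suc.prems by (auto intro!: vec_stack_carrier)
  ultimately have "hstack nr (map B [0..<Suc N]) *\<^sub>v stack (Suc N) v
     = B 0 *\<^sub>v v 0 + hstack nr (map (\<lambda>i. B (Suc i)) [0..<N]) *\<^sub>v stack N (\<lambda>i. v (Suc i))"
    unfolding hstack_def map_map o_def map_upt_Suc_conv vec_stack_Cons list.map vstack_Cons
    using B by (subst transpose_append_rows_mult[of _ "d 0" nr _ "\<Sum>i<N. d (Suc i)"]) auto
  also have "\<dots> = B 0 *\<^sub>v v 0 + vsum nr (\<lambda>i. B (Suc i) *\<^sub>v v (Suc i)) {..<N}"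
    using Suc.IH[of "\<lambda>i. B (Suc i)" "\<lambda>i. d (Suc i)" "\<lambda>i. v (Suc i)"] Suc.prems by simp
  also have "\<dots> = vsum nr (\<lambda>i. B i *\<^sub>v v i) {..<Suc N}"
    by (intro eq_vecI) (use B in \<open>auto simp: sum.lessThan_Suc_shift simp del: sum.lessThan_Suc index_mult_mat_vec\<close>)
  finally show ?case .
qed

text \<open>Block arrays are indexed from 1, stacks from 0; from here on the block in row k and
  column t of an array is \<open>f (Suc k) (Suc t)\<close>.\<close>

lemma map_upt_1_Suc: "map f [1..<Suc K] = map (\<lambda>k. f (Suc k)) [0..<K]"
  unfolding One_nat_def map_Suc_upt[symmetric] map_map o_def ..

lemma block_array_alt: "block_array K rw cw f =
  vstack (K * cw) (map (\<lambda>k. hstack rw (map (\<lambda>t. f (Suc k) (Suc t)) [0..<K])) [0..<K])"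
  unfolding block_array_def map_upt_1_Suc ..

lemma block_array_carrier:
  assumes "\<And>k t. 1 \<le> k \<Longrightarrow> k \<le> K \<Longrightarrow> 1 \<le> t \<Longrightarrow> t \<le> K \<Longrightarrow> f k t \<in> carrier_mat rw cw"
  shows "block_array K rw cw f \<in> carrier_mat (K * rw) (K * cw)"
proof -
  have "hstack rw (map (\<lambda>t. f (Suc k) (Suc t)) [0..<K]) \<in> carrier_mat rw (K * cw)" if "k < K" for k
    using hstack_carrier[of K "\<lambda>t. f (Suc k) (Suc t)" rw "\<lambda>_. cw"] assms that by simp
  then show ?thesis
    unfolding block_array_alt
    using vstack_carrier[of K "\<lambda>k. hstack rw (map (\<lambda>t. f (Suc k) (Suc t)) [0..<K])" "\<lambda>_. rw" "K * cw"] by simp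
qed

lemma block_array_mult_vec_stack:
  assumes "\<And>k t. 1 \<le> k \<Longrightarrow> k \<le> K \<Longrightarrow> 1 \<le> t \<Longrightarrow> t \<le> K \<Longrightarrow> f k t \<in> carrier_mat rw cw"
    "\<And>t. t < K \<Longrightarrow> v t \<in> carrier_vec cw"
  shows "block_array K rw cw f *\<^sub>v stack K v =
    stack K (\<lambda>k. vsum rw (\<lambda>t. f (Suc k) (Suc t) *\<^sub>v v t) {..<K})"
proof -
  have h: "hstack rw (map (\<lambda>t. f (Suc k) (Suc t)) [0..<K]) \<in> carrier_mat rw (K * cw)" if "k < K" for k
    using hstack_carrier[of K "\<lambda>t. f (Suc k) (Suc t)" rw "\<lambda>_. cw"] assms that by simp
  have v: "stack K v \<in> carrier_vec (K * cw)"
    using vec_stack_carrier[of K v "\<lambda>_. cw"] assms by simp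
  have "block_array K rw cw f *\<^sub>v stack K v = stack K (\<lambda>k.
      hstack rw (map (\<lambda>t. f (Suc k) (Suc t)) [0..<K]) *\<^sub>v stack K v)"
    unfolding block_array_alt using h v by (rule vstack_mult_vec)
  also have "\<dots> = stack K (\<lambda>k. vsum rw (\<lambda>t. f (Suc k) (Suc t) *\<^sub>v v t) {..<K})"
  proof (rule arg_cong[of _ _ vec_stack], rule map_cong[OF refl])
    fix k assume "k \<in> set [0..<K]"
    then show "hstack rw (map (\<lambda>t. f (Suc k) (Suc t)) [0..<K]) *\<^sub>v stack K v
      = vsum rw (\<lambda>t. f (Suc k) (Suc t) *\<^sub>v v t) {..<K}"
      using assms by (intro hstack_mult_vec_stack[where d = "\<lambda>_. cw"]) auto
  qed
  finally show ?thesis .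
qed

section \<open>Block diagonal matrices, Kronecker products and column blocks\<close>

lemma diag_block_mat_carrier:
  assumes "\<And>i. i < N \<Longrightarrow> B i \<in> carrier_mat (r i) (c i)"
  shows "diag_block_mat (map B [0..<N]) \<in> carrier_mat (\<Sum>i<N. r i) (\<Sum>i<N. c i)"
proof -
  have "map dim_row (map B [0..<N]) = map r [0..<N]" "map dim_col (map B [0..<N]) = map c [0..<N]"
    using carrier_matD[OF assms] by simp_all
  then show ?thesis
    by (intro carrier_matI) (simp_all only: dim_diag_block_mat interv_sum_list_conv_sum_set_nat lessThan_atLeast0 set_upt)
qed

lemma diag_block_mat_mult_vec_stack:
  assumes "\<And>i. i < N \<Longrightarrow> B i \<in> carrier_mat (r i) (c i)" "\<And>i. i < N \<Longrightarrow> v i \<in> carrier_vec (c i)"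
  shows "diag_block_mat (map B [0..<N]) *\<^sub>v stack N v = stack N (\<lambda>i. B i *\<^sub>v v i)"
  using assms
proof (induction N arbitrary: B v r c)
  case 0
  then show ?case by (auto intro!: eq_vecI)
next
  case (Suc N)
  let ?D = "diag_block_mat (map (\<lambda>i. B (Suc i)) [0..<N])"
  let ?w = "stack N (\<lambda>i. v (Suc i))"
  have D: "?D \<in> carrier_mat (\<Sum>i<N. r (Suc i)) (\<Sum>i<N. c (Suc i))"
    using Suc.prems by (intro diag_block_mat_carrier) auto
  have w: "?w \<in> carrier_vec (\<Sum>i<N. c (Suc i))" using Suc.prems by (intro vec_stack_carrier) auto
  have B: "B 0 \<in> carrier_mat (r 0) (c 0)" "v 0 \<in> carrier_vec (c 0)" using Suc.prems by auto
  have Bv: "B 0 *\<^sub>v v 0 \<in> carrier_vec (r 0)" using B by auto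
  have Dw: "?D *\<^sub>v ?w \<in> carrier_vec (\<Sum>i<N. r (Suc i))" using D w by auto
  have "diag_block_mat (map B [0..<Suc N]) *\<^sub>v stack (Suc N) v
     = (B 0 *\<^sub>v v 0) @\<^sub>v (?D *\<^sub>v ?w)"
    unfolding map_upt_Suc_conv vec_stack_Cons diag_block_mat.simps Let_def
    using D w B Bv Dw by (subst four_block_mat_mult_vec[of _ "r 0" "c 0" _ "\<Sum>i<N. c (Suc i)" _ "\<Sum>i<N. r (Suc i)"]) auto
  also have "?D *\<^sub>v ?w = stack N (\<lambda>i. B (Suc i) *\<^sub>v v (Suc i))"
    using Suc.IH[of "\<lambda>i. B (Suc i)" "\<lambda>i. r (Suc i)" "\<lambda>i. c (Suc i)" "\<lambda>i. v (Suc i)"] Suc.prems by simp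
  finally show ?case unfolding map_upt_Suc_conv vec_stack_Cons .
qed

lemma transpose_diag_block_mat: "(diag_block_mat Bs)\<^sup>T = diag_block_mat (map transpose_mat Bs)"
proof (induction Bs)
  case (Cons B Bs)
  then show ?case by (intro eq_matI) (auto simp: Let_def dim_diag_block_mat[of "map _ _"] dim_diag_block_mat o_def simp flip: Cons.IH)
qed simp

text \<open>Passes from a flat index to a block number and a position inside the block; block j
  starts at the total size of the blocks before it.\<close>

lemma sum_blocks:
  fixes f :: "nat \<Rightarrow> real" and N :: nat
  shows "(\<Sum>b<(\<Sum>l<N. d l). f b) = (\<Sum>j<N. \<Sum>b<d j. f ((\<Sum>l<j. d l) + b))"
proof (induction N)
  case (Suc N)
  have "sum f {..<s + t} = sum f {..<s} + (\<Sum>b<t. f (s + b))" for s t :: nat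
    by (induction t) (auto simp: add_ac)
  then show ?case using Suc by simp
qed simp

lemma index_vec_stack:
  assumes "\<And>i. i < N \<Longrightarrow> v i \<in> carrier_vec (d i)" "j < N" "b < d j"
  shows "stack N v $ ((\<Sum>l<j. d l) + b) = v j $ b"
  using assms
proof (induction N arbitrary: v d j)
  case (Suc N)
  have v0: "dim_vec (v 0) = d 0" using Suc.prems by auto
  have dim: "dim_vec (stack N (\<lambda>i. v (Suc i))) = (\<Sum>i<N. d (Suc i))"
    using Suc.prems by (intro dim_vec_stack_map) auto
  show ?case
  proof (cases j)
    case 0
    then have "b < dim_vec (v 0)" unfolding v0 using Suc.prems(3) by simp
    then show ?thesis using 0 by (simp add: map_upt_Suc_conv del: upt_Suc)
  next
    case (Suc j')
    have "(\<Sum>l<j'. d (Suc l)) + b < (\<Sum>i<Suc j'. d (Suc i))" using Suc Suc.prems by simp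
    also have "\<dots> \<le> (\<Sum>i<N. d (Suc i))" using Suc Suc.prems by (intro sum_mono2) auto
    finally have "(\<Sum>l<j'. d (Suc l)) + b < (\<Sum>i<N. d (Suc i))" .
    then have "(v 0 @\<^sub>v stack N (\<lambda>i. v (Suc i))) $ (d 0 + ((\<Sum>l<j'. d (Suc l)) + b))
      = stack N (\<lambda>i. v (Suc i)) $ ((\<Sum>l<j'. d (Suc l)) + b)"
      by (subst index_append_vec(1)) (simp_all only: v0 dim, simp_all)
    also have "\<dots> = v (Suc j') $ b"
      using Suc.IH[of "\<lambda>i. v (Suc i)" "\<lambda>i. d (Suc i)" j'] Suc Suc.prems by simp
    finally show ?thesis
      unfolding Suc map_upt_Suc_conv vec_stack_Cons sum.lessThan_Suc_shift add.assoc .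
  qed
qed simp

text \<open>The identity factor makes the product block diagonal with N copies of A: an entry in
  block row i survives only in block column i.\<close>

lemma kron_one_mult_vec_stack:
  assumes "A \<in> carrier_mat r c" "\<And>i. i < N \<Longrightarrow> v i \<in> carrier_vec c"
  shows "kron (1\<^sub>m N) A *\<^sub>v stack N v = stack N (\<lambda>i. A *\<^sub>v v i)"
proof (rule eq_vecI)
  have Av: "A *\<^sub>v v i \<in> carrier_vec r" if "i < N" for i using assms that by auto
  have dim: "dim_vec (stack N v) = N * c"
    "dim_vec (stack N (\<lambda>i. A *\<^sub>v v i)) = N * r"
    using dim_vec_stack_map[of N v "\<lambda>_. c"] dim_vec_stack_map[of N "\<lambda>i. A *\<^sub>v v i" "\<lambda>_. r"] assms Av by auto
  then show "dim_vec (kron (1\<^sub>m N) A *\<^sub>v stack N v) = dim_vec (stack N (\<lambda>i. A *\<^sub>v v i))"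
    using assms by (simp add: kron_def)
  fix x assume "x < dim_vec (stack N (\<lambda>i. A *\<^sub>v v i))"
  then have x: "x < N * r" using dim by simp
  \<comment> \<open>Flat row x is row a of block i.\<close>
  define i a where "i = x div r" and "a = x mod r"
  have r: "r > 0" using x by (cases r) auto
  then have i: "i < N" and a: "a < r"
    using x by (auto simp: i_def a_def less_mult_imp_div_less)
  have x_eq: "x = (\<Sum>l<i. r) + a" by (simp add: i_def a_def)
  have "(kron (1\<^sub>m N) A *\<^sub>v stack N v) $ x =
    (\<Sum>y<(\<Sum>l<N. c). (if i = y div c then A $$ (a, y mod c) else 0) * stack N v $ y)"
    using assms(1) x dim i
    by (auto simp: kron_def scalar_prod_def lessThan_atLeast0 i_def a_def less_mult_imp_div_less intro!: sum.cong)
  also have "\<dots> = (\<Sum>j<N. \<Sum>b<c. (if i = j then A $$ (a, b) * v j $ b else 0))"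
    unfolding sum_blocks using index_vec_stack[of N v "\<lambda>_. c"] assms(2) by (intro sum.cong refl) auto
  also have "\<dots> = (\<Sum>j<N. if i = j then (\<Sum>b<c. A $$ (a, b) * v j $ b) else 0)"
    by (intro sum.cong refl) auto
  also have "\<dots> = (\<Sum>b<c. A $$ (a, b) * v i $ b)" using i by simp
  also have "\<dots> = (A *\<^sub>v v i) $ a"
    using assms(1) assms(2)[OF i] a by (auto simp: scalar_prod_def lessThan_atLeast0)
  also have "\<dots> = stack N (\<lambda>i. A *\<^sub>v v i) $ x"
    unfolding x_eq using index_vec_stack[of N "\<lambda>i. A *\<^sub>v v i" "\<lambda>_. r" i a] Av i a by simp
  finally show "(kron (1\<^sub>m N) A *\<^sub>v stack N v) $ x = stack N (\<lambda>i. A *\<^sub>v v i) $ x" .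
qed

text \<open>The matrices on the right have the form of \<open>Nblk\<close>, so a constraint matrix
  acting on the joint input can be applied player by player.\<close>

lemma mult_vec_stack_col_blocks:
  assumes "A \<in> carrier_mat r (\<Sum>i<N. d i)" "\<And>i. i < N \<Longrightarrow> v i \<in> carrier_vec (d i)"
  shows "A *\<^sub>v stack N v =
    vsum r (\<lambda>j. mat r (d j) (\<lambda>(a, b). A $$ (a, (\<Sum>l<j. d l) + b)) *\<^sub>v v j) {..<N}"
proof (rule eq_vecI)
  fix a assume "a < dim_vec (vsum r (\<lambda>j. mat r (d j) (\<lambda>(a, b). A $$ (a, (\<Sum>l<j. d l) + b)) *\<^sub>v v j) {..<N})"
  then have a: "a < r" by simp
  have "(A *\<^sub>v stack N v) $ a = (\<Sum>b<(\<Sum>i<N. d i). A $$ (a, b) * stack N v $ b)"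
    by (rule mult_mat_vec_index_sum[OF assms(1) vec_stack_carrier[OF assms(2)] a])
  also have "\<dots> = (\<Sum>j<N. \<Sum>b<d j. A $$ (a, (\<Sum>l<j. d l) + b) * v j $ b)"
    unfolding sum_blocks using index_vec_stack[of N v d] assms(2) by (intro sum.cong refl) auto
  also have "\<dots> = (\<Sum>j<N. (mat r (d j) (\<lambda>(a, b). A $$ (a, (\<Sum>l<j. d l) + b)) *\<^sub>v v j) $ a)"
    using assms(2) a by (intro sum.cong refl, subst mult_mat_vec_index_sum[of _ r]) auto
  finally show "(A *\<^sub>v stack N v) $ a =
    vsum r (\<lambda>j. mat r (d j) (\<lambda>(a, b). A $$ (a, (\<Sum>l<j. d l) + b)) *\<^sub>v v j) {..<N} $ a" using a by simp
qed (use assms in auto)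

text \<open>\<open>minv\<close> takes \<open>the\<close> of an option. Invertibility is first turned
  into membership in the units of the matrix ring, where \<open>mat_inverse\<close> is known to
  return a value.\<close>

lemma minv_props:
  assumes "A \<in> carrier_mat n n" "invertible_mat A"
  shows "minv A \<in> carrier_mat n n" "A * minv A = 1\<^sub>m n" "minv A * A = 1\<^sub>m n"
proof -
  obtain B where "inverts_mat A B" "inverts_mat B A" using assms(2) by (auto simp: invertible_mat_def)
  then have "A * B = 1\<^sub>m n" "B * A = 1\<^sub>m (dim_row B)" using assms(1) by (auto simp: inverts_mat_def)
  moreover from this have "B \<in> carrier_mat n n"
    using assms(1) by (metis carrier_matD(2) carrier_matI index_mult_mat(2,3) index_one_mat(2,3))
  ultimately have "A \<in> Units (ring_mat TYPE(real) n n)"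
    using assms(1) by (auto simp: Units_def ring_mat_def)
  then obtain C where "mat_inverse A = Some C"
    using mat_inverse(1)[OF assms(1), of n] by (cases "mat_inverse A") auto
  then show "minv A \<in> carrier_mat n n" "A * minv A = 1\<^sub>m n" "minv A * A = 1\<^sub>m n"
    using mat_inverse(2)[OF assms(1)] by (auto simp: minv_def)
qed

text \<open>A trivial kernel forces a nonzero determinant. Definite matrices and block diagonals are
  shown to be invertible in this way, without exhibiting an inverse.\<close>

lemma invertible_mat_if_inj:
  fixes A :: "real mat"
  assumes "A \<in> carrier_mat n n" "\<And>v. v \<in> carrier_vec n \<Longrightarrow> A *\<^sub>v v = 0\<^sub>v n \<Longrightarrow> v = 0\<^sub>v n"
  shows "invertible_mat A"
proof -
  have "det A \<noteq> 0" using det_0_iff_vec_prod_zero_field[OF assms(1)] assms(2) by auto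
  then have "A \<in> Units (ring_mat TYPE(real) n undefined)"
    by (rule det_non_zero_imp_unit[OF assms(1)])
  then obtain B where "B \<in> carrier_mat n n" "A * B = 1\<^sub>m n" "B * A = 1\<^sub>m n"
    by (auto simp: Units_def ring_mat_def)
  then show ?thesis using assms(1) by (auto simp: invertible_mat_def inverts_mat_def)
qed

lemma minv_mult_eq_iff:
  assumes "A \<in> carrier_mat n n" "invertible_mat A" "y \<in> carrier_vec n" "z \<in> carrier_vec n"
  shows "y = minv A *\<^sub>v z \<longleftrightarrow> A *\<^sub>v y = z"
proof
  note m = minv_props[OF assms(1,2)]
  assume "y = minv A *\<^sub>v z"
  then have "A *\<^sub>v y = (A * minv A) *\<^sub>v z" using m(1) assms by simp
  then show "A *\<^sub>v y = z" unfolding m(2) using assms by simp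
next
  note m = minv_props[OF assms(1,2)]
  assume "A *\<^sub>v y = z"
  then have "minv A *\<^sub>v z = (minv A * A) *\<^sub>v y" using m(1) assms by auto
  then show "y = minv A *\<^sub>v z" unfolding m(3) using assms by simp
qed

lemma pos_def_invertible:
  assumes "pos_def A" "A \<in> carrier_mat n n"
  shows "invertible_mat A"
proof (rule invertible_mat_if_inj[OF assms(2)])
  fix v :: "real vec" assume v: "v \<in> carrier_vec n" "A *\<^sub>v v = 0\<^sub>v n"
  show "v = 0\<^sub>v n"
  proof (rule ccontr)
    assume "v \<noteq> 0\<^sub>v n"
    then have "v \<bullet> (A *\<^sub>v v) > 0" using assms v by (auto simp: pos_def_def)
    then show False using v by simp
  qed
qed

section \<open>Farkas' lemma and linear-quadratic curvature\<close>

text \<open>Linearity is only required with respect to a single operation \<open>comb x c y\<close>, to be read as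
  \<open>x + c y\<close>, on a carrier set: strategies do not form a vector space type.\<close>

lemma farkas:
  fixes a :: "'i \<Rightarrow> 'v \<Rightarrow> real" and b :: "'v \<Rightarrow> real"
  assumes "finite S" "V \<noteq> {}"
    and closed: "\<And>x c y. x \<in> V \<Longrightarrow> y \<in> V \<Longrightarrow> comb x c y \<in> V"
    and "\<And>s x c y. s \<in> S \<Longrightarrow> x \<in> V \<Longrightarrow> y \<in> V \<Longrightarrow> a s (comb x c y) = a s x + c * a s y"
    and "\<And>x c y. x \<in> V \<Longrightarrow> y \<in> V \<Longrightarrow> b (comb x c y) = b x + c * b y"
    and "\<And>x. x \<in> V \<Longrightarrow> (\<And>s. s \<in> S \<Longrightarrow> 0 \<le> a s x) \<Longrightarrow> 0 \<le> b x"
  shows "\<exists>\<nu>. (\<forall>s\<in>S. 0 \<le> \<nu> s) \<and> (\<forall>x\<in>V. b x = (\<Sum>s\<in>S. \<nu> s * a s x))"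
  using assms(1,4-)
proof (induction S arbitrary: a b rule: finite_induct)
  case empty
  have "b x = 0" if x: "x \<in> V" for x
  proof -
    \<comment> \<open>\<open>comb x (-2) x\<close> plays the role of -x, so b is nonnegative on
      both.\<close>
    have "0 \<le> b (comb x (-2) x)" using closed empty.prems(3) x by blast
    then have "0 \<le> - b x" using empty.prems(2)[OF x x, of "-2"] by simp
    then show ?thesis using empty.prems(3)[OF x] by simp
  qed
  then show ?case by simp
next
  case (insert s S)
  show ?case
  \<comment> \<open>If the constraints in S alone imply the inequality, s gets multiplier 0.
    Otherwise some z satisfies them but makes b negative, and then z must violate s.\<close>
  proof (cases "\<forall>x\<in>V. (\<forall>t\<in>S. 0 \<le> a t x) \<longrightarrow> 0 \<le> b x")
    case True
    then obtain \<nu> where \<nu>: "\<forall>t\<in>S. 0 \<le> \<nu> t" "\<forall>x\<in>V. b x = (\<Sum>t\<in>S. \<nu> t * a t x)"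
      using insert.IH[of a b] insert.prems by blast
    have "(\<Sum>t\<in>S. (\<nu>(s := 0)) t * a t x) = (\<Sum>t\<in>S. \<nu> t * a t x)" for x
      using insert.hyps by (intro sum.cong) auto
    then show ?thesis using \<nu> insert.hyps by (intro exI[of _ "\<nu>(s := 0)"]) auto
  next
    case False
    then obtain z where z: "z \<in> V" "\<And>t. t \<in> S \<Longrightarrow> 0 \<le> a t z" "b z < 0" by force
    then have sz: "a s z < 0" using insert.prems(3)[of z] by force
    define r where "r x = a s x / a s z" for x
    \<comment> \<open>Projection along z onto the kernel of \<open>a s\<close>. There constraint s
      holds with equality, so the induction hypothesis applies to the other functionals composed
      with the projection.\<close>
    define proj where "proj x = comb x (- r x) z" for x
    have lin_r: "r (comb x c y) = r x + c * r y" if "x \<in> V" "y \<in> V" for x c y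
      using that insert.prems(1)[of s x y c] by (simp add: r_def add_divide_distrib)
    have a_proj: "a t (proj x) = a t x - r x * a t z" if "t \<in> insert s S" "x \<in> V" for t x
      using insert.prems(1)[OF that(1) that(2) z(1), of "- r x"] by (simp add: proj_def)
    have b_proj: "b (proj x) = b x - r x * b z" if "x \<in> V" for x
      using insert.prems(2)[OF that z(1), of "- r x"] by (simp add: proj_def)
    have "\<exists>\<nu>. (\<forall>t\<in>S. 0 \<le> \<nu> t) \<and>
      (\<forall>x\<in>V. b x - r x * b z = (\<Sum>t\<in>S. \<nu> t * (a t x - r x * a t z)))"
    proof (rule insert.IH)
      fix x assume x: "x \<in> V" "\<And>t. t \<in> S \<Longrightarrow> 0 \<le> a t x - r x * a t z"
      have "a s (proj x) = 0" using a_proj[of s x] x sz by (simp add: r_def)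
      then have "0 \<le> b (proj x)"
        using x a_proj by (intro insert.prems(3)) (auto simp: proj_def closed z)
      then show "0 \<le> b x - r x * b z" using b_proj x by simp
    qed (use lin_r insert.prems in \<open>auto simp: algebra_simps\<close>)
    then obtain \<nu> where \<nu>: "\<forall>t\<in>S. 0 \<le> \<nu> t"
      "\<And>x. x \<in> V \<Longrightarrow> b x - r x * b z = (\<Sum>t\<in>S. \<nu> t * (a t x - r x * a t z))" by blast
    \<comment> \<open>Forced by evaluating the desired identity at z. Numerator and denominator are
      both negative, which gives the sign.\<close>
    define \<nu>s where "\<nu>s = (b z - (\<Sum>t\<in>S. \<nu> t * a t z)) / a s z"
    have "0 \<le> (\<Sum>t\<in>S. \<nu> t * a t z)" using \<nu>(1) z(2) by (intro sum_nonneg mult_nonneg_nonneg) auto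
    then have s0: "0 \<le> \<nu>s" using z(3) sz by (auto simp: \<nu>s_def intro!: divide_nonpos_neg)
    have "b x = \<nu>s * a s x + (\<Sum>t\<in>S. \<nu> t * a t x)" if "x \<in> V" for x
    proof -
      have "b x = r x * b z + (\<Sum>t\<in>S. \<nu> t * a t x) - r x * (\<Sum>t\<in>S. \<nu> t * a t z)"
        using \<nu>(2)[OF that] by (simp add: algebra_simps sum_subtractf sum_distrib_left)
      then show ?thesis by (simp add: \<nu>s_def r_def algebra_simps diff_divide_distrib)
    qed
    moreover have "(\<Sum>t\<in>S. (\<nu>(s := \<nu>s)) t * a t x) = (\<Sum>t\<in>S. \<nu> t * a t x)" for x
      using insert.hyps by (intro sum.cong) auto
    ultimately show ?thesis using \<nu>(1) s0 insert.hyps by (intro exI[of _ "\<nu>(s := \<nu>s)"]) auto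
  qed
qed

section \<open>Quadratic forms and completion of the square\<close>

lemma mult_mat_vec_scalar_prod:
  fixes A :: "real mat"
  assumes "A \<in> carrier_mat nr cl" "x \<in> carrier_vec cl" "y \<in> carrier_vec nr"
  shows "(A *\<^sub>v x) \<bullet> y = x \<bullet> (A\<^sup>T *\<^sub>v y)"
proof -
  have "(A *\<^sub>v x) \<bullet> y = y \<bullet> (A *\<^sub>v x)" using assms by (intro comm_scalar_prod[of _ nr]) auto
  also have "\<dots> = (A\<^sup>T *\<^sub>v y) \<bullet> x"
    using transpose_vec_mult_scalar[OF assms] by simp
  also have "\<dots> = x \<bullet> (A\<^sup>T *\<^sub>v y)" using assms by (intro comm_scalar_prod[of _ cl]) auto
  finally show ?thesis .
qed

lemma mult4_mat_vec:
  fixes A :: "real mat"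
  assumes "A \<in> carrier_mat a b" "B \<in> carrier_mat b c" "C \<in> carrier_mat c d" "D \<in> carrier_mat d e"
    and "v \<in> carrier_vec e"
  shows "(A * B * C * D) *\<^sub>v v = A *\<^sub>v (B *\<^sub>v (C *\<^sub>v (D *\<^sub>v v)))"
proof -
  note AB = mult_carrier_mat[OF assms(1,2)]
  note Dv = mult_mat_vec_carrier[OF assms(4,5)]
  note CDv = mult_mat_vec_carrier[OF assms(3) Dv]
  show ?thesis
    unfolding assoc_mult_mat_vec[OF mult_carrier_mat[OF AB assms(3)] assms(4,5)]
      assoc_mult_mat_vec[OF AB assms(3) Dv] assoc_mult_mat_vec[OF assms(1,2) CDv] ..
qed

lemma quad_add:
  assumes "S \<in> carrier_mat n n" "S\<^sup>T = S" "x \<in> carrier_vec n" "y \<in> carrier_vec n"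
  shows "quad S (x + y) = quad S x + 2 * ((S *\<^sub>v x) \<bullet> y) + quad S y"
proof -
  have c: "S *\<^sub>v x \<in> carrier_vec n" "S *\<^sub>v y \<in> carrier_vec n" using assms by auto
  have "x \<bullet> (S *\<^sub>v y) = (S *\<^sub>v x) \<bullet> y"
    using mult_mat_vec_scalar_prod[OF assms(1,3,4)] assms(2) by simp
  moreover have "y \<bullet> (S *\<^sub>v x) = (S *\<^sub>v x) \<bullet> y" using c assms by (intro comm_scalar_prod[of _ n]) auto
  ultimately show ?thesis
    unfolding quad_def mult_add_distrib_mat_vec[OF assms(1,3,4)]
    using c assms by (simp add: add_scalar_prod_distrib[of _ n] scalar_prod_add_distrib[of _ n])
qed

lemma quad_smult:
  assumes "S \<in> carrier_mat n n" "x \<in> carrier_vec n"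
  shows "quad S (t \<cdot>\<^sub>v x) = t\<^sup>2 * quad S x"
proof -
  have "S *\<^sub>v (t \<cdot>\<^sub>v x) = t \<cdot>\<^sub>v (S *\<^sub>v x)" using assms by (simp add: mult_mat_vec)
  then show ?thesis using assms by (simp add: quad_def power2_eq_square)
qed

lemma pos_def_quad_nonneg:
  assumes "pos_def S" "S \<in> carrier_mat n n" "x \<in> carrier_vec n"
  shows "0 \<le> quad S x"
  using assms by (cases "x = 0\<^sub>v n") (auto simp: pos_def_def quad_def less_imp_le)

text \<open>Completion of the square: the right side exceeds the left by exactly
  \<open>quad Y (d + z)\<close>, where z is the inverse of Y applied to \<open>B' E A x\<close>.
  Thus -z is the minimiser over d and \<open>E'\<close> gives the minimal value.\<close>

lemma riccati_stage_nonneg: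
  fixes A B E Q R :: "real mat" and n m :: nat
  defines "Y \<equiv> R + B\<^sup>T * E * B"
  assumes A: "A \<in> carrier_mat n n" and B: "B \<in> carrier_mat n m"
    and E: "E \<in> carrier_mat n n" "E\<^sup>T = E"
    and Q: "Q \<in> carrier_mat n n" and R: "R \<in> carrier_mat m m"
    and Y: "pos_def Y"
    and E': "E' = A\<^sup>T * E * A + Q - A\<^sup>T * E * B * minv Y * B\<^sup>T * E * A"
    and x: "x \<in> carrier_vec n" and d: "d \<in> carrier_vec m"
  shows "quad E' x \<le> quad E (A *\<^sub>v x + B *\<^sub>v d) + quad Q x + quad R d"
proof -
  have Yc: "Y \<in> carrier_mat m m" using assms by (auto simp: Y_def)
  have Ysym: "Y\<^sup>T = Y" using Y by (simp add: pos_def_def)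
  note Yi = minv_props[OF Yc pos_def_invertible[OF Y Yc]]
  define g z where "g = B\<^sup>T *\<^sub>v (E *\<^sub>v (A *\<^sub>v x))" and "z = minv Y *\<^sub>v g"
  have Ax: "A *\<^sub>v x \<in> carrier_vec n" and Bd: "B *\<^sub>v d \<in> carrier_vec n" using A B x d by auto
  have EAx: "E *\<^sub>v (A *\<^sub>v x) \<in> carrier_vec n" using E Ax by auto
  have g: "g \<in> carrier_vec m" using B EAx by (auto simp: g_def)
  have z: "z \<in> carrier_vec m" using Yi g by (auto simp: z_def)
  have Yz: "Y *\<^sub>v z = g" using minv_mult_eq_iff[OF Yc pos_def_invertible[OF Y Yc] z g] z_def by simp
  have "quad Y d = quad R d + quad E (B *\<^sub>v d)"
  proof -
    have "Y *\<^sub>v d = R *\<^sub>v d + B\<^sup>T *\<^sub>v (E *\<^sub>v (B *\<^sub>v d))"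
    proof -
      have "Y *\<^sub>v d = R *\<^sub>v d + (B\<^sup>T * E * B) *\<^sub>v d"
        unfolding Y_def using R B E d by (intro add_mult_distrib_mat_vec[of _ m m]) auto
      also have "(B\<^sup>T * E * B) *\<^sub>v d = (B\<^sup>T * E) *\<^sub>v (B *\<^sub>v d)"
        using B E d by (intro assoc_mult_mat_vec[of _ m n _ m]) auto
      also have "\<dots> = B\<^sup>T *\<^sub>v (E *\<^sub>v (B *\<^sub>v d))"
        using B E Bd by (intro assoc_mult_mat_vec[of _ m n _ n]) auto
      finally show ?thesis .
    qed
    moreover have "(B *\<^sub>v d) \<bullet> (E *\<^sub>v (B *\<^sub>v d)) = d \<bullet> (B\<^sup>T *\<^sub>v (E *\<^sub>v (B *\<^sub>v d)))"
      using B E d Bd by (intro mult_mat_vec_scalar_prod[of _ n m]) auto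
    moreover have "d \<bullet> (R *\<^sub>v d + B\<^sup>T *\<^sub>v (E *\<^sub>v (B *\<^sub>v d))) = d \<bullet> (R *\<^sub>v d) + d \<bullet> (B\<^sup>T *\<^sub>v (E *\<^sub>v (B *\<^sub>v d)))"
      using B E R d Bd by (intro scalar_prod_add_distrib[of _ m]) auto
    ultimately show ?thesis by (simp add: quad_def)
  qed
  moreover have "quad E (A *\<^sub>v x + B *\<^sub>v d) = quad E (A *\<^sub>v x) + 2 * (g \<bullet> d) + quad E (B *\<^sub>v d)"
  proof -
    have "(E *\<^sub>v (A *\<^sub>v x)) \<bullet> (B *\<^sub>v d) = g \<bullet> d"
      unfolding g_def using transpose_vec_mult_scalar[OF B d EAx] by simp
    then show ?thesis using quad_add[OF E Ax Bd] by simp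
  qed
  \<comment> \<open>The correction term of the Riccati equation is the form of the inverse of Y at
    g, which is the scalar product of g and z.\<close>
  moreover have "quad E' x = quad E (A *\<^sub>v x) + quad Q x - g \<bullet> z"
  proof -
    have c: "A\<^sup>T * E * A + Q \<in> carrier_mat n n" "A\<^sup>T * E * B * minv Y * B\<^sup>T * E * A \<in> carrier_mat n n"
      using A B E Q Yi by auto
    have 1: "(A\<^sup>T * E * A) *\<^sub>v x = A\<^sup>T *\<^sub>v (E *\<^sub>v (A *\<^sub>v x))"
    proof -
      have "(A\<^sup>T * E * A) *\<^sub>v x = (A\<^sup>T * E) *\<^sub>v (A *\<^sub>v x)"
        using A E x by (intro assoc_mult_mat_vec[of _ n n _ n]) auto
      then show ?thesis using A E Ax by (simp add: assoc_mult_mat_vec[of _ n n _ n])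
    qed
    have 2: "(A\<^sup>T * E * B * minv Y * B\<^sup>T * E * A) *\<^sub>v x = A\<^sup>T *\<^sub>v (E *\<^sub>v (B *\<^sub>v z))"
    proof -
      have AT: "A\<^sup>T \<in> carrier_mat n n" and BT: "B\<^sup>T \<in> carrier_mat m n" using A B by auto
      have W: "A\<^sup>T * E * B * minv Y \<in> carrier_mat n m" using A B E Yi by auto
      show ?thesis
        unfolding mult4_mat_vec[OF W BT E(1) A x] z_def g_def[symmetric] by (rule mult4_mat_vec[OF AT E(1) B Yi(1) g])
    qed
    have "E' *\<^sub>v x = A\<^sup>T *\<^sub>v (E *\<^sub>v (A *\<^sub>v x)) + Q *\<^sub>v x - A\<^sup>T *\<^sub>v (E *\<^sub>v (B *\<^sub>v z))"
      unfolding E' minus_mult_distrib_mat_vec[OF c x] 2 1[symmetric]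
      using A E Q x by (subst add_mult_distrib_mat_vec[of _ n n]) auto
    moreover have "A\<^sup>T *\<^sub>v (E *\<^sub>v (A *\<^sub>v x)) \<in> carrier_vec n" "Q *\<^sub>v x \<in> carrier_vec n"
      "A\<^sup>T *\<^sub>v (E *\<^sub>v (B *\<^sub>v z)) \<in> carrier_vec n" using A B E Q EAx x z by auto
    ultimately have "quad E' x = x \<bullet> (A\<^sup>T *\<^sub>v (E *\<^sub>v (A *\<^sub>v x))) + quad Q x - x \<bullet> (A\<^sup>T *\<^sub>v (E *\<^sub>v (B *\<^sub>v z)))"
      using x by (simp add: quad_def scalar_prod_minus_distrib[of _ n] scalar_prod_add_distrib[of _ n])
    moreover have "x \<bullet> (A\<^sup>T *\<^sub>v (E *\<^sub>v (A *\<^sub>v x))) = quad E (A *\<^sub>v x)"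
      unfolding quad_def using mult_mat_vec_scalar_prod[OF A x EAx] by simp
    moreover have "x \<bullet> (A\<^sup>T *\<^sub>v (E *\<^sub>v (B *\<^sub>v z))) = g \<bullet> z"
    proof -
      have Bz: "B *\<^sub>v z \<in> carrier_vec n" and EBz: "E *\<^sub>v (B *\<^sub>v z) \<in> carrier_vec n" using B E z by auto
      have "x \<bullet> (A\<^sup>T *\<^sub>v (E *\<^sub>v (B *\<^sub>v z))) = (A *\<^sub>v x) \<bullet> (E *\<^sub>v (B *\<^sub>v z))"
        using mult_mat_vec_scalar_prod[OF A x EBz] by simp
      also have "\<dots> = (E *\<^sub>v (A *\<^sub>v x)) \<bullet> (B *\<^sub>v z)"
        using mult_mat_vec_scalar_prod[OF E(1) Ax Bz] E(2) by simp
      also have "\<dots> = g \<bullet> z"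
        unfolding g_def using transpose_vec_mult_scalar[OF B z EAx] by simp
      finally show ?thesis .
    qed
    ultimately show ?thesis by simp
  qed
  moreover have "quad Y (d + z) = quad Y d + 2 * (g \<bullet> d) + g \<bullet> z"
  proof -
    have "quad Y (z + d) = quad Y z + 2 * ((Y *\<^sub>v z) \<bullet> d) + quad Y d" by (rule quad_add[OF Yc Ysym z d])
    moreover have "z + d = d + z" by (rule comm_add_vec[OF z d])
    moreover have "quad Y z = g \<bullet> z" using Yz comm_scalar_prod[OF z g] by (simp add: quad_def)
    ultimately show ?thesis using Yz by simp
  qed
  moreover have "0 \<le> quad Y (d + z)" using pos_def_quad_nonneg[OF Y Yc] d z by auto
  ultimately show ?thesis by linarith
qed

lemma minv_symmetric:
  assumes "A \<in> carrier_mat n n" "invertible_mat A" "A\<^sup>T = A"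
  shows "(minv A)\<^sup>T = minv A"
proof -
  note m = minv_props[OF assms(1,2)]
  have "(minv A)\<^sup>T * A = 1\<^sub>m n"
    using arg_cong[OF m(2), of transpose_mat] transpose_mult[OF assms(1) m(1)] assms(3) by simp
  then have "(minv A)\<^sup>T * A * minv A = minv A" using m by simp
  moreover have "(minv A)\<^sup>T * A * minv A = (minv A)\<^sup>T"
    using m assms(1) by (simp add: assoc_mult_mat[of _ n n _ n _ n])
  ultimately show ?thesis by simp
qed

section \<open>Linear-quadratic paths of one decision maker\<close>

locale lq_path =
  fixes K n m :: nat and A B Q R :: "nat \<Rightarrow> real mat"
  assumes A: "\<And>k. k < K \<Longrightarrow> A k \<in> carrier_mat n n"
    and B: "\<And>k. k < K \<Longrightarrow> B k \<in> carrier_mat n m"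
    and Q: "\<And>k. k \<le> K \<Longrightarrow> Q k \<in> carrier_mat n n"
    and Q_sym: "\<And>k. k \<le> K \<Longrightarrow> (Q k)\<^sup>T = Q k"
    and R: "\<And>k. k < K \<Longrightarrow> R k \<in> carrier_mat m m"
    and R_sym: "\<And>k. k < K \<Longrightarrow> (R k)\<^sup>T = R k"
begin

definition dirs :: "(nat \<Rightarrow> real vec) set" where
  "dirs = {d. \<forall>k<K. d k \<in> carrier_vec m}"

text \<open>Difference of two state paths whose inputs differ by d: the initial state and the
  contribution of everyone else cancel.\<close>

primrec resp :: "(nat \<Rightarrow> real vec) \<Rightarrow> nat \<Rightarrow> real vec" where
  "resp d 0 = 0\<^sub>v n"
| "resp d (Suc k) = A k *\<^sub>v resp d k + B k *\<^sub>v d k"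

lemma resp_carrier: "d \<in> dirs \<Longrightarrow> k \<le> K \<Longrightarrow> resp d k \<in> carrier_vec n"
proof (induction k)
  case (Suc k)
  then show ?case using A[of k] B[of k] by (auto simp: dirs_def)
qed simp

text \<open>The operation handed to \<open>farkas\<close>. Scaling is expressed with it as well:
  \<open>comb d (t - 1) d\<close> is d multiplied by t.\<close>

definition comb :: "(nat \<Rightarrow> real vec) \<Rightarrow> real \<Rightarrow> (nat \<Rightarrow> real vec) \<Rightarrow> nat \<Rightarrow> real vec" where
  "comb x c y k = x k + c \<cdot>\<^sub>v y k"

lemma comb_dirs: "x \<in> dirs \<Longrightarrow> y \<in> dirs \<Longrightarrow> comb x c y \<in> dirs"
  by (auto simp: dirs_def comb_def)

lemma mult_comb:
  assumes "(S :: real mat) \<in> carrier_mat r q" "x \<in> carrier_vec q" "y \<in> carrier_vec q"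
  shows "S *\<^sub>v (x + c \<cdot>\<^sub>v y) = S *\<^sub>v x + c \<cdot>\<^sub>v (S *\<^sub>v y)"
  using assms by (simp add: mult_add_distrib_mat_vec mult_mat_vec)

lemma resp_comb:
  assumes "x \<in> dirs" "y \<in> dirs"
  shows "k \<le> K \<Longrightarrow> resp (comb x c y) k = resp x k + c \<cdot>\<^sub>v resp y k"
proof (induction k)
  case (Suc k)
  then have k: "k < K" by simp
  have c: "x k \<in> carrier_vec m" "y k \<in> carrier_vec m" "resp x k \<in> carrier_vec n" "resp y k \<in> carrier_vec n"
    using assms k by (auto simp: dirs_def intro!: resp_carrier)
  then have c': "A k *\<^sub>v resp x k \<in> carrier_vec n" "A k *\<^sub>v resp y k \<in> carrier_vec n"
    "B k *\<^sub>v x k \<in> carrier_vec n" "B k *\<^sub>v y k \<in> carrier_vec n" using A[OF k] B[OF k] by auto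
  have "resp (comb x c y) (Suc k) = (A k *\<^sub>v resp x k + c \<cdot>\<^sub>v (A k *\<^sub>v resp y k)) + (B k *\<^sub>v x k + c \<cdot>\<^sub>v (B k *\<^sub>v y k))"
    using Suc k c mult_comb[OF A[OF k], of "resp x k" "resp y k" c] mult_comb[OF B[OF k], of "x k" "y k" c]
      comb_def[of x c y k] by simp
  also have "\<dots> = resp x (Suc k) + c \<cdot>\<^sub>v resp y (Suc k)"
    by (intro eq_vecI) (use A[OF k] B[OF k] in \<open>auto simp: algebra_simps simp del: index_mult_mat_vec\<close>)
  finally show ?case .
qed (auto intro!: eq_vecI)

text \<open>Second derivative of the cost in direction d; neither the profile nor the linear cost
  terms enter.\<close>

definition curvature :: "(nat \<Rightarrow> real vec) \<Rightarrow> real" where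
  "curvature d = quad (Q K) (resp d K) + (\<Sum>k<K. quad (Q k) (resp d k) + quad (R k) (d k))"

lemma curvature_scale:
  assumes d: "d \<in> dirs"
  shows "curvature (comb d (t - 1) d) = t\<^sup>2 * curvature d"
proof -
  have add: "v + (t - 1) \<cdot>\<^sub>v v = t \<cdot>\<^sub>v v" for v :: "real vec"
    by (intro eq_vecI) (auto simp: algebra_simps)
  have "comb d (t - 1) d k = t \<cdot>\<^sub>v d k" for k by (simp add: comb_def add)
  moreover have "resp (comb d (t - 1) d) k = t \<cdot>\<^sub>v resp d k" if "k \<le> K" for k
    using resp_comb[OF d d that] by (simp add: add)
  ultimately show ?thesis unfolding curvature_def
    using Q R resp_carrier[OF d] d
    by (simp add: quad_smult[of _ n] quad_smult[of _ m] dirs_def sum_distrib_left distrib_left)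
qed

text \<open>With \<open>E\<close> as value function, the accumulated quadratic cost plus
  \<open>quad (E j) (resp d j)\<close> cannot decrease in j, by \<open>riccati_stage_nonneg\<close>;
  it is 0 at the start and equals the curvature at the end.\<close>

lemma curvature_nonneg:
  assumes E: "\<And>k. k \<le> K \<Longrightarrow> E k \<in> carrier_mat n n" "E K = Q K"
    and Y: "\<And>k. k < K \<Longrightarrow> pos_def (R k + (B k)\<^sup>T * E (Suc k) * B k)"
    and ric: "\<And>k. k < K \<Longrightarrow> E k = (A k)\<^sup>T * E (Suc k) * A k + Q k
          - (A k)\<^sup>T * E (Suc k) * B k * minv (R k + (B k)\<^sup>T * E (Suc k) * B k)
              * (B k)\<^sup>T * E (Suc k) * A k"
    and d: "d \<in> dirs"
  shows "0 \<le> curvature d"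
proof -
  \<comment> \<open>Completing the square requires symmetric \<open>E k\<close>. Symmetry is
    inherited backward from the terminal weight through the Riccati equation.\<close>
  have E_sym: "k \<le> K \<Longrightarrow> (E k)\<^sup>T = E k" for k
  proof (induction "K - k" arbitrary: k)
    case 0
    then show ?case using E(2) Q_sym by simp
  next
    case (Suc j)
    then have k: "k < K" by simp
    have IH: "(E (Suc k))\<^sup>T = E (Suc k)" using Suc k by simp
    let ?Y = "R k + (B k)\<^sup>T * E (Suc k) * B k"
    have c: "E (Suc k) \<in> carrier_mat n n" "A k \<in> carrier_mat n n" "B k \<in> carrier_mat n m"
      "Q k \<in> carrier_mat n n" "R k \<in> carrier_mat m m"
      using k E A B Q R by auto
    have Yc: "?Y \<in> carrier_mat m m" using c by auto
    have Yi: "minv ?Y \<in> carrier_mat m m" "(minv ?Y)\<^sup>T = minv ?Y"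
      using minv_props[OF Yc pos_def_invertible[OF Y[OF k] Yc]] 
        minv_symmetric[OF Yc pos_def_invertible[OF Y[OF k] Yc]] Y[OF k] by (auto simp: pos_def_def)
    let ?W = "(B k)\<^sup>T * E (Suc k) * A k" and ?V = "(A k)\<^sup>T * E (Suc k) * B k"
    have W: "?W \<in> carrier_mat m n" and V: "?V \<in> carrier_mat n m" using c by auto
    have WT: "?W\<^sup>T = ?V"
    proof -
      have "(B k)\<^sup>T \<in> carrier_mat m n" "(B k)\<^sup>T * E (Suc k) \<in> carrier_mat m n" using c by auto
      then have "?W\<^sup>T = (A k)\<^sup>T * (E (Suc k) * B k)"
        using transpose_mult[of "(B k)\<^sup>T * E (Suc k)" m n "A k" n] transpose_mult[of "(B k)\<^sup>T" m n "E (Suc k)" n]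
          c IH by simp
      then show ?thesis using c assoc_mult_mat[of "(A k)\<^sup>T" n n "E (Suc k)" n "B k" m] by simp
    qed
    then have VT: "?V\<^sup>T = ?W" by (metis transpose_transpose)
    have 1: "((A k)\<^sup>T * E (Suc k) * A k)\<^sup>T = (A k)\<^sup>T * E (Suc k) * A k"
      using c IH by (simp add: transpose_mult[of _ n n _ n] assoc_mult_mat[of _ n n _ n _ n])
    \<comment> \<open>Rebracketed as \<open>?V * minv ?Y * ?W\<close> with \<open>?V\<close> the
      transpose of \<open>?W\<close>, a form in which symmetry is visible.\<close>
    have e: "?V * minv ?Y * (B k)\<^sup>T * E (Suc k) * A k = ?V * minv ?Y * ?W"
    proof -
      have VY: "?V * minv ?Y \<in> carrier_mat n m" using V Yi by auto
      have B': "(B k)\<^sup>T \<in> carrier_mat m n" "(B k)\<^sup>T * E (Suc k) \<in> carrier_mat m n" using c by auto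
      show ?thesis
        unfolding assoc_mult_mat[OF VY B'(1) c(1)] assoc_mult_mat[OF VY B'(2) c(2)] ..
    qed
    have 2: "(?V * minv ?Y * ?W)\<^sup>T = ?V * minv ?Y * ?W"
    proof -
      have VY: "?V * minv ?Y \<in> carrier_mat n m" using V Yi by auto
      show ?thesis unfolding transpose_mult[OF VY W] transpose_mult[OF V Yi(1)] WT VT Yi(2)
        using assoc_mult_mat[OF V Yi(1) W] by simp
    qed
    have "E k = (A k)\<^sup>T * E (Suc k) * A k + Q k - ?V * minv ?Y * ?W" using ric[OF k] e by simp
    moreover have "((A k)\<^sup>T * E (Suc k) * A k + Q k - ?V * minv ?Y * ?W)\<^sup>T
      = (A k)\<^sup>T * E (Suc k) * A k + Q k - ?V * minv ?Y * ?W"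
    proof -
      have a: "(A k)\<^sup>T * E (Suc k) * A k \<in> carrier_mat n n" "?V * minv ?Y * ?W \<in> carrier_mat n n"
        using c V Yi W by auto
      have "((A k)\<^sup>T * E (Suc k) * A k + Q k)\<^sup>T = (A k)\<^sup>T * E (Suc k) * A k + Q k"
        unfolding transpose_add[OF a(1) c(4)] 1 using Q_sym k by simp
      moreover have "(A k)\<^sup>T * E (Suc k) * A k + Q k \<in> carrier_mat n n" using a c by auto
      ultimately show ?thesis using transpose_minus[OF _ a(2)] 2 by metis
    qed
    ultimately show ?case by simp
  qed
  have "j \<le> K \<Longrightarrow> 0 \<le> quad (E j) (resp d j) + (\<Sum>k<j. quad (Q k) (resp d k) + quad (R k) (d k))" for j
  proof (induction j)
    case 0
    then show ?case using E(1)[of 0] by (simp add: quad_def)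
  next
    case (Suc j)
    then have j: "j < K" by simp
    have "quad (E j) (resp d j) \<le> quad (E (Suc j)) (A j *\<^sub>v resp d j + B j *\<^sub>v d j) + quad (Q j) (resp d j) + quad (R j) (d j)"
      using j d by (intro riccati_stage_nonneg[OF A B E(1) E_sym Q R Y ric] resp_carrier) (auto simp: dirs_def)
    then show ?case using Suc j by simp
  qed
  from this[of K] show ?thesis using E(2) by (simp add: curvature_def)
qed

text \<open>Summation by parts: the pairing of costate and response telescopes over the stages. The
  adjoint recursion is asked for from stage 1 on, because the response starts at zero.\<close>

lemma costate_identity:
  assumes d: "d \<in> dirs" and lam: "\<And>k. k \<le> K \<Longrightarrow> lam k \<in> carrier_vec n"
    and s: "\<And>k. k \<le> K \<Longrightarrow> s k \<in> carrier_vec n"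
    and "lam K = s K"
    and rec: "\<And>k. 1 \<le> k \<Longrightarrow> k < K \<Longrightarrow> lam k = (A k)\<^sup>T *\<^sub>v lam (Suc k) + s k"
  shows "s K \<bullet> resp d K + (\<Sum>k<K. s k \<bullet> resp d k) = (\<Sum>k<K. ((B k)\<^sup>T *\<^sub>v lam (Suc k)) \<bullet> d k)"
proof -
  have "j \<le> K \<Longrightarrow> lam j \<bullet> resp d j + (\<Sum>k<j. s k \<bullet> resp d k) = (\<Sum>k<j. ((B k)\<^sup>T *\<^sub>v lam (Suc k)) \<bullet> d k)" for j
  proof (induction j)
    case 0
    then show ?case using lam[of 0] by simp
  next
    case (Suc j)
    then have j: "j < K" by simp
    have c: "resp d j \<in> carrier_vec n" "d j \<in> carrier_vec m" "lam (Suc j) \<in> carrier_vec n"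
      "s j \<in> carrier_vec n"
      using d j lam s by (auto simp: dirs_def intro!: resp_carrier)
    have e: "lam j \<bullet> resp d j = ((A j)\<^sup>T *\<^sub>v lam (Suc j)) \<bullet> resp d j + s j \<bullet> resp d j"
    proof (cases "j = 0")
      case True
      then show ?thesis using lam[of 0] c A[OF j] by auto
    next
      case False
      then show ?thesis using rec[of j] j c A[OF j] by (simp add: add_scalar_prod_distrib[of _ n])
    qed
    have "lam (Suc j) \<bullet> resp d (Suc j) = lam (Suc j) \<bullet> (A j *\<^sub>v resp d j) + lam (Suc j) \<bullet> (B j *\<^sub>v d j)"
      using c A[OF j] B[OF j] by (simp add: scalar_prod_add_distrib[of _ n])
    also have "\<dots> = ((A j)\<^sup>T *\<^sub>v lam (Suc j)) \<bullet> resp d j + ((B j)\<^sup>T *\<^sub>v lam (Suc j)) \<bullet> d j"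
      using transpose_vec_mult_scalar[OF A[OF j] c(1) c(3)] transpose_vec_mult_scalar[OF B[OF j] c(2) c(3)] by simp
    finally show ?case using Suc e j by simp
  qed
  from this[of K] show ?thesis using assms(4) by simp
qed

end

section \<open>Optimality of a single player\<close>

lemma vsum_perturb:
  assumes "finite S" "i \<in> S" "\<And>j. j \<in> S \<Longrightarrow> j \<noteq> i \<Longrightarrow> f j = g j" "f i = g i + h"
    "h \<in> carrier_vec n"
  shows "vsum n f S = vsum n g S + h"
proof (rule eq_vecI)
  fix a assume "a < dim_vec (vsum n g S + h)"
  then have a: "a < n" using assms by simp
  have "(\<Sum>j\<in>S. f j $ a) = f i $ a + (\<Sum>j\<in>S - {i}. f j $ a)" using assms by (intro sum.remove) auto
  also have "(\<Sum>j\<in>S - {i}. f j $ a) = (\<Sum>j\<in>S - {i}. g j $ a)" using assms by (intro sum.cong) auto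
  also have "f i $ a = g i $ a + h $ a" using assms a by simp
  also have "(\<Sum>j\<in>S. g j $ a) = g i $ a + (\<Sum>j\<in>S - {i}. g j $ a)" using assms by (intro sum.remove) auto
  ultimately show "vsum n f S $ a = (vsum n g S + h) $ a"
    using a assms(5) by simp
qed (use assms in auto)

text \<open>A recursion from a terminal value becomes primitive when it counts the stages to go,
  \<open>K - k\<close>.\<close>

lemma backward_recursion:
  "\<exists>f. f (K::nat) = a \<and> (\<forall>k<K. f k = F k (f (Suc k)))"
proof -
  define f where "f k = rec_nat a (\<lambda>j. F (K - Suc j)) (K - k)" for k
  have "f k = F k (f (Suc k))" if "k < K" for k
  proof -
    have "K - k = Suc (K - Suc k)" using that by simp
    then show ?thesis using that by (simp add: f_def del: diff_Suc_eq_diff_pred)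
  qed
  then show ?thesis by (intro exI[of _ f]) (auto simp: f_def)
qed

text \<open>Takes the place of a constraint qualification: among finitely many affine constraints
  the active ones do not decrease along w and the inactive ones have slack, so a short step stays
  feasible.\<close>

lemma small_step:
  fixes c w :: "'i \<Rightarrow> real"
  assumes "finite S" "\<And>s. s \<in> S \<Longrightarrow> 0 \<le> c s" "\<And>s. s \<in> S \<Longrightarrow> c s = 0 \<Longrightarrow> 0 \<le> w s"
  shows "\<exists>T>0. \<forall>t. 0 \<le> t \<and> t \<le> T \<longrightarrow> (\<forall>s\<in>S. 0 \<le> c s + t * w s)"
  using assms
proof (induction S rule: finite_induct)
  case empty
  then show ?case by (auto intro: exI[of _ 1])
next
  case (insert s S)
  then obtain T where T: "T > 0" "\<And>t r. 0 \<le> t \<Longrightarrow> t \<le> T \<Longrightarrow> r \<in> S \<Longrightarrow> 0 \<le> c r + t * w r" by force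
  show ?case
  proof (cases "0 \<le> w s")
    case True
    then show ?thesis using T insert.prems(1)[of s] by (intro exI[of _ T]) auto
  next
    case False
    then have cs: "0 < c s" using insert.prems(1)[of s] insert.prems(2)[of s] by force
    \<comment> \<open>The ratio is the step length at which constraint s becomes active.\<close>
    let ?T = "min T (c s / (- w s))"
    have "0 \<le> c s + t * w s" if "t \<le> ?T" for t
    proof -
      have "t \<le> c s / (- w s)" using that by simp
      then have "t * (- w s) \<le> c s" using False by (subst (asm) pos_le_divide_eq) auto
      then show ?thesis by simp
    qed
    moreover have "0 < ?T" using T cs False by (auto intro!: divide_pos_pos simp: divide_pos_neg)
    ultimately show ?thesis using T by (intro exI[of _ ?T]) auto
  qed
qed

lemma scalar_prod_self_eq_0:
  assumes "(v :: real vec) \<in> carrier_vec n" "v \<bullet> v = 0"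
  shows "v = 0\<^sub>v n"
proof (rule eq_vecI)
  have "(\<Sum>a<n. v $ a * v $ a) = 0" using assms by (auto simp: scalar_prod_def lessThan_atLeast0)
  then have "\<forall>a\<in>{..<n}. v $ a * v $ a = 0" by (subst (asm) sum_nonneg_eq_0_iff) auto
  then show "v $ a = 0\<^sub>v n $ a" if "a < dim_vec (0\<^sub>v n)" for a using that by simp
qed (use assms in auto)

section \<open>First-order conditions of a player\<close>

definition cval :: "dgc \<Rightarrow> real vec \<Rightarrow> profile \<Rightarrow> nat \<Rightarrow> nat \<Rightarrow> real vec" where
  "cval G x0 u i k = Mm G i k *\<^sub>v state G x0 u k + Nm G i k *\<^sub>v ustage G u k + rv G i k"

text \<open>State derivative of the player's Lagrangian at stage k. No constraint is posed at the
  final stage, so no multiplier enters there.\<close>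

definition grad :: "dgc \<Rightarrow> real vec \<Rightarrow> profile \<Rightarrow> nat \<Rightarrow> (nat \<Rightarrow> real vec) \<Rightarrow> nat \<Rightarrow> real vec" where
  "grad G x0 u i \<mu> k = (let g = Qm G i k *\<^sub>v state G x0 u k + pv G i k in
     if k < hor G then g - (Mm G i k)\<^sup>T *\<^sub>v \<mu> k else g)"

text \<open>The adjoint equation is imposed from stage 1 on, since the initial state is given and
  not varied.\<close>

definition costate :: "dgc \<Rightarrow> real vec \<Rightarrow> profile \<Rightarrow> nat \<Rightarrow> (nat \<Rightarrow> real vec) \<Rightarrow> (nat \<Rightarrow> real vec) \<Rightarrow> bool" where
  "costate G x0 u i \<mu> lam \<longleftrightarrow> (\<forall>k\<le>hor G. lam k \<in> carrier_vec (nx G)) \<and>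
     lam (hor G) = grad G x0 u i \<mu> (hor G) \<and>
     (\<forall>k. 1 \<le> k \<and> k < hor G \<longrightarrow> lam k = (Am G k)\<^sup>T *\<^sub>v lam (Suc k) + grad G x0 u i \<mu> k)"

text \<open>Control derivative of the Hamiltonian. Constraints demand that \<open>cval\<close> be
  nonnegative, hence the minus sign of the multiplier term.\<close>

definition hamiltonian_grad where
  "hamiltonian_grad G u i \<mu> lam k = Rm G i i k *\<^sub>v u i k + (Bm G i k)\<^sup>T *\<^sub>v lam (Suc k) - (Nblk G i i k)\<^sup>T *\<^sub>v \<mu> k"

definition stationary :: "dgc \<Rightarrow> real vec \<Rightarrow> profile \<Rightarrow> nat \<Rightarrow> (nat \<Rightarrow> real vec) \<Rightarrow> bool" where
  "stationary G x0 u i \<mu> \<longleftrightarrow> (\<exists>lam. costate G x0 u i \<mu> lam \<and>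
     (\<forall>k<hor G. hamiltonian_grad G u i \<mu> lam k = 0\<^sub>v (nu G i)))"

section \<open>The game from a fixed initial state\<close>

locale game =
  fixes G :: dgc and x0 :: "real vec"
  assumes wf: "dgc_wf G" and x0: "x0 \<in> carrier_vec (nx G)"
begin

abbreviation "K \<equiv> hor G"
abbreviation "N \<equiv> npl G"
abbreviation "n \<equiv> nx G"

lemma carriers:
  "k < K \<Longrightarrow> Am G k \<in> carrier_mat n n"
  "i < N \<Longrightarrow> k < K \<Longrightarrow> Bm G i k \<in> carrier_mat n (nu G i)"
  "i < N \<Longrightarrow> k < K \<Longrightarrow> Mm G i k \<in> carrier_mat (nc G i) n"
  "i < N \<Longrightarrow> k < K \<Longrightarrow> Nm G i k \<in> carrier_mat (nc G i) (nu_tot G)"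
  "i < N \<Longrightarrow> k < K \<Longrightarrow> rv G i k \<in> carrier_vec (nc G i)"
  "i < N \<Longrightarrow> j < N \<Longrightarrow> k < K \<Longrightarrow> Rm G i j k \<in> carrier_mat (nu G j) (nu G j)"
  "i < N \<Longrightarrow> k \<le> K \<Longrightarrow> Qm G i k \<in> carrier_mat n n"
  "i < N \<Longrightarrow> k \<le> K \<Longrightarrow> pv G i k \<in> carrier_vec n"
  "Nblk G i j k \<in> carrier_mat (nc G i) (nu G j)"
  using wf by (auto simp: dgc_wf_def Nblk_def)

lemma syms:
  "i < N \<Longrightarrow> k \<le> K \<Longrightarrow> (Qm G i k)\<^sup>T = Qm G i k"
  "i < N \<Longrightarrow> k < K \<Longrightarrow> (Rm G i i k)\<^sup>T = Rm G i i k"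
  using wf by (auto simp: dgc_wf_def)

end

locale game_profile = game +
  fixes u :: profile
  assumes u: "\<And>i. i < N \<Longrightarrow> u i \<in> strategies G i"
begin

lemma u_carrier: "i < N \<Longrightarrow> k < K \<Longrightarrow> u i k \<in> carrier_vec (nu G i)"
  using u by (auto simp: strategies_def)

lemma state_Suc:
  assumes "k < K"
  shows "state G x0 u (Suc k) = Am G k *\<^sub>v state G x0 u k + vsum n (\<lambda>i. Bm G i k *\<^sub>v u i k) {..<N}"
proof -
  have "Bm G i k *\<^sub>v u i k \<in> carrier_vec n" if "i < N" for i
    using carriers(2)[OF that assms] u_carrier[OF that assms] by auto
  then show ?thesis using finsum_vec_vsum[of "{..<N}" "\<lambda>i. Bm G i k *\<^sub>v u i k" n] by simp
qed

lemma state_carrier: "k \<le> K \<Longrightarrow> state G x0 u k \<in> carrier_vec n"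
proof (induction k)
  case (Suc k)
  then show ?case using carriers(1)[of k] unfolding state_Suc[OF Suc_le_lessD[OF Suc.prems]] by auto
qed (simp add: x0)

lemma ustage_carrier: "k < K \<Longrightarrow> ustage G u k \<in> carrier_vec (nu_tot G)"
  unfolding ustage_def nu_tot_def using u_carrier by (intro vec_stack_carrier) auto

lemma Nm_mult_ustage:
  assumes "i < N" "k < K"
  shows "Nm G i k *\<^sub>v ustage G u k = vsum (nc G i) (\<lambda>j. Nblk G i j k *\<^sub>v u j k) {..<N}"
  unfolding ustage_def Nblk_def
  using assms u_carrier carriers(4)[OF assms] by (intro mult_vec_stack_col_blocks) (auto simp: nu_tot_def)

lemma cval_carrier: "i < N \<Longrightarrow> k < K \<Longrightarrow> cval G x0 u i k \<in> carrier_vec (nc G i)"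
  using carriers(3-5)[of i k] by (intro carrier_vecI) (auto simp: cval_def)

end

section \<open>Deviations of a single player\<close>

locale player = game_profile +
  fixes i :: nat
  assumes i: "i < N"
begin

sublocale lq_path K n "nu G i" "Am G" "Bm G i" "Qm G i" "Rm G i i"
  using carriers syms i by unfold_locales auto

lemma profile_upd: "v \<in> strategies G i \<Longrightarrow> game_profile G x0 (u(i := v))"
  using u by unfold_locales auto

text \<open>Derivative of the player's own constraint values: d acts through the state response and
  through the own column block.\<close>

definition "lin_con d k = Mm G i k *\<^sub>v resp d k + Nblk G i i k *\<^sub>v d k"

lemma lin_con_carrier: "k < K \<Longrightarrow> lin_con d k \<in> carrier_vec (nc G i)"
  using carriers(3)[OF i, of k] carriers(9)[of i i k] by (intro carrier_vecI) (auto simp: lin_con_def)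

text \<open>First-order part of the own cost. Terms that weight the other players' inputs are
  constant along own deviations and drop out.\<close>

definition "slope d = (Qm G i K *\<^sub>v state G x0 u K + pv G i K) \<bullet> resp d K
  + (\<Sum>k<K. (Qm G i k *\<^sub>v state G x0 u k + pv G i k) \<bullet> resp d k + (Rm G i i k *\<^sub>v u i k) \<bullet> d k)"

context
  fixes d v :: "nat \<Rightarrow> real vec"
  assumes d: "d \<in> dirs" and v: "\<And>k. k < K \<Longrightarrow> v k = u i k + d k"
begin

lemma dk: "k < K \<Longrightarrow> d k \<in> carrier_vec (nu G i)"
  using d by (simp add: dirs_def)

lemma v_strategies: "v \<in> strategies G i"
  using u_carrier[OF i] dk v by (auto simp: strategies_def)

text \<open>Strategies are functions on all natural numbers, so v is tied to u and d only below the
  horizon; inputs beyond it never reach the states up to stage K.\<close>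

lemma state_perturb: "k \<le> K \<Longrightarrow> state G x0 (u(i := v)) k = state G x0 u k + resp d k"
proof (induction k)
  case 0
  then show ?case using x0 by simp
next
  case (Suc k)
  then have k: "k < K" by simp
  interpret v: game_profile G x0 "u(i := v)" by (rule profile_upd[OF v_strategies])
  have c: "state G x0 u k \<in> carrier_vec n" "resp d k \<in> carrier_vec n" "Bm G i k *\<^sub>v d k \<in> carrier_vec n"
    using k state_carrier resp_carrier[OF d] B[OF k] dk by auto
  have "vsum n (\<lambda>j. Bm G j k *\<^sub>v (u(i := v)) j k) {..<N} = vsum n (\<lambda>j. Bm G j k *\<^sub>v u j k) {..<N} + Bm G i k *\<^sub>v d k"
    using i c(3) v[OF k] mult_add_distrib_mat_vec[OF B[OF k] u_carrier[OF i k] dk[OF k]]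
    by (intro vsum_perturb) auto
  moreover have "Am G k *\<^sub>v state G x0 (u(i := v)) k = Am G k *\<^sub>v state G x0 u k + Am G k *\<^sub>v resp d k"
    unfolding Suc.IH[OF less_imp_le[OF k]] by (rule mult_add_distrib_mat_vec[OF A[OF k] c(1,2)])
  ultimately show ?case
    unfolding state_Suc[OF k] v.state_Suc[OF k] resp.simps
    by (intro eq_vecI) (use A[OF k] B[OF k] in \<open>auto simp: algebra_simps simp del: index_mult_mat_vec\<close>)
qed

lemma cval_perturb:
  assumes k: "k < K"
  shows "cval G x0 (u(i := v)) i k = cval G x0 u i k + lin_con d k"
proof -
  interpret v: game_profile G x0 "u(i := v)" by (rule profile_upd[OF v_strategies])
  have c: "state G x0 u k \<in> carrier_vec n" "resp d k \<in> carrier_vec n"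
    "Nblk G i i k *\<^sub>v d k \<in> carrier_vec (nc G i)"
    using k state_carrier resp_carrier[OF d] carriers(9)[of i i k] dk by auto
  have "Nm G i k *\<^sub>v ustage G (u(i := v)) k = Nm G i k *\<^sub>v ustage G u k + Nblk G i i k *\<^sub>v d k"
    unfolding Nm_mult_ustage[OF i k] v.Nm_mult_ustage[OF i k]
    using i c(3) v[OF k] mult_add_distrib_mat_vec[OF carriers(9) u_carrier[OF i k] dk[OF k]]
    by (intro vsum_perturb) auto
  moreover have "Mm G i k *\<^sub>v state G x0 (u(i := v)) k = Mm G i k *\<^sub>v state G x0 u k + Mm G i k *\<^sub>v resp d k"
    using k mult_add_distrib_mat_vec[OF carriers(3)[OF i k] c(1,2)] state_perturb[of k] by simp
  ultimately show ?thesis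
    unfolding cval_def lin_con_def
    by (intro eq_vecI)
      (use carriers(3-5)[OF i k] carriers(9)[of i i k] in \<open>auto simp: algebra_simps simp del: index_mult_mat_vec\<close>)
qed

text \<open>The cost is quadratic, so the second-order expansion is exact; symmetry of the weights
  merges the two mixed terms of each form.\<close>

lemma cost_perturb: "cost G x0 i (u(i := v)) = cost G x0 i u + slope d + curvature d / 2"
proof -
  let ?x = "state G x0 u" and ?r = "resp d"
  have x: "?x k \<in> carrier_vec n" "?r k \<in> carrier_vec n" if "k \<le> K" for k
    using that state_carrier resp_carrier[OF d] by auto
  have q: "quad (Qm G i k) (?x k + ?r k) = quad (Qm G i k) (?x k) + 2 * ((Qm G i k *\<^sub>v ?x k) \<bullet> ?r k) + quad (Qm G i k) (?r k)"
    "pv G i k \<bullet> (?x k + ?r k) = pv G i k \<bullet> ?x k + pv G i k \<bullet> ?r k"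
    "(Qm G i k *\<^sub>v ?x k + pv G i k) \<bullet> ?r k = (Qm G i k *\<^sub>v ?x k) \<bullet> ?r k + pv G i k \<bullet> ?r k" if "k \<le> K" for k
    using that x[OF that] carriers(7,8)[OF i that] quad_add[OF Q[OF that] Q_sym[OF that] x[OF that]]
    by (auto simp: scalar_prod_add_distrib[of _ n] add_scalar_prod_distrib[of _ n])
  have r: "(\<Sum>j<N. quad (Rm G i j k) ((u(i := v)) j k)) = (\<Sum>j<N. quad (Rm G i j k) (u j k))
    + 2 * ((Rm G i i k *\<^sub>v u i k) \<bullet> d k) + quad (Rm G i i k) (d k)" if k: "k < K" for k
  proof -
    have "(\<Sum>j<N. quad (Rm G i j k) ((u(i := v)) j k)) = quad (Rm G i i k) (v k) + (\<Sum>j\<in>{..<N} - {i}. quad (Rm G i j k) (u j k))"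
      using i by (subst sum.remove[of _ i]) (auto intro!: sum.cong)
    moreover have "(\<Sum>j<N. quad (Rm G i j k) (u j k)) = quad (Rm G i i k) (u i k) + (\<Sum>j\<in>{..<N} - {i}. quad (Rm G i j k) (u j k))"
      using i by (subst sum.remove[of _ i]) auto
    moreover have "quad (Rm G i i k) (v k) = quad (Rm G i i k) (u i k) + 2 * ((Rm G i i k *\<^sub>v u i k) \<bullet> d k) + quad (Rm G i i k) (d k)"
      unfolding v[OF k] by (rule quad_add[OF R[OF k] R_sym[OF k] u_carrier[OF i k] dk[OF k]])
    ultimately show ?thesis by simp
  qed
  have "(\<Sum>k<K. quad (Qm G i k) (state G x0 (u(i := v)) k) + 2 * (pv G i k \<bullet> state G x0 (u(i := v)) k)
      + (\<Sum>j<N. quad (Rm G i j k) ((u(i := v)) j k)))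
    = (\<Sum>k<K. (quad (Qm G i k) (?x k) + 2 * (pv G i k \<bullet> ?x k) + (\<Sum>j<N. quad (Rm G i j k) (u j k)))
      + 2 * ((Qm G i k *\<^sub>v ?x k + pv G i k) \<bullet> ?r k + (Rm G i i k *\<^sub>v u i k) \<bullet> d k)
      + (quad (Qm G i k) (?r k) + quad (Rm G i i k) (d k)))"
    by (intro sum.cong refl) (simp add: state_perturb q r del: fun_upd_apply)
  then show ?thesis
    unfolding cost_def Let_def slope_def curvature_def
    using q[of K] state_perturb[of K]
    by (simp add: sum.distrib sum_distrib_left[symmetric] algebra_simps)
qed

text \<open>Eliminates the state response from the slope by means of the adjoint equation. With
  vanishing Hamiltonian gradient this yields sufficiency of the multiplier conditions; with d equal
  to that gradient it yields stationarity.\<close>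

lemma slope_costate:
  assumes \<mu>: "\<And>k. k < K \<Longrightarrow> \<mu> k \<in> carrier_vec (nc G i)" and lam: "costate G x0 u i \<mu> lam"
  shows "slope d = (\<Sum>k<K. \<mu> k \<bullet> lin_con d k) + (\<Sum>k<K. hamiltonian_grad G u i \<mu> lam k \<bullet> d k)"
proof -
  let ?x = "state G x0 u" and ?r = "resp d" and ?s = "grad G x0 u i \<mu>"
  let ?g = "\<lambda>k. Qm G i k *\<^sub>v ?x k + pv G i k" and ?bl = "\<lambda>k. (Bm G i k)\<^sup>T *\<^sub>v lam (Suc k)"
  have x: "?x k \<in> carrier_vec n" "?r k \<in> carrier_vec n" if "k \<le> K" for k
    using that state_carrier resp_carrier[OF d] by auto
  have s: "?s k \<in> carrier_vec n" if "k \<le> K" for k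
    using that x[OF that] carriers(7,8)[OF i that] carriers(3)[OF i, of k]
    by (intro carrier_vecI) (auto simp: grad_def Let_def)
  have id: "?s K \<bullet> ?r K + (\<Sum>k<K. ?s k \<bullet> ?r k) = (\<Sum>k<K. ?bl k \<bullet> d k)"
    using lam by (intro costate_identity[OF d _ s]) (auto simp: costate_def)
  \<comment> \<open>The response terms do not cancel stage by stage; together with the terminal term
    they do so after summation, by \<open>id\<close>.\<close>
  have "(\<Sum>k<K. ?g k \<bullet> ?r k + (Rm G i i k *\<^sub>v u i k) \<bullet> d k)
    = (\<Sum>k<K. \<mu> k \<bullet> lin_con d k + hamiltonian_grad G u i \<mu> lam k \<bullet> d k + ?s k \<bullet> ?r k - ?bl k \<bullet> d k)"
  proof (rule sum.cong[OF refl])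
    fix k assume "k \<in> {..<K}"
    then have k: "k < K" "k \<le> K" by auto
    have lk: "lam (Suc k) \<in> carrier_vec n" using lam k by (simp add: costate_def)
    have c: "?g k \<in> carrier_vec n" "(Mm G i k)\<^sup>T *\<^sub>v \<mu> k \<in> carrier_vec n"
      "Mm G i k *\<^sub>v ?r k \<in> carrier_vec (nc G i)" "Nblk G i i k *\<^sub>v d k \<in> carrier_vec (nc G i)"
      "Rm G i i k *\<^sub>v u i k \<in> carrier_vec (nu G i)" "?bl k \<in> carrier_vec (nu G i)"
      "(Nblk G i i k)\<^sup>T *\<^sub>v \<mu> k \<in> carrier_vec (nu G i)"
      using carriers(3)[OF i k(1)] carriers(7,8)[OF i k(2)] x[OF k(2)] carriers(9)[of i i k] R[OF k(1)] B[OF k(1)]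
        \<mu>[OF k(1)] dk[OF k(1)] u_carrier[OF i k(1)] lk by auto
    have "?s k \<bullet> ?r k = ?g k \<bullet> ?r k - \<mu> k \<bullet> (Mm G i k *\<^sub>v ?r k)"
      using k c x[OF k(2)] transpose_vec_mult_scalar[OF carriers(3)[OF i k(1)] x(2)[OF k(2)] \<mu>[OF k(1)]]
      by (simp add: grad_def minus_scalar_prod_distrib[of _ n])
    moreover have "\<mu> k \<bullet> lin_con d k = \<mu> k \<bullet> (Mm G i k *\<^sub>v ?r k) + \<mu> k \<bullet> (Nblk G i i k *\<^sub>v d k)"
      using c \<mu>[OF k(1)] by (simp add: lin_con_def scalar_prod_add_distrib[of _ "nc G i"])
    moreover have "hamiltonian_grad G u i \<mu> lam k \<bullet> d k = (Rm G i i k *\<^sub>v u i k) \<bullet> d k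
        + ?bl k \<bullet> d k - \<mu> k \<bullet> (Nblk G i i k *\<^sub>v d k)"
      using c dk[OF k(1)] transpose_vec_mult_scalar[OF carriers(9) dk[OF k(1)] \<mu>[OF k(1)], of k]
      by (simp add: hamiltonian_grad_def minus_scalar_prod_distrib[of _ "nu G i"] add_scalar_prod_distrib[of _ "nu G i"])
    ultimately show "?g k \<bullet> ?r k + (Rm G i i k *\<^sub>v u i k) \<bullet> d k
      = \<mu> k \<bullet> lin_con d k + hamiltonian_grad G u i \<mu> lam k \<bullet> d k + ?s k \<bullet> ?r k - ?bl k \<bullet> d k"
      by linarith
  qed
  moreover have "?s K = Qm G i K *\<^sub>v ?x K + pv G i K" by (simp add: grad_def)
  ultimately show ?thesis using id unfolding slope_def by (simp add: sum.distrib sum_subtractf)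
qed

end

text \<open>Linearity along \<open>comb\<close>, in the form that \<open>farkas\<close> asks
  for.\<close>

lemma lin_con_comb:
  assumes "d \<in> dirs" "e \<in> dirs" "k < K"
  shows "lin_con (comb d c e) k = lin_con d k + c \<cdot>\<^sub>v lin_con e k"
proof -
  have c: "d k \<in> carrier_vec (nu G i)" "e k \<in> carrier_vec (nu G i)" "resp d k \<in> carrier_vec n" "resp e k \<in> carrier_vec n"
    using assms by (auto simp: dirs_def intro!: resp_carrier)
  have kK: "k \<le> K" using assms by simp
  show ?thesis
    unfolding lin_con_def resp_comb[OF assms(1,2) kK] comb_def[of d c e k]
      mult_comb[OF carriers(3)[OF i assms(3)] c(3,4)] mult_comb[OF carriers(9) c(1,2)]
    by (intro eq_vecI)
      (use carriers(3)[OF i assms(3)] carriers(9)[of i i k] lin_con_carrier[OF assms(3), of e, unfolded lin_con_def] in \<open>auto simp: algebra_simps simp del: index_mult_mat_vec\<close>)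
qed

lemma slope_comb:
  assumes "d \<in> dirs" "e \<in> dirs"
  shows "slope (comb d c e) = slope d + c * slope e"
proof -
  let ?g = "\<lambda>k. Qm G i k *\<^sub>v state G x0 u k + pv G i k" and ?h = "\<lambda>k. Rm G i i k *\<^sub>v u i k"
  have rc: "a \<bullet> resp (comb d c e) k = a \<bullet> resp d k + c * (a \<bullet> resp e k)" if "a \<in> carrier_vec n" "k \<le> K" for a k
    using that resp_carrier[OF assms(1) that(2)] resp_carrier[OF assms(2) that(2)]
    by (simp add: resp_comb[OF assms] scalar_prod_add_distrib[of _ n])
  have dc: "a \<bullet> comb d c e k = a \<bullet> d k + c * (a \<bullet> e k)" if "a \<in> carrier_vec (nu G i)" "k < K" for a k
    using that assms by (simp add: comb_def dirs_def scalar_prod_add_distrib[of _ "nu G i"])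
  have g: "?g k \<in> carrier_vec n" if "k \<le> K" for k
    using carriers(8)[OF i that] by (intro carrier_vecI) auto
  have h: "?h k \<in> carrier_vec (nu G i)" if "k < K" for k
    using R[OF that] by (intro carrier_vecI) auto
  have "(\<Sum>k<K. ?g k \<bullet> resp (comb d c e) k + ?h k \<bullet> comb d c e k)
    = (\<Sum>k<K. (?g k \<bullet> resp d k + ?h k \<bullet> d k)
       + c * (?g k \<bullet> resp e k + ?h k \<bullet> e k))"
    by (intro sum.cong refl) (simp add: rc g dc h algebra_simps)
  then show ?thesis
    unfolding slope_def rc[OF g[OF order_refl] order_refl]
    by (simp add: sum.distrib sum_distrib_left[symmetric] algebra_simps)
qed


lemma ex_costate:
  assumes "\<And>k. k < K \<Longrightarrow> \<mu> k \<in> carrier_vec (nc G i)"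
  shows "\<exists>lam. costate G x0 u i \<mu> lam"
proof -
  let ?s = "grad G x0 u i \<mu>"
  have s: "?s k \<in> carrier_vec n" if "k \<le> K" for k
    using that carriers(7,8)[OF i that] carriers(3)[OF i, of k]
    by (intro carrier_vecI) (auto simp: grad_def Let_def)
  obtain lam where lam: "lam K = ?s K" "\<forall>k<K. lam k = (Am G k)\<^sup>T *\<^sub>v lam (Suc k) + ?s k"
    using backward_recursion[of K "?s K" "\<lambda>k y. (Am G k)\<^sup>T *\<^sub>v y + ?s k"] by auto
  have "lam k \<in> carrier_vec n" if "k \<le> K" for k
    using that lam s by (cases "k = K") (auto intro!: carrier_vecI)
  then show ?thesis using lam by (auto simp: costate_def)
qed

section \<open>Optimality and multipliers\<close>

definition own_feasible :: "bool" where
  "own_feasible \<longleftrightarrow> (\<forall>k<K. 0\<^sub>v (nc G i) \<le> cval G x0 u i k)"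

definition own_optimal :: "bool" where
  "own_optimal \<longleftrightarrow> (\<forall>v \<in> admissible_own G x0 i u. cost G x0 i u \<le> cost G x0 i (u(i := v)))"

text \<open>Multipliers are attached to the player's own constraints alone; the matching set of
  deviations is \<open>admissible_own\<close>.\<close>

definition kkt :: "(nat \<Rightarrow> real vec) \<Rightarrow> bool" where
  "kkt \<mu> \<longleftrightarrow> (\<forall>k<K. \<mu> k \<in> carrier_vec (nc G i) \<and> 0\<^sub>v (nc G i) \<le> \<mu> k \<and> cval G x0 u i k \<bullet> \<mu> k = 0)
     \<and> stationary G x0 u i \<mu>"

text \<open>Stationarity reduces the slope to the pairing of the multipliers with the linearised
  constraints, which is nonnegative along admissible deviations; the curvature term can only add to
  the cost.\<close>

lemma kkt_imp_optimal:
  assumes curv: "\<And>d. d \<in> dirs \<Longrightarrow> 0 \<le> curvature d" and kkt: "kkt \<mu>"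
  shows own_optimal
  unfolding own_optimal_def
proof
  fix v assume v: "v \<in> admissible_own G x0 i u"
  then have vs: "v \<in> strategies G i" and vc: "\<And>k. k < K \<Longrightarrow> constr G x0 (u(i := v)) i k"
    by (auto simp: admissible_own_def)
  define d where "d k = v k - u i k" for k
  have d: "d \<in> dirs" using vs u_carrier[OF i] by (auto simp: dirs_def strategies_def d_def)
  have vd: "v k = u i k + d k" if "k < K" for k
    using vs u_carrier[OF i that] that by (intro eq_vecI) (auto simp: strategies_def d_def)
  have \<mu>: "\<mu> k \<in> carrier_vec (nc G i)" "0\<^sub>v (nc G i) \<le> \<mu> k" "cval G x0 u i k \<bullet> \<mu> k = 0" if "k < K" for k
    using kkt that by (auto simp: kkt_def)
  obtain lam where lam: "costate G x0 u i \<mu> lam" "\<forall>k<K. hamiltonian_grad G u i \<mu> lam k = 0\<^sub>v (nu G i)"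
    using kkt by (auto simp: kkt_def stationary_def)
  \<comment> \<open>The new constraint value is nonnegative, and complementarity removes the old one
    from the pairing.\<close>
  have "0 \<le> \<mu> k \<bullet> lin_con d k" if k: "k < K" for k
  proof -
    have c: "cval G x0 u i k \<in> carrier_vec (nc G i)" "lin_con d k \<in> carrier_vec (nc G i)"
      using cval_carrier[OF i k] lin_con_carrier[OF k] by auto
    have "0\<^sub>v (nc G i) \<le> cval G x0 u i k + lin_con d k"
      using vc[OF k] cval_perturb[OF d vd k] by (simp add: constr_def cval_def)
    then have "0 \<le> \<mu> k \<bullet> (cval G x0 u i k + lin_con d k)"
      using \<mu>[OF k] by (auto simp: scalar_prod_def less_eq_vec_def intro!: sum_nonneg mult_nonneg_nonneg)
    also have "\<dots> = \<mu> k \<bullet> cval G x0 u i k + \<mu> k \<bullet> lin_con d k"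
      by (rule scalar_prod_add_distrib[OF \<mu>(1)[OF k] c])
    also have "\<mu> k \<bullet> cval G x0 u i k = 0" using \<mu>[OF k] c by (simp add: comm_scalar_prod[of "\<mu> k" "nc G i"])
    finally show ?thesis by simp
  qed
  moreover have "hamiltonian_grad G u i \<mu> lam k \<bullet> d k = 0" if "k < K" for k
    using lam(2) that d by (simp add: dirs_def)
  ultimately have "0 \<le> slope d"
    using slope_costate[OF d vd \<mu>(1) lam(1)] by (auto intro!: sum_nonneg)
  then show "cost G x0 i u \<le> cost G x0 i (u(i := v))"
    using cost_perturb[OF d vd] curv[OF d] by simp
qed

text \<open>After Farkas the slope is a combination of constraint derivatives along all deviations,
  feasible or not. This makes the Hamiltonian gradient itself a legitimate test direction.\<close>

lemma optimal_imp_kkt: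
  assumes curv: "\<And>d. d \<in> dirs \<Longrightarrow> 0 \<le> curvature d" and own_feasible own_optimal
  shows "\<exists>\<mu>. kkt \<mu>"
proof -
  let ?c = "\<lambda>(k, a). cval G x0 u i k $ a"
  let ?w = "\<lambda>(k, a) d. lin_con d k $ a"
  define I where "I = {..<K} \<times> {..<nc G i}"
  \<comment> \<open>Stages and components at which the constraint is active; only these restrict the
    direction.\<close>
  define S where "S = {s \<in> I. ?c s = 0}"
  have fin: "finite I" "finite S" by (auto simp: I_def S_def)
  have c0: "0 \<le> ?c s" if "s \<in> I" for s
    using that assms(2) cval_carrier[OF i] by (auto simp: I_def own_feasible_def less_eq_vec_def)
  have slope_nonneg: "0 \<le> slope d" if d: "d \<in> dirs" and act: "\<And>s. s \<in> S \<Longrightarrow> 0 \<le> ?w s d" for d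
  proof -
    have "\<exists>T>0. \<forall>t. 0 \<le> t \<and> t \<le> T \<longrightarrow> (\<forall>s\<in>I. 0 \<le> ?c s + t * ?w s d)"
      by (rule small_step[OF fin(1)]) (use c0 act in \<open>auto simp: S_def\<close>)
    then obtain T where T: "T > 0" "\<And>t s. 0 \<le> t \<Longrightarrow> t \<le> T \<Longrightarrow> s \<in> I \<Longrightarrow> 0 \<le> ?c s + t * ?w s d"
      by blast
    have step: "0 \<le> slope d + t / 2 * curvature d" if t: "0 < t" "t \<le> T" for t
    proof -
      \<comment> \<open>The deviation with step length t in direction d.\<close>
      define e v where "e = comb d (t - 1) d" and "v k = u i k + e k" for k
      have e: "e \<in> dirs" unfolding e_def by (rule comb_dirs[OF d d])
      have sl: "slope e = t * slope d"
        unfolding e_def slope_comb[OF d d] by (simp add: algebra_simps)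
      have lc: "lin_con e k $ a = t * lin_con d k $ a" if "k < K" "a < nc G i" for k a
        using that lin_con_comb[OF d d that(1), of "t - 1"] lin_con_carrier[OF that(1), of d]
        by (simp add: e_def algebra_simps)
      have cv: "curvature e = t\<^sup>2 * curvature d" unfolding e_def by (rule curvature_scale[OF d])
      have "v \<in> admissible_own G x0 i u"
      proof -
        have "0\<^sub>v (nc G i) \<le> cval G x0 (u(i := v)) i k" if k: "k < K" for k
          using cval_perturb[OF e v_def k] cval_carrier[OF i k] lin_con_carrier[OF k, of e] lc[OF k] k
            T(2)[of t "(k, _)"] t
          by (auto simp: less_eq_vec_def I_def)
        then show ?thesis
          using v_strategies[OF e v_def] by (auto simp: admissible_own_def constr_def cval_def)
      qed
      then have "cost G x0 i u \<le> cost G x0 i (u(i := v))" using assms(3) by (auto simp: own_optimal_def)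
      then have "0 \<le> t * slope d + t\<^sup>2 * curvature d / 2" using cost_perturb[OF e v_def] sl cv by simp
      then have "0 \<le> t * (slope d + t / 2 * curvature d)" by (simp add: power2_eq_square algebra_simps)
      then show ?thesis using t by (simp add: zero_le_mult_iff)
    qed
    show ?thesis
    proof (rule ccontr)
      assume "\<not> 0 \<le> slope d"
      then have neg: "slope d < 0" by simp
      let ?C = "curvature d"
      \<comment> \<open>Small enough that t times the curvature is at most minus the slope, so the
        second-order term recovers at most half of the descent. The added 1 covers zero
        curvature.\<close>
      define t where "t = min T (- slope d / (?C + 1))"
      have C: "0 \<le> ?C" by (rule curv[OF d])
      have t: "0 < t" "t \<le> T" using T neg C by (auto simp: t_def intro!: divide_neg_pos)
      have "t * ?C \<le> t * (?C + 1)" using t by simp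
      also have "\<dots> \<le> - slope d"
      proof -
        have "t \<le> - slope d / (?C + 1)" by (simp add: t_def)
        moreover have "0 < ?C + 1" using C by simp
        ultimately show ?thesis by (simp only: pos_le_divide_eq)
      qed
      finally show False using step[OF t] neg by simp
    qed
  qed
  have "\<exists>\<nu>. (\<forall>s\<in>S. 0 \<le> \<nu> s) \<and> (\<forall>d\<in>dirs. slope d = (\<Sum>s\<in>S. \<nu> s * ?w s d))"
  proof (rule farkas[where comb = comb])
    show "dirs \<noteq> {}" using u_carrier[OF i] by (auto simp: dirs_def)
    show "?w s (comb x c y) = ?w s x + c * ?w s y" if "s \<in> S" "x \<in> dirs" "y \<in> dirs" for s x c y
      using that carrier_vecD[OF lin_con_carrier] by (auto simp: S_def I_def lin_con_comb)
  qed (use fin comb_dirs slope_comb slope_nonneg in auto)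
  then obtain \<nu> where \<nu>: "\<And>s. s \<in> S \<Longrightarrow> 0 \<le> \<nu> s" "\<And>d. d \<in> dirs \<Longrightarrow> slope d = (\<Sum>s\<in>S. \<nu> s * ?w s d)"
    by blast
  \<comment> \<open>Zero at inactive components, so that complementarity holds by
    construction.\<close>
  define \<mu> where "\<mu> k = vec (nc G i) (\<lambda>a. if (k, a) \<in> S then \<nu> (k, a) else 0)" for k
  have \<mu>c: "\<mu> k \<in> carrier_vec (nc G i)" for k by (simp add: \<mu>_def)
  have \<mu>0: "0\<^sub>v (nc G i) \<le> \<mu> k" for k using \<nu>(1) by (auto simp: \<mu>_def less_eq_vec_def)
  have compl: "cval G x0 u i k \<bullet> \<mu> k = 0" for k
    unfolding scalar_prod_def using \<mu>c[of k] by (intro sum.neutral) (auto simp: \<mu>_def S_def)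
  have slope_\<mu>: "slope d = (\<Sum>k<K. \<mu> k \<bullet> lin_con d k)" if "d \<in> dirs" for d
  proof -
    have "(\<Sum>s\<in>S. \<nu> s * ?w s d) = (\<Sum>s\<in>I. (if s \<in> S then \<nu> s else 0) * ?w s d)"
      using fin by (intro sum.mono_neutral_cong_left) (auto simp: S_def)
    also have "\<dots> = (\<Sum>k<K. \<Sum>a<nc G i. (if (k, a) \<in> S then \<nu> (k, a) else 0) * lin_con d k $ a)"
      unfolding I_def by (subst sum.cartesian_product) (auto intro!: sum.cong)
    also have "\<dots> = (\<Sum>k<K. \<mu> k \<bullet> lin_con d k)"
    proof (rule sum.cong[OF refl])
      fix k assume "k \<in> {..<K}"
      then show "(\<Sum>a<nc G i. (if (k, a) \<in> S then \<nu> (k, a) else 0) * lin_con d k $ a) = \<mu> k \<bullet> lin_con d k"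
        using lin_con_carrier[of k d] by (auto simp: scalar_prod_def \<mu>_def lessThan_atLeast0)
    qed
    finally show ?thesis using \<nu>(2)[OF that] by simp
  qed
  obtain lam where lam: "costate G x0 u i \<mu> lam" using ex_costate[of \<mu>] \<mu>c by blast
  define h where "h = hamiltonian_grad G u i \<mu> lam"
  have h: "h k \<in> carrier_vec (nu G i)" if "k < K" for k
    using carriers(9)[of i i k] by (intro carrier_vecI) (auto simp: h_def hamiltonian_grad_def)
  then have hd: "h \<in> dirs" by (simp add: dirs_def)
  \<comment> \<open>The two expressions for the slope in direction h differ by this sum of
    squares.\<close>
  have "(\<Sum>k<K. h k \<bullet> h k) = 0"
    using slope_\<mu>[OF hd] slope_costate[OF hd refl \<mu>c lam] by (simp add: h_def)
  moreover have "0 \<le> h k \<bullet> h k" for k by (auto simp: scalar_prod_def intro!: sum_nonneg)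
  ultimately have "\<forall>k\<in>{..<K}. h k \<bullet> h k = 0" by (subst (asm) sum_nonneg_eq_0_iff) auto
  then have "\<forall>k<K. h k = 0\<^sub>v (nu G i)" using scalar_prod_self_eq_0 h by blast
  then have "stationary G x0 u i \<mu>" using lam by (auto simp: stationary_def h_def)
  then show ?thesis using \<mu>c \<mu>0 compl by (auto simp: kkt_def)
qed

end

section \<open>One stage of the coupled system\<close>

lemma vsum_mat_add:
  assumes "\<And>t. t \<in> S \<Longrightarrow> X t \<in> carrier_mat r c" "\<And>t. t \<in> S \<Longrightarrow> Y t \<in> carrier_mat r c"
    "\<And>t. t \<in> S \<Longrightarrow> v t \<in> carrier_vec c"
  shows "vsum r (\<lambda>t. (X t + Y t) *\<^sub>v v t) S = vsum r (\<lambda>t. X t *\<^sub>v v t) S + vsum r (\<lambda>t. Y t *\<^sub>v v t) S"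
proof -
  have "((X t + Y t) *\<^sub>v v t) $ a = (X t *\<^sub>v v t) $ a + (Y t *\<^sub>v v t) $ a" if "t \<in> S" "a < r" for t a
  proof -
    have "(X t + Y t) *\<^sub>v v t = X t *\<^sub>v v t + Y t *\<^sub>v v t"
      by (rule add_mult_distrib_mat_vec[OF assms(1-3)[OF that(1)]])
    then show ?thesis using assms(2)[OF that(1)] that(2) by (simp del: index_mult_mat_vec)
  qed
  then show ?thesis by (intro eq_vecI) (simp_all add: sum.distrib del: index_mult_mat_vec)
qed

lemma vsum_mat_mult:
  assumes "A \<in> carrier_mat r r'" "\<And>t. t \<in> S \<Longrightarrow> X t \<in> carrier_mat r' c" "\<And>t. t \<in> S \<Longrightarrow> v t \<in> carrier_vec c"
  shows "vsum r (\<lambda>t. (A * X t) *\<^sub>v v t) S = A *\<^sub>v vsum r' (\<lambda>t. X t *\<^sub>v v t) S"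
proof -
  have "X t *\<^sub>v v t \<in> carrier_vec r'" if "t \<in> S" for t using assms(2,3)[OF that] by auto
  then have "A *\<^sub>v vsum r' (\<lambda>t. X t *\<^sub>v v t) S = vsum r (\<lambda>t. A *\<^sub>v (X t *\<^sub>v v t)) S"
    by (intro mult_mat_vsum[OF assms(1)])
  also have "\<dots> = vsum r (\<lambda>t. (A * X t) *\<^sub>v v t) S"
    using assms by (intro vsum_cong refl) (metis assoc_mult_mat_vec)
  finally show ?thesis by simp
qed

lemma vsum_mat_lin:
  assumes "A \<in> carrier_mat r r1" "B \<in> carrier_mat r r2" "\<And>t. t \<in> S \<Longrightarrow> X t \<in> carrier_mat r1 c"
    "\<And>t. t \<in> S \<Longrightarrow> Y t \<in> carrier_mat r2 c" "\<And>t. t \<in> S \<Longrightarrow> v t \<in> carrier_vec c"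
  shows "vsum r (\<lambda>t. (A * X t + B * Y t) *\<^sub>v v t) S = A *\<^sub>v vsum r1 (\<lambda>t. X t *\<^sub>v v t) S + B *\<^sub>v vsum r2 (\<lambda>t. Y t *\<^sub>v v t) S"
  using vsum_mat_add[of S "\<lambda>t. A * X t" r c "\<lambda>t. B * Y t" v] vsum_mat_mult[of A r r1 S X c v]
    vsum_mat_mult[of B r r2 S Y c v] assms by simp

text \<open>The conditional matrix encodes a source term in a single block column, as produced by
  the recursions of the solution operators.\<close>

lemma vsum_mat_delta:
  fixes K :: nat
  assumes "j < K" "C \<in> carrier_mat r c" "\<And>t. t < K \<Longrightarrow> v t \<in> carrier_vec c"
  shows "vsum r (\<lambda>t. (if t = j then C else 0\<^sub>m r c) *\<^sub>v v t) {..<K} = C *\<^sub>v v j"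
proof (rule eq_vecI)
  fix a assume "a < dim_vec (C *\<^sub>v v j)"
  then have a: "a < r" using assms by simp
  have "((if t = j then C else 0\<^sub>m r c) *\<^sub>v v t) $ a = (if t = j then (C *\<^sub>v v j) $ a else 0)" if "t < K" for t
    using a assms(3)[OF that] by auto
  then have "(\<Sum>t<K. ((if t = j then C else 0\<^sub>m r c) *\<^sub>v v t) $ a) = (\<Sum>t<K. if t = j then (C *\<^sub>v v j) $ a else 0)"
    by (intro sum.cong refl) auto
  then show "vsum r (\<lambda>t. (if t = j then C else 0\<^sub>m r c) *\<^sub>v v t) {..<K} $ a = (C *\<^sub>v v j) $ a"
    using a assms(1) by (simp del: index_mult_mat_vec)
qed (use assms in auto)

text \<open>\<open>sol_F\<close> with \<open>sol_P\<close>, and \<open>lcp_M\<close> with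
  \<open>lcp_q\<close> up to \<open>rK\<close>, share this shape. The regrouping exposes the state
  trajectory and the costate offsets as inner brackets.\<close>

lemma affine_assembly:
  fixes F :: "real mat"
  assumes c: "F \<in> carrier_mat a b" "Fb \<in> carrier_mat a c" "Ft \<in> carrier_mat a d"
    "F0 \<in> carrier_mat b n" "F1 \<in> carrier_mat b e" "F2 \<in> carrier_mat b d"
    "S1 \<in> carrier_mat c e" "S2 \<in> carrier_mat c d"
    and v: "x \<in> carrier_vec n" "p \<in> carrier_vec e" "m \<in> carrier_vec d"
  shows "(F * F2 + Fb * S2 + Ft) *\<^sub>v m + (F * F0 *\<^sub>v x + (F * F1 + Fb * S1) *\<^sub>v p)
    = F *\<^sub>v (F0 *\<^sub>v x + F1 *\<^sub>v p + F2 *\<^sub>v m) + Fb *\<^sub>v (S1 *\<^sub>v p + S2 *\<^sub>v m) + Ft *\<^sub>v m"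
proof -
  have "(F * F2 + Fb * S2 + Ft) *\<^sub>v m = F *\<^sub>v (F2 *\<^sub>v m) + Fb *\<^sub>v (S2 *\<^sub>v m) + Ft *\<^sub>v m"
    using c v by (simp add: add_mult_distrib_mat_vec[of _ a d])
  moreover have "(F * F1 + Fb * S1) *\<^sub>v p = F *\<^sub>v (F1 *\<^sub>v p) + Fb *\<^sub>v (S1 *\<^sub>v p)"
    using c v by (simp add: add_mult_distrib_mat_vec[of _ a e])
  moreover have "F * F0 *\<^sub>v x = F *\<^sub>v (F0 *\<^sub>v x)" using c v by simp
  moreover have "F *\<^sub>v (F0 *\<^sub>v x + F1 *\<^sub>v p + F2 *\<^sub>v m) = F *\<^sub>v (F0 *\<^sub>v x) + F *\<^sub>v (F1 *\<^sub>v p) + F *\<^sub>v (F2 *\<^sub>v m)"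
    using c v by (simp add: mult_add_distrib_mat_vec[of _ a b])
  moreover have "Fb *\<^sub>v (S1 *\<^sub>v p + S2 *\<^sub>v m) = Fb *\<^sub>v (S1 *\<^sub>v p) + Fb *\<^sub>v (S2 *\<^sub>v m)"
    using c v by (simp add: mult_add_distrib_mat_vec[of _ a c])
  ultimately show ?thesis
    by (intro eq_vecI) (use c in \<open>auto simp: algebra_simps simp del: index_mult_mat_vec\<close>)
qed

lemma vec_stack_minus:
  assumes "\<And>i. i < N \<Longrightarrow> v i \<in> carrier_vec (d i)" "\<And>i. i < N \<Longrightarrow> w i \<in> carrier_vec (d i)"
  shows "stack N v - stack N w = stack N (\<lambda>i. v i - w i)"
proof -
  have c: "stack N v \<in> carrier_vec (\<Sum>i<N. d i)" "stack N w \<in> carrier_vec (\<Sum>i<N. d i)"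
    "stack N (\<lambda>i. v i - w i) \<in> carrier_vec (\<Sum>i<N. d i)"
    using assms by (auto intro!: vec_stack_carrier)
  have vw: "v i - w i \<in> carrier_vec (d i)" if "i < N" for i using assms that by auto
  have "stack N (\<lambda>i. v i - w i) + stack N w = stack N (\<lambda>i. v i - w i + w i)"
    using vw assms(2) by (rule vec_stack_add)
  also have "map (\<lambda>i. v i - w i + w i) [0..<N] = map v [0..<N]"
  proof (rule map_cong[OF refl])
    fix i assume "i \<in> set [0..<N]"
    then show "v i - w i + w i = v i" using assms[of i] by (intro eq_vecI) auto
  qed
  finally have "stack N (\<lambda>i. v i - w i) + stack N w = stack N v" .
  then have "stack N v - stack N w =
    stack N (\<lambda>i. v i - w i) + stack N w - stack N w" by simp
  also have "\<dots> = stack N (\<lambda>i. v i - w i)" using c by (intro eq_vecI) auto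
  finally show ?thesis .
qed

text \<open>No inverse is computed: the kernel is trivial because it is so in each block, and the
  claimed image is then verified by multiplying back.\<close>

lemma minv_diag_block_mult_vec_stack:
  assumes "\<And>i. i < N \<Longrightarrow> B i \<in> carrier_mat (d i) (d i)" "\<And>i. i < N \<Longrightarrow> invertible_mat (B i)"
    "\<And>i. i < N \<Longrightarrow> v i \<in> carrier_vec (d i)"
  shows "invertible_mat (diag_block_mat (map B [0..<N]))"
    "minv (diag_block_mat (map B [0..<N])) *\<^sub>v stack N v = stack N (\<lambda>i. minv (B i) *\<^sub>v v i)"
proof -
  let ?D = "diag_block_mat (map B [0..<N])" and ?n = "\<Sum>i<N. d i"
  have D: "?D \<in> carrier_mat ?n ?n" using assms by (intro diag_block_mat_carrier) auto
  have Bi: "minv (B i) \<in> carrier_mat (d i) (d i)" if "i < N" for i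
    using minv_props(1) assms(1,2)[OF that] by blast
  show inv: "invertible_mat ?D"
  proof (rule invertible_mat_if_inj[OF D])
    fix x assume "x \<in> carrier_vec ?n" and z: "?D *\<^sub>v x = 0\<^sub>v ?n"
    then obtain w where w: "\<And>i. i < N \<Longrightarrow> w i \<in> carrier_vec (d i)" "x = stack N w"
      using vec_stack_surj[of x d N] by blast
    \<comment> \<open>Zero is written as w - w to present it as a stack, which makes it comparable
      block by block.\<close>
    have zero: "0\<^sub>v ?n = stack N (\<lambda>i. 0\<^sub>v (d i))"
    proof -
      have "stack N w \<in> carrier_vec ?n" using w(1) by (rule vec_stack_carrier)
      then have "0\<^sub>v ?n = stack N w - stack N w" by simp
      also have "\<dots> = stack N (\<lambda>i. w i - w i)" using w(1) w(1) by (rule vec_stack_minus)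
      also have "map (\<lambda>i. w i - w i) [0..<N] = map (\<lambda>i. 0\<^sub>v (d i)) [0..<N]"
      proof (rule map_cong[OF refl])
        fix i assume "i \<in> set [0..<N]"
        then have "w i \<in> carrier_vec (d i)" using w(1) by simp
        then show "w i - w i = 0\<^sub>v (d i)" by simp
      qed
      finally show ?thesis .
    qed
    have "stack N (\<lambda>i. B i *\<^sub>v w i) = stack N (\<lambda>i. 0\<^sub>v (d i))"
      using z diag_block_mat_mult_vec_stack[of N B d d w] assms(1) w zero by simp
    then have "B i *\<^sub>v w i = 0\<^sub>v (d i)" if "i < N" for i
      using that assms(1) w by (subst (asm) vec_stack_eq_iff[where d = d]) (auto intro!: mult_mat_vec_carrier)
    then have "w i = 0\<^sub>v (d i)" if "i < N" for i
      using that minv_mult_eq_iff[OF assms(1,2)[OF that] w(1)[OF that], of "0\<^sub>v (d i)"] Bi[OF that] by auto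
    then have "map w [0..<N] = map (\<lambda>i. 0\<^sub>v (d i)) [0..<N]" by auto
    then show "x = 0\<^sub>v ?n" unfolding w(2) zero by (rule arg_cong)
  qed
  have c: "stack N (\<lambda>i. minv (B i) *\<^sub>v v i) \<in> carrier_vec ?n" "stack N v \<in> carrier_vec ?n"
    using assms(3) mult_mat_vec_carrier[OF Bi assms(3)] by (auto intro!: vec_stack_carrier)
  have "?D *\<^sub>v stack N (\<lambda>i. minv (B i) *\<^sub>v v i) = stack N (\<lambda>i. B i *\<^sub>v (minv (B i) *\<^sub>v v i))"
    using assms(1) mult_mat_vec_carrier[OF Bi assms(3)] by (rule diag_block_mat_mult_vec_stack)
  also have "map (\<lambda>i. B i *\<^sub>v (minv (B i) *\<^sub>v v i)) [0..<N] = map v [0..<N]"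
  proof (rule map_cong[OF refl])
    fix i assume "i \<in> set [0..<N]"
    then have i: "i < N" by simp
    then show "B i *\<^sub>v (minv (B i) *\<^sub>v v i) = v i"
      using minv_mult_eq_iff[OF assms(1,2)[OF i] _ assms(3)[OF i], of "minv (B i) *\<^sub>v v i"] Bi[OF i] assms(3)[OF i] by auto
  qed
  finally show "minv ?D *\<^sub>v stack N v = stack N (\<lambda>i. minv (B i) *\<^sub>v v i)"
    using minv_mult_eq_iff[OF D inv c] by simp
qed

lemma mult_mat_vec_add3:
  fixes A :: "real mat"
  assumes "A \<in> carrier_mat r c" "u \<in> carrier_vec c" "v \<in> carrier_vec c" "w \<in> carrier_vec c"
  shows "A *\<^sub>v (u + v + w) = A *\<^sub>v u + A *\<^sub>v v + A *\<^sub>v w"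
  using mult_add_distrib_mat_vec[OF assms(1) add_carrier_vec[OF assms(2,3)] assms(4)]
    mult_add_distrib_mat_vec[OF assms(1-3)] by (simp only:)

lemma vec_eq_minus_iff:
  fixes z :: "real vec"
  assumes "z \<in> carrier_vec n" "v \<in> carrier_vec n" "r \<in> carrier_vec n"
  shows "z = r - v \<longleftrightarrow> z + v = r"
proof
  show "z = r - v \<Longrightarrow> z + v = r" using assms by (intro eq_vecI) auto
  show "z + v = r \<Longrightarrow> z = r - v" using assms by (intro eq_vecI) auto
qed

section \<open>Stage matrices of the coupled game\<close>

locale game_nash = game +
  fixes P :: "nat \<Rightarrow> nat \<Rightarrow> real mat"
  assumes R_pos: "\<And>i k. i < N \<Longrightarrow> k < K \<Longrightarrow> pos_def (Rm G i i k)"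
    and P_ric: "riccati_nash G P"
begin

abbreviation "Nn \<equiv> N * n"

lemma P_carrier: "i < N \<Longrightarrow> k \<le> K \<Longrightarrow> P i k \<in> carrier_mat n n"
  using P_ric by (auto simp: riccati_nash_def)

lemma R_inv: "i < N \<Longrightarrow> k < K \<Longrightarrow> invertible_mat (Rm G i i k)"
  using pos_def_invertible R_pos carriers(6) by blast

lemma Ri_carrier: "i < N \<Longrightarrow> k < K \<Longrightarrow> minv (Rm G i i k) \<in> carrier_mat (nu G i) (nu G i)"
  using minv_props(1) R_inv carriers(6) by blast

lemma Lam_carrier: "Lam G P k \<in> carrier_mat n n"
  by (simp add: Lam_def)

lemma Lam_inv: "k < K \<Longrightarrow> invertible_mat (Lam G P k)"
  using P_ric by (auto simp: riccati_nash_def)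

lemma Li_carrier: "k < K \<Longrightarrow> minv (Lam G P k) \<in> carrier_mat n n"
  using minv_props(1) Lam_carrier Lam_inv by blast

lemma stage_carriers:
  assumes k: "k < K"
  shows "Gm G P k \<in> carrier_mat n n" "Gbar G P (Suc k) \<in> carrier_mat n Nn" "Gtil G P k \<in> carrier_mat n (nc_tot G)"
    "bR G k \<in> carrier_mat (nu_tot G) (nu_tot G)" "bB G k \<in> carrier_mat Nn (nu_tot G)"
    "bN G k \<in> carrier_mat (nc_tot G) (nu_tot G)" "bM G k \<in> carrier_mat (nc_tot G) Nn"
    "Mbar G k \<in> carrier_mat (nc_tot G) n" "Nbar G k \<in> carrier_mat (nc_tot G) (nu_tot G)"
    "Pcol G P (Suc k) \<in> carrier_mat Nn n" "minv (bR G k) \<in> carrier_mat (nu_tot G) (nu_tot G)"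
    "kron (1\<^sub>m N) ((Am G k)\<^sup>T) \<in> carrier_mat Nn Nn"
proof -
  show "Gm G P k \<in> carrier_mat n n" using carriers(1)[OF k] Li_carrier[OF k] by (simp add: Gm_def)
  have "- (minv (Lam G P k) * Bm G i k * minv (Rm G i i k) * (Bm G i k)\<^sup>T) \<in> carrier_mat n n"
    "minv (Lam G P k) * Bm G i k * minv (Rm G i i k) * (Nblk G i i k)\<^sup>T \<in> carrier_mat n (nc G i)" if "i < N" for i
    using carriers(2)[OF that k] carriers(9)[of i i k] Li_carrier[OF k] Ri_carrier[OF that k] by auto
  then show "Gbar G P (Suc k) \<in> carrier_mat n Nn" "Gtil G P k \<in> carrier_mat n (nc_tot G)"
    using hstack_carrier[of N _ n "\<lambda>_. n"] hstack_carrier[of N _ n "nc G"] by (simp_all add: Gbar_def Gtil_def nc_tot_def)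
  show bR: "bR G k \<in> carrier_mat (nu_tot G) (nu_tot G)"
    unfolding bR_def nu_tot_def using carriers(6) k by (intro diag_block_mat_carrier) auto
  show "bB G k \<in> carrier_mat Nn (nu_tot G)"
    unfolding bB_def nu_tot_def using carriers(2) k diag_block_mat_carrier[of N "\<lambda>i. Bm G i k" "\<lambda>_. n" "nu G"] by simp
  show "bN G k \<in> carrier_mat (nc_tot G) (nu_tot G)"
    unfolding bN_def nu_tot_def nc_tot_def using carriers(9) by (intro diag_block_mat_carrier) auto
  show "bM G k \<in> carrier_mat (nc_tot G) Nn"
    unfolding bM_def nc_tot_def using carriers(3) k diag_block_mat_carrier[of N "\<lambda>i. Mm G i k" "nc G" "\<lambda>_. n"] by simp
  show "Mbar G k \<in> carrier_mat (nc_tot G) n" "Nbar G k \<in> carrier_mat (nc_tot G) (nu_tot G)"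
    unfolding Mbar_def Nbar_def nc_tot_def using carriers(3,4) k by (auto intro!: vstack_carrier)
  show "Pcol G P (Suc k) \<in> carrier_mat Nn n"
    unfolding Pcol_def using vstack_carrier[of N "\<lambda>i. P i (Suc k)" "\<lambda>_. n" n] P_carrier k by simp
  have "invertible_mat (bR G k)" unfolding bR_def
    using R_inv carriers(6) k by (intro minv_diag_block_mult_vec_stack(1)[where d = "nu G" and v = "\<lambda>i. 0\<^sub>v (nu G i)"]) auto
  then show "minv (bR G k) \<in> carrier_mat (nu_tot G) (nu_tot G)" using minv_props(1) bR by blast
  show "kron (1\<^sub>m N) ((Am G k)\<^sup>T) \<in> carrier_mat Nn Nn"
    using carriers(1)[OF k] by (auto simp: kron_def)
qed

lemma stage_carriers2:
  assumes k: "k < K"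
  shows "Fm G P k \<in> carrier_mat (nu_tot G) n" "Fbar G P (Suc k) \<in> carrier_mat (nu_tot G) Nn"
    "Ftil G P k \<in> carrier_mat (nu_tot G) (nc_tot G)"
    "Hm G P (Suc k) \<in> carrier_mat Nn Nn" "Hbar G P k \<in> carrier_mat Nn (nc_tot G)"
  using stage_carriers[OF k] by (auto simp: Fm_def Fbar_def Ftil_def Hm_def Hbar_def Let_def)

text \<open>Solution of the stationarity condition for the input of player i, when the next costate
  is \<open>P i (Suc k)\<close> applied to z plus \<open>b i\<close>. Here z is the next state, so
  the input depends implicitly on the state it produces.\<close>

definition feedback :: "nat \<Rightarrow> real vec \<Rightarrow> (nat \<Rightarrow> real vec) \<Rightarrow> (nat \<Rightarrow> real vec) \<Rightarrow> nat \<Rightarrow> real vec" where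
  "feedback k z b m i = minv (Rm G i i k) *\<^sub>v ((Nblk G i i k)\<^sup>T *\<^sub>v m i - (Bm G i k)\<^sup>T *\<^sub>v (P i (Suc k) *\<^sub>v z + b i))"

definition next_state :: "nat \<Rightarrow> real vec \<Rightarrow> real vec \<Rightarrow> real vec \<Rightarrow> real vec" where
  "next_state k x b m = Gm G P k *\<^sub>v x + Gbar G P (Suc k) *\<^sub>v b + Gtil G P k *\<^sub>v m"

context
  fixes k :: nat and x :: "real vec" and b m :: "nat \<Rightarrow> real vec"
  assumes k: "k < K" and x: "x \<in> carrier_vec n"
    and b: "\<And>i. i < N \<Longrightarrow> b i \<in> carrier_vec n" and m: "\<And>i. i < N \<Longrightarrow> m i \<in> carrier_vec (nc G i)"
begin

abbreviation "bs \<equiv> stack N b"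
abbreviation "ms \<equiv> stack N m"

lemma bs: "bs \<in> carrier_vec Nn"
  using vec_stack_carrier[of N b "\<lambda>_. n"] b by simp

lemma ms: "ms \<in> carrier_vec (nc_tot G)"
  using vec_stack_carrier[of N m "nc G"] m by (simp add: nc_tot_def)

lemma next_state_carrier: "next_state k x bs ms \<in> carrier_vec n"
  using stage_carriers[OF k] by (intro carrier_vecI) (auto simp: next_state_def)

text \<open>Collecting the terms with z gives a linear system with matrix \<open>Lam\<close>, whose
  invertibility makes the next state explicit and unique. Both directions are used: one to verify
  the explicit trajectory, the other to recognise the state of a stationary profile.\<close>

lemma fixpoint_iff:
  assumes z: "z \<in> carrier_vec n"
  shows "z = Am G k *\<^sub>v x + vsum n (\<lambda>i. Bm G i k *\<^sub>v feedback k z b m i) {..<N} \<longleftrightarrow> z = next_state k x bs ms"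
proof -
  let ?Li = "minv (Lam G P k)" and ?Ri = "\<lambda>i. minv (Rm G i i k)"
  let ?vm = "\<lambda>i. (Nblk G i i k)\<^sup>T *\<^sub>v m i" and ?vb = "\<lambda>i. (Bm G i k)\<^sup>T *\<^sub>v b i" and ?vz = "\<lambda>i. (Bm G i k)\<^sup>T *\<^sub>v (P i (Suc k) *\<^sub>v z)"
  let ?tm = "\<lambda>i. Bm G i k *\<^sub>v (?Ri i *\<^sub>v ?vm i)"
  let ?tb = "\<lambda>i. Bm G i k *\<^sub>v (?Ri i *\<^sub>v ?vb i)"
  let ?tz = "\<lambda>i. Bm G i k *\<^sub>v (?Ri i *\<^sub>v ?vz i)"
  \<comment> \<open>Everything on the right side that does not involve z.\<close>
  define r where "r = Am G k *\<^sub>v x + vsum n ?tm {..<N} - vsum n ?tb {..<N}"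
  have B: "Bm G i k \<in> carrier_mat n (nu G i)" if "i < N" for i using carriers(2)[OF that k] .
  have Ri: "?Ri i \<in> carrier_mat (nu G i) (nu G i)" if "i < N" for i using Ri_carrier[OF that k] .
  have P: "P i (Suc k) \<in> carrier_mat n n" if "i < N" for i using P_carrier[OF that] k by simp
  have Nb: "Nblk G i i k \<in> carrier_mat (nc G i) (nu G i)" for i by (rule carriers(9))
  note A = carriers(1)[OF k] and Li = Li_carrier[OF k]
  have t: "?tm i \<in> carrier_vec n" "?tb i \<in> carrier_vec n" "?tz i \<in> carrier_vec n" if "i < N" for i
    using B[OF that] by (auto intro!: carrier_vecI)
  have r: "r \<in> carrier_vec n" by (intro carrier_vecI) (simp add: r_def)
  \<comment> \<open>\<open>Gm\<close>, \<open>Gtil\<close> and \<open>Gbar\<close> apply the inverse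
    of \<open>Lam\<close> to the three parts of r.\<close>
  have next_state_eq: "next_state k x bs ms = ?Li *\<^sub>v r"
  proof -
    have 1: "Gm G P k *\<^sub>v x = ?Li *\<^sub>v (Am G k *\<^sub>v x)" unfolding Gm_def using A Li x by simp
    have 2: "Gtil G P k *\<^sub>v ms = ?Li *\<^sub>v vsum n ?tm {..<N}"
    proof -
      have "Gtil G P k *\<^sub>v ms = vsum n (\<lambda>i. (?Li * Bm G i k * ?Ri i * (Nblk G i i k)\<^sup>T) *\<^sub>v m i) {..<N}"
        unfolding Gtil_def using B Ri Nb Li m by (intro hstack_mult_vec_stack) (auto intro!: mult_carrier_mat)
      also have "\<dots> = vsum n (\<lambda>i. ?Li *\<^sub>v ?tm i) {..<N}"
      proof (intro vsum_cong refl)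
        fix i assume "i \<in> {..<N}"
        then have i: "i < N" by simp
        have "(Nblk G i i k)\<^sup>T \<in> carrier_mat (nu G i) (nc G i)" using Nb[of i] by simp
        then show "(?Li * Bm G i k * ?Ri i * (Nblk G i i k)\<^sup>T) *\<^sub>v m i = ?Li *\<^sub>v ?tm i"
          by (rule mult4_mat_vec[OF Li B[OF i] Ri[OF i] _ m[OF i]])
      qed
      finally show ?thesis using mult_mat_vsum[OF Li, of "{..<N}" ?tm] t by simp
    qed
    have 3: "Gbar G P (Suc k) *\<^sub>v bs = - (?Li *\<^sub>v vsum n ?tb {..<N})"
    proof -
      have "Gbar G P (Suc k) *\<^sub>v bs = vsum n (\<lambda>i. (- (?Li * Bm G i k * ?Ri i * (Bm G i k)\<^sup>T)) *\<^sub>v b i) {..<N}"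
        unfolding Gbar_def Let_def diff_Suc_1 using B Ri Li b
        by (intro hstack_mult_vec_stack[where d = "\<lambda>_. n"]) (auto intro!: mult_carrier_mat)
      also have "\<dots> = vsum n (\<lambda>i. - (?Li *\<^sub>v ?tb i)) {..<N}"
      proof (intro vsum_cong refl)
        fix i assume "i \<in> {..<N}"
        then have i: "i < N" by simp
        have "(Bm G i k)\<^sup>T \<in> carrier_mat (nu G i) n" using B[OF i] by simp
        then have e: "(?Li * Bm G i k * ?Ri i * (Bm G i k)\<^sup>T) *\<^sub>v b i = ?Li *\<^sub>v ?tb i"
          by (rule mult4_mat_vec[OF Li B[OF i] Ri[OF i] _ b[OF i]])
        have "(- (?Li * Bm G i k * ?Ri i * (Bm G i k)\<^sup>T)) *\<^sub>v b i = - ((?Li * Bm G i k * ?Ri i * (Bm G i k)\<^sup>T) *\<^sub>v b i)"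
          using B[OF i] b[OF i] by (intro uminus_mult_mat_vec) auto
        then show "(- (?Li * Bm G i k * ?Ri i * (Bm G i k)\<^sup>T)) *\<^sub>v b i = - (?Li *\<^sub>v ?tb i)" unfolding e .
      qed
      also have "\<dots> = - vsum n (\<lambda>i. ?Li *\<^sub>v ?tb i) {..<N}"
        by (intro eq_vecI) (use Li in \<open>auto simp: sum_negf simp del: index_mult_mat_vec\<close>)
      finally show ?thesis using mult_mat_vsum[OF Li, of "{..<N}" ?tb] t by simp
    qed
    have "?Li *\<^sub>v r = ?Li *\<^sub>v (Am G k *\<^sub>v x + vsum n ?tm {..<N}) - ?Li *\<^sub>v vsum n ?tb {..<N}"
      unfolding r_def using A x Li by (intro mult_minus_distrib_mat_vec) auto
    also have "?Li *\<^sub>v (Am G k *\<^sub>v x + vsum n ?tm {..<N}) = ?Li *\<^sub>v (Am G k *\<^sub>v x) + ?Li *\<^sub>v vsum n ?tm {..<N}"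
      using A x Li by (intro mult_add_distrib_mat_vec) auto
    finally show ?thesis unfolding next_state_def 1 2 3
      by (intro eq_vecI) (use Li in \<open>auto simp del: index_mult_mat_vec\<close>)
  qed
  have Lz: "Lam G P k *\<^sub>v z = z + vsum n ?tz {..<N}"
  proof -
    have "Lam G P k *\<^sub>v z = z + mat_sum n n (\<lambda>j. Bm G j k * ?Ri j * (Bm G j k)\<^sup>T * P j (Suc k)) {..<N} *\<^sub>v z"
      unfolding Lam_def using z by (subst add_mult_distrib_mat_vec[of _ n n]) auto
    also have "mat_sum n n (\<lambda>j. Bm G j k * ?Ri j * (Bm G j k)\<^sup>T * P j (Suc k)) {..<N} *\<^sub>v z
      = vsum n (\<lambda>j. (Bm G j k * ?Ri j * (Bm G j k)\<^sup>T * P j (Suc k)) *\<^sub>v z) {..<N}"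
      using z B Ri P by (intro mat_sum_mult_vec) (auto intro!: mult_carrier_mat)
    also have "\<dots> = vsum n ?tz {..<N}"
    proof (intro vsum_cong refl)
      fix i assume "i \<in> {..<N}"
      then have i: "i < N" by simp
      have "(Bm G i k)\<^sup>T \<in> carrier_mat (nu G i) n" using B[OF i] by simp
      then show "(Bm G i k * ?Ri i * (Bm G i k)\<^sup>T * P i (Suc k)) *\<^sub>v z = ?tz i"
        by (rule mult4_mat_vec[OF B[OF i] Ri[OF i] _ P[OF i] z])
    qed
    finally show ?thesis .
  qed
  have "vsum n (\<lambda>i. Bm G i k *\<^sub>v feedback k z b m i) {..<N} = vsum n ?tm {..<N} - vsum n ?tz {..<N} - vsum n ?tb {..<N}"
  proof -
    have e: "Bm G i k *\<^sub>v feedback k z b m i = ?tm i - ?tz i - ?tb i" if i: "i < N" for i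
    proof -
      have v: "?vm i \<in> carrier_vec (nu G i)" "P i (Suc k) *\<^sub>v z \<in> carrier_vec n" "b i \<in> carrier_vec n"
        "?vz i \<in> carrier_vec (nu G i)" "?vb i \<in> carrier_vec (nu G i)"
        using B[OF i] P[OF i] Nb[of i] z m[OF i] b[OF i] by (auto intro!: mult_mat_vec_carrier)
      have B': "(Bm G i k)\<^sup>T \<in> carrier_mat (nu G i) n" using B[OF i] by simp
      have "?vm i - (Bm G i k)\<^sup>T *\<^sub>v (P i (Suc k) *\<^sub>v z + b i)
        = ?vm i - ?vz i - ?vb i"
        unfolding mult_add_distrib_mat_vec[OF B' v(2,3)]
        by (intro eq_vecI) (use B' in \<open>auto simp del: index_mult_mat_vec\<close>)
      moreover have "?Ri i *\<^sub>v (?vm i - ?vz i - ?vb i)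
        = ?Ri i *\<^sub>v ?vm i - ?Ri i *\<^sub>v ?vz i - ?Ri i *\<^sub>v ?vb i"
        using v Ri[OF i] by (subst mult_minus_distrib_mat_vec[of _ "nu G i" "nu G i"], simp, simp, simp,
            subst mult_minus_distrib_mat_vec[of _ "nu G i" "nu G i"], simp_all)
      moreover have c: "?Ri i *\<^sub>v ?vm i \<in> carrier_vec (nu G i)"
         "?Ri i *\<^sub>v ?vz i \<in> carrier_vec (nu G i)"
         "?Ri i *\<^sub>v ?vb i \<in> carrier_vec (nu G i)" using Ri[OF i] v by auto
      moreover have "Bm G i k *\<^sub>v (?Ri i *\<^sub>v ?vm i - ?Ri i *\<^sub>v ?vz i - ?Ri i *\<^sub>v ?vb i)
        = ?tm i - ?tz i - ?tb i"
        using c B[OF i] by (subst mult_minus_distrib_mat_vec[of _ n "nu G i"], simp, simp, simp,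
            subst mult_minus_distrib_mat_vec[of _ n "nu G i"], simp_all)
      ultimately show ?thesis by (simp add: feedback_def)
    qed
    have "(Bm G i k *\<^sub>v feedback k z b m i) $ a = ?tm i $ a - ?tz i $ a - ?tb i $ a" if "i < N" "a < n" for i a
      unfolding e[OF that(1)] using t[OF that(1)] B[OF that(1)] that by (simp del: index_mult_mat_vec)
    then show ?thesis by (intro eq_vecI) (simp_all add: sum_subtractf del: index_mult_mat_vec)
  qed
  then have "Am G k *\<^sub>v x + vsum n (\<lambda>i. Bm G i k *\<^sub>v feedback k z b m i) {..<N} = r - vsum n ?tz {..<N}"
    unfolding r_def by (intro eq_vecI) (use A in \<open>auto simp del: index_mult_mat_vec\<close>)
  then have "z = Am G k *\<^sub>v x + vsum n (\<lambda>i. Bm G i k *\<^sub>v feedback k z b m i) {..<N} \<longleftrightarrow> z = r - vsum n ?tz {..<N}"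
    by simp
  also have "\<dots> \<longleftrightarrow> z + vsum n ?tz {..<N} = r"
    using z vsum_carrier r by (rule vec_eq_minus_iff)
  also have "\<dots> \<longleftrightarrow> z = next_state k x bs ms"
    unfolding next_state_eq minv_mult_eq_iff[OF Lam_carrier Lam_inv[OF k] z r] Lz ..
  finally show ?thesis .
qed


text \<open>The gains arise by inserting the explicit next state into the feedback law. In
  \<open>Fbar\<close> the identity stems from b itself, the product of \<open>Pcol\<close> and
  \<open>Gbar\<close> from the dependence of the next state on b.\<close>

lemma feedback_stack_eq:
  "Fm G P k *\<^sub>v x + Fbar G P (Suc k) *\<^sub>v bs + Ftil G P k *\<^sub>v ms
    = stack N (feedback k (next_state k x bs ms) b m)"
proof -
  let ?y = "next_state k x bs ms" and ?R = "minv (bR G k)" and ?B = "(bB G k)\<^sup>T" and ?Nb = "(bN G k)\<^sup>T" and ?P = "Pcol G P (Suc k)"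
  let ?Nm = "\<lambda>i. (Nblk G i i k)\<^sup>T *\<^sub>v m i" and ?Bb = "\<lambda>i. (Bm G i k)\<^sup>T *\<^sub>v (P i (Suc k) *\<^sub>v ?y + b i)"
  let ?GB = "Gbar G P (Suc k)" and ?GT = "Gtil G P k"
  note c = stage_carriers[OF k]
  have B: "?B \<in> carrier_mat (nu_tot G) Nn" and Nb: "?Nb \<in> carrier_mat (nu_tot G) (nc_tot G)"
    using c by auto
  let ?p1 = "?P *\<^sub>v (Gm G P k *\<^sub>v x)" and ?p2 = "?P *\<^sub>v (?GB *\<^sub>v bs)" and ?p3 = "?P *\<^sub>v (?GT *\<^sub>v ms)"
  have g: "Gm G P k *\<^sub>v x \<in> carrier_vec n" "?GB *\<^sub>v bs \<in> carrier_vec n" "?GT *\<^sub>v ms \<in> carrier_vec n"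
    using c by (auto intro!: carrier_vecI)
  have p: "?p1 \<in> carrier_vec Nn" "?p2 \<in> carrier_vec Nn" "?p3 \<in> carrier_vec Nn"
    using c by (auto intro!: carrier_vecI)
  have Bp: "?B *\<^sub>v v \<in> carrier_vec (nu_tot G)" "?Nb *\<^sub>v v \<in> carrier_vec (nu_tot G)" "?R *\<^sub>v v \<in> carrier_vec (nu_tot G)" for v
    using B Nb c by (auto intro!: carrier_vecI)
  have 1: "Fm G P k *\<^sub>v x = - (?R *\<^sub>v (?B *\<^sub>v ?p1))"
  proof -
    have "?R * ?B * ?P * Gm G P k \<in> carrier_mat (nu_tot G) n" using B c by auto
    then have "Fm G P k *\<^sub>v x = - ((?R * ?B * ?P * Gm G P k) *\<^sub>v x)"
      unfolding Fm_def using x c by (intro uminus_mult_mat_vec) auto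
    also have "(?R * ?B * ?P * Gm G P k) *\<^sub>v x = ?R *\<^sub>v (?B *\<^sub>v ?p1)"
      by (rule mult4_mat_vec[OF c(11) B c(10) c(1) x])
    finally show ?thesis .
  qed
  have IP: "(1\<^sub>m Nn + ?P * ?GB) *\<^sub>v bs = bs + ?p2"
    using c bs by (subst add_mult_distrib_mat_vec[of _ Nn Nn]) auto
  have IPc: "1\<^sub>m Nn + ?P * ?GB \<in> carrier_mat Nn Nn" using c by auto
  have 2: "Fbar G P (Suc k) *\<^sub>v bs = - (?R *\<^sub>v (?B *\<^sub>v (bs + ?p2)))"
  proof -
    have "Fbar G P (Suc k) *\<^sub>v bs = - ((?R * ?B * (1\<^sub>m Nn + ?P * ?GB)) *\<^sub>v bs)"
      unfolding Fbar_def Let_def diff_Suc_1 using bs c by (intro uminus_mult_mat_vec) auto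
    also have "(?R * ?B * (1\<^sub>m Nn + ?P * ?GB)) *\<^sub>v bs = (?R * ?B) *\<^sub>v (bs + ?p2)"
      unfolding IP[symmetric] using B c bs IPc by (intro assoc_mult_mat_vec[of _ "nu_tot G" Nn _ Nn]) auto
    also have "\<dots> = ?R *\<^sub>v (?B *\<^sub>v (bs + ?p2))"
      using B c p bs by (intro assoc_mult_mat_vec[of _ "nu_tot G" "nu_tot G" _ Nn]) auto
    finally show ?thesis .
  qed
  have 3: "Ftil G P k *\<^sub>v ms = ?R *\<^sub>v (?Nb *\<^sub>v ms - ?B *\<^sub>v ?p3)"
  proof -
    have BPG: "?B * ?P * ?GT \<in> carrier_mat (nu_tot G) (nc_tot G)" using B c by auto
    have "(?B * ?P * ?GT) *\<^sub>v ms = (?B * ?P) *\<^sub>v (?GT *\<^sub>v ms)"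
      using B c ms by (intro assoc_mult_mat_vec[of _ "nu_tot G" n _ "nc_tot G"]) (auto intro!: mult_carrier_mat)
    also have "\<dots> = ?B *\<^sub>v ?p3"
      using B c g by (intro assoc_mult_mat_vec[of _ "nu_tot G" Nn _ n]) auto
    finally have "(?Nb - ?B * ?P * ?GT) *\<^sub>v ms = ?Nb *\<^sub>v ms - ?B *\<^sub>v ?p3"
      using minus_mult_distrib_mat_vec[OF Nb BPG ms] by simp
    moreover have "Ftil G P k *\<^sub>v ms = ?R *\<^sub>v ((?Nb - ?B * ?P * ?GT) *\<^sub>v ms)"
      unfolding Ftil_def using BPG c ms by (intro assoc_mult_mat_vec[of _ "nu_tot G" "nu_tot G" _ "nc_tot G"]) auto
    ultimately show ?thesis by simp
  qed
  have Py: "?P *\<^sub>v ?y = ?p1 + ?p2 + ?p3"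
    unfolding next_state_def by (rule mult_mat_vec_add3[OF c(10) g])
  have "?R *\<^sub>v (?Nb *\<^sub>v ms - ?B *\<^sub>v (?P *\<^sub>v ?y + bs)) = ?R *\<^sub>v (?Nb *\<^sub>v ms) - ?R *\<^sub>v (?B *\<^sub>v (?P *\<^sub>v ?y + bs))"
    using Bp c by (intro mult_minus_distrib_mat_vec) auto
  moreover have "?R *\<^sub>v (?B *\<^sub>v (?P *\<^sub>v ?y + bs)) = ?R *\<^sub>v (?B *\<^sub>v ?p1) + ?R *\<^sub>v (?B *\<^sub>v ?p2) + ?R *\<^sub>v (?B *\<^sub>v ?p3) + ?R *\<^sub>v (?B *\<^sub>v bs)"
    unfolding Py mult_add_distrib_mat_vec[OF B add_carrier_vec[OF add_carrier_vec[OF p(1,2)] p(3)] bs] mult_mat_vec_add3[OF B p]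
      mult_add_distrib_mat_vec[OF c(11) add_carrier_vec[OF add_carrier_vec[OF Bp(1) Bp(1)] Bp(1)] Bp(1)]
      mult_mat_vec_add3[OF c(11) Bp(1) Bp(1) Bp(1)] ..
  moreover have "?R *\<^sub>v (?B *\<^sub>v (bs + ?p2)) = ?R *\<^sub>v (?B *\<^sub>v bs) + ?R *\<^sub>v (?B *\<^sub>v ?p2)"
    using p bs B Bp c
    by (simp add: mult_add_distrib_mat_vec[of _ "nu_tot G" Nn] mult_add_distrib_mat_vec[of _ "nu_tot G" "nu_tot G"])
  moreover have "?R *\<^sub>v (?Nb *\<^sub>v ms - ?B *\<^sub>v ?p3) = ?R *\<^sub>v (?Nb *\<^sub>v ms) - ?R *\<^sub>v (?B *\<^sub>v ?p3)"
    using Bp c by (intro mult_minus_distrib_mat_vec) auto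
  ultimately have "Fm G P k *\<^sub>v x + Fbar G P (Suc k) *\<^sub>v bs + Ftil G P k *\<^sub>v ms = ?R *\<^sub>v (?Nb *\<^sub>v ms - ?B *\<^sub>v (?P *\<^sub>v ?y + bs))"
    unfolding 1 2 3 by (intro eq_vecI) (use c in \<open>auto simp: algebra_simps simp del: index_mult_mat_vec\<close>)
  also have "?P *\<^sub>v ?y + bs = stack N (\<lambda>i. P i (Suc k) *\<^sub>v ?y + b i)"
  proof -
    have Pc: "P i (Suc k) \<in> carrier_mat n n" if "i < N" for i using P_carrier that k by simp
    have "?P *\<^sub>v ?y = stack N (\<lambda>i. P i (Suc k) *\<^sub>v ?y)"
      unfolding Pcol_def using Pc next_state_carrier by (intro vstack_mult_vec) auto
    moreover have "P i (Suc k) *\<^sub>v ?y \<in> carrier_vec n" if "i < N" for i using Pc[OF that] by (intro carrier_vecI) auto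
    ultimately show ?thesis using vec_stack_add[of N "\<lambda>i. P i (Suc k) *\<^sub>v ?y" "\<lambda>_. n" b] b by simp
  qed
  also have "?B *\<^sub>v \<dots> = stack N (\<lambda>i. ?Bb i)"
    unfolding bB_def transpose_diag_block_mat map_map o_def
  proof (rule diag_block_mat_mult_vec_stack[where r = "nu G" and c = "\<lambda>_. n"])
    fix i assume i: "i < N"
    show "(Bm G i k)\<^sup>T \<in> carrier_mat (nu G i) n" using carriers(2)[OF i k] by simp
    show "P i (Suc k) *\<^sub>v ?y + b i \<in> carrier_vec n" using b[OF i] by (intro carrier_vecI) auto
  qed
  also have "?Nb *\<^sub>v ms = stack N (\<lambda>i. ?Nm i)"
    unfolding bN_def transpose_diag_block_mat map_map o_def
    using carriers(9) m by (intro diag_block_mat_mult_vec_stack[where r = "nu G" and c = "nc G"]) auto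
  also have "\<dots> - stack N (\<lambda>i. ?Bb i)
    = stack N (\<lambda>i. ?Nm i - ?Bb i)"
    using carrier_matD(2)[OF carriers(2)[OF _ k]] carrier_matD(2)[OF carriers(9)]
    by (intro vec_stack_minus[where d = "nu G"]) (auto intro!: carrier_vecI)
  also have "?R *\<^sub>v \<dots> = stack N (feedback k ?y b m)"
    unfolding bR_def feedback_def using carriers(6) R_inv k carrier_matD(2)[OF carriers(2)[OF _ k]]
    by (intro minv_diag_block_mult_vec_stack(2)[where d = "nu G"]) (auto intro!: carrier_vecI)
  finally show ?thesis .
qed

text \<open>Once \<open>P i k\<close> applied to x is subtracted, the adjoint step is free of x:
  only linear maps of b and m remain, and these are \<open>Hm\<close> and \<open>Hbar\<close>. The
  vectors \<open>pv\<close> are added separately in \<open>offset_step\<close>.\<close>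

lemma costate_eq:
  "Hm G P (Suc k) *\<^sub>v bs + Hbar G P k *\<^sub>v ms
    = stack N (\<lambda>i. (Am G k)\<^sup>T *\<^sub>v (P i (Suc k) *\<^sub>v next_state k x bs ms + b i) + Qm G i k *\<^sub>v x
        - (Mm G i k)\<^sup>T *\<^sub>v m i - P i k *\<^sub>v x)"
proof -
  let ?y = "next_state k x bs ms" and ?A = "(Am G k)\<^sup>T" and ?Kr = "kron (1\<^sub>m N) ((Am G k)\<^sup>T)" and ?M = "(bM G k)\<^sup>T" and ?P = "Pcol G P (Suc k)"
  let ?GB = "Gbar G P (Suc k)" and ?GT = "Gtil G P k" and ?Mm = "\<lambda>i. (Mm G i k)\<^sup>T *\<^sub>v m i" and ?Pw = "\<lambda>i v. P i (Suc k) *\<^sub>v v"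
  let ?gx = "Gm G P k *\<^sub>v x"
  \<comment> \<open>The part of the next state that does not come from x.\<close>
  define w where "w = ?GB *\<^sub>v bs + ?GT *\<^sub>v ms"
  note c = stage_carriers[OF k]
  have A: "?A \<in> carrier_mat n n" using carriers(1)[OF k] by simp
  have M: "?M \<in> carrier_mat Nn (nc_tot G)" using c by auto
  have Pc: "P i (Suc k) \<in> carrier_mat n n" if "i < N" for i using P_carrier that k by simp
  have g: "?GB *\<^sub>v bs \<in> carrier_vec n" "?GT *\<^sub>v ms \<in> carrier_vec n"
    using c by (auto intro!: carrier_vecI)
  have w: "w \<in> carrier_vec n" using g by (simp add: w_def)
  have gx: "?gx \<in> carrier_vec n" using c by (auto intro!: carrier_vecI)
  have Pw: "?Pw i w \<in> carrier_vec n" if "i < N" for i using Pc[OF that] by (intro carrier_vecI) auto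
  have Pg: "P i (Suc k) *\<^sub>v ?gx \<in> carrier_vec n" if "i < N" for i using Pc[OF that] by (intro carrier_vecI) auto
  have "?P *\<^sub>v (?GB *\<^sub>v bs) \<in> carrier_vec Nn" "?P *\<^sub>v (?GT *\<^sub>v ms) \<in> carrier_vec Nn"
    using c by (auto intro!: carrier_vecI)
  note p = this
  have 1: "Hm G P (Suc k) *\<^sub>v bs = ?Kr *\<^sub>v (bs + ?P *\<^sub>v (?GB *\<^sub>v bs))"
  proof -
    have IP: "(1\<^sub>m Nn + ?P * ?GB) *\<^sub>v bs = bs + ?P *\<^sub>v (?GB *\<^sub>v bs)"
      using c bs by (subst add_mult_distrib_mat_vec[of _ Nn Nn]) auto
    have IPc: "1\<^sub>m Nn + ?P * ?GB \<in> carrier_mat Nn Nn" using c by auto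
    show ?thesis unfolding Hm_def Let_def diff_Suc_1 IP[symmetric]
      by (rule assoc_mult_mat_vec[OF c(12) IPc bs])
  qed
  have 2: "Hbar G P k *\<^sub>v ms = ?Kr *\<^sub>v (?P *\<^sub>v (?GT *\<^sub>v ms)) - ?M *\<^sub>v ms"
  proof -
    have KPG: "?Kr * ?P * ?GT \<in> carrier_mat Nn (nc_tot G)" using c by auto
    have "(?Kr * ?P * ?GT) *\<^sub>v ms = (?Kr * ?P) *\<^sub>v (?GT *\<^sub>v ms)"
      using c ms by (intro assoc_mult_mat_vec[of _ Nn n _ "nc_tot G"]) (auto intro!: mult_carrier_mat)
    also have "\<dots> = ?Kr *\<^sub>v (?P *\<^sub>v (?GT *\<^sub>v ms))"
      using c g by (intro assoc_mult_mat_vec[of _ Nn Nn _ n]) auto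
    finally show ?thesis unfolding Hbar_def minus_mult_distrib_mat_vec[OF KPG M ms] by simp
  qed
  have "Hm G P (Suc k) *\<^sub>v bs + Hbar G P k *\<^sub>v ms = ?Kr *\<^sub>v (bs + ?P *\<^sub>v w) - ?M *\<^sub>v ms"
  proof -
    have "?P *\<^sub>v w = ?P *\<^sub>v (?GB *\<^sub>v bs) + ?P *\<^sub>v (?GT *\<^sub>v ms)"
      unfolding w_def by (rule mult_add_distrib_mat_vec[OF c(10) g])
    then show ?thesis unfolding 1 2 using p bs c(12) M
      by (simp add: mult_add_distrib_mat_vec[of _ Nn Nn])
        (intro eq_vecI, use c(12) M in \<open>auto simp: algebra_simps simp del: index_mult_mat_vec\<close>)
  qed
  also have "bs + ?P *\<^sub>v w = stack N (\<lambda>i. b i + ?Pw i w)"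
  proof -
    have "?P *\<^sub>v w = stack N (\<lambda>i. ?Pw i w)"
      unfolding Pcol_def using Pc w by (intro vstack_mult_vec) auto
    then show ?thesis using vec_stack_add[of N b "\<lambda>_. n" "\<lambda>i. ?Pw i w"] b Pw by simp
  qed
  also have "?Kr *\<^sub>v \<dots> = stack N (\<lambda>i. ?A *\<^sub>v (b i + ?Pw i w))"
    using b Pw by (intro kron_one_mult_vec_stack[OF A]) auto
  also have "?M *\<^sub>v ms = stack N (\<lambda>i. ?Mm i)"
    unfolding bM_def transpose_diag_block_mat map_map o_def
    using carriers(3) k m by (intro diag_block_mat_mult_vec_stack[where r = "\<lambda>_. n" and c = "nc G"]) auto
  also have "stack N (\<lambda>i. ?A *\<^sub>v (b i + ?Pw i w)) - \<dots>
    = stack N (\<lambda>i. ?A *\<^sub>v (b i + ?Pw i w) - ?Mm i)"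
  proof (rule vec_stack_minus[where d = "\<lambda>_. n"])
    fix i assume "i < N"
    then show "?A *\<^sub>v (b i + ?Pw i w) \<in> carrier_vec n" "?Mm i \<in> carrier_vec n"
      using A carriers(3)[OF _ k, of i] by (auto intro!: carrier_vecI)
  qed
  also have "map (\<lambda>i. ?A *\<^sub>v (b i + ?Pw i w) - ?Mm i) [0..<N]
    = map (\<lambda>i. ?A *\<^sub>v (P i (Suc k) *\<^sub>v ?y + b i) + Qm G i k *\<^sub>v x - ?Mm i - P i k *\<^sub>v x) [0..<N]"
  proof (rule map_cong[OF refl])
    fix i assume "i \<in> set [0..<N]"
    then have i: "i < N" by simp
    have Q: "Qm G i k \<in> carrier_mat n n" using carriers(7)[OF i] k by simp
    have y: "?y = ?gx + w"
      unfolding next_state_def w_def using g gx by (intro assoc_add_vec[of _ n]) auto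
    \<comment> \<open>The Riccati equation cancels the state weight together with the part of the
      next state that comes from x.\<close>
    have "P i k = Qm G i k + ?A * P i (Suc k) * minv (Lam G P k) * Am G k"
      using P_ric i k by (auto simp: riccati_nash_def)
    moreover have "(?A * P i (Suc k) * minv (Lam G P k) * Am G k) *\<^sub>v x = ?A *\<^sub>v (P i (Suc k) *\<^sub>v ?gx)"
    proof -
      note Li = Li_carrier[OF k]
      have AP: "?A * P i (Suc k) \<in> carrier_mat n n" using A Pc[OF i] by auto
      have "(?A * P i (Suc k) * minv (Lam G P k) * Am G k) *\<^sub>v x = (?A * P i (Suc k) * Gm G P k) *\<^sub>v x"
        unfolding Gm_def assoc_mult_mat[OF AP Li carriers(1)[OF k]] ..
      also have "\<dots> = (?A * P i (Suc k)) *\<^sub>v ?gx" by (rule assoc_mult_mat_vec[OF AP c(1) x])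
      also have "\<dots> = ?A *\<^sub>v (P i (Suc k) *\<^sub>v ?gx)" by (rule assoc_mult_mat_vec[OF A Pc[OF i] gx])
      finally show ?thesis .
    qed
    moreover have "?A * P i (Suc k) * minv (Lam G P k) * Am G k \<in> carrier_mat n n"
      using A Pc[OF i] Li_carrier[OF k] carriers(1)[OF k] by (intro mult_carrier_mat) auto
    ultimately have Px: "P i k *\<^sub>v x = Qm G i k *\<^sub>v x + ?A *\<^sub>v (P i (Suc k) *\<^sub>v ?gx)"
      using add_mult_distrib_mat_vec[OF Q _ x] by simp
    have "?A *\<^sub>v (P i (Suc k) *\<^sub>v ?y + b i) = ?A *\<^sub>v (P i (Suc k) *\<^sub>v ?gx) + ?A *\<^sub>v (?Pw i w) + ?A *\<^sub>v b i"
      unfolding y mult_add_distrib_mat_vec[OF Pc[OF i] gx w]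
      by (rule mult_mat_vec_add3[OF A Pg[OF i] Pw[OF i] b[OF i]])
    moreover have "?A *\<^sub>v (b i + ?Pw i w) = ?A *\<^sub>v b i + ?A *\<^sub>v (?Pw i w)"
      by (rule mult_add_distrib_mat_vec[OF A b[OF i] Pw[OF i]])
    ultimately show "?A *\<^sub>v (b i + ?Pw i w) - ?Mm i
      = ?A *\<^sub>v (P i (Suc k) *\<^sub>v ?y + b i) + Qm G i k *\<^sub>v x - ?Mm i - P i k *\<^sub>v x"
      unfolding Px by (intro eq_vecI)
        (use A Q carriers(3)[OF i k] in \<open>auto simp: algebra_simps simp del: index_mult_mat_vec\<close>)
  qed
  finally show ?thesis .
qed

end

end

section \<open>Solution operators of the recursions\<close>

text \<open>Here f is the 1-based formula of an array and g a 0-based family better suited to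
  recursions.\<close>

lemma block_array_cong_mult_vec_stack:
  assumes "\<And>k t. k < K \<Longrightarrow> t < K \<Longrightarrow> f (Suc k) (Suc t) = g k t"
    "\<And>k t. k < K \<Longrightarrow> t < K \<Longrightarrow> g k t \<in> carrier_mat r c"
    "\<And>t. t < K \<Longrightarrow> v t \<in> carrier_vec c"
  shows "block_array K r c f \<in> carrier_mat (K * r) (K * c)"
    "block_array K r c f *\<^sub>v stack K v =
      stack K (\<lambda>k. vsum r (\<lambda>t. g k t *\<^sub>v v t) {..<K})"
proof -
  have f: "f k t \<in> carrier_mat r c" if "1 \<le> k" "k \<le> K" "1 \<le> t" "t \<le> K" for k t
    using that assms(1,2)[of "k - 1" "t - 1"] by (cases k; cases t) auto
  show "block_array K r c f \<in> carrier_mat (K * r) (K * c)" using f by (rule block_array_carrier)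
  have "block_array K r c f *\<^sub>v stack K v =
      stack K (\<lambda>k. vsum r (\<lambda>t. f (Suc k) (Suc t) *\<^sub>v v t) {..<K})"
    using f assms(3) by (rule block_array_mult_vec_stack)
  also have "\<dots> = stack K (\<lambda>k. vsum r (\<lambda>t. g k t *\<^sub>v v t) {..<K})"
    by (intro arg_cong[of _ _ vec_stack] map_cong vsum_cong refl) (simp add: assms(1))
  finally show "block_array K r c f *\<^sub>v stack K v =
      stack K (\<lambda>k. vsum r (\<lambda>t. g k t *\<^sub>v v t) {..<K})" .
qed

lemma add_mat_rearrange:
  fixes X :: "real mat"
  assumes "X \<in> carrier_mat r c" "Y \<in> carrier_mat r c" "Z \<in> carrier_mat r c" "W \<in> carrier_mat r c"
  shows "(X + Y) + (Z + W) = (X + Z) + Y + W"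
  using assms by (intro eq_matI) auto

context game_nash
begin

section \<open>Transition matrices and blocks of the solution operators\<close>

lemma phi_carrier: "k \<le> K \<Longrightarrow> phi G P k \<tau> \<in> carrier_mat n n"
  by (induction k) (auto intro!: mult_carrier_mat stage_carriers(1))

lemma vphi_carrier: "\<tau> \<le> K \<Longrightarrow> vphi G P k \<tau> \<in> carrier_mat Nn Nn"
  by (induction \<tau>) (auto intro!: mult_carrier_mat stage_carriers2(4))

lemma phi_same [simp]: "phi G P k k = 1\<^sub>m n"
  by (cases k) auto

lemma vphi_same [simp]: "vphi G P k k = 1\<^sub>m Nn"
  by (cases k) auto

text \<open>\<open>vphi\<close> grows on the right by definition, whereas the backward recursion of
  the offsets needs its leftmost factor.\<close>

lemma vphi_left: "k < \<tau> \<Longrightarrow> \<tau> \<le> K \<Longrightarrow> vphi G P k \<tau> = Hm G P (Suc k) * vphi G P (Suc k) \<tau>"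
proof (induction \<tau>)
  case (Suc \<tau>)
  show ?case
  proof (cases "k = \<tau>")
    case True
    have "Hm G P (Suc \<tau>) \<in> carrier_mat Nn Nn" using stage_carriers2(4)[of \<tau>] Suc.prems by simp
    then show ?thesis using True by simp
  next
    case False
    then have k: "k < \<tau>" using Suc.prems by simp
    then have "vphi G P k (Suc \<tau>) = (Hm G P (Suc k) * vphi G P (Suc k) \<tau>) * Hm G P (Suc \<tau>)"
      using Suc by simp
    also have "\<dots> = Hm G P (Suc k) * (vphi G P (Suc k) \<tau> * Hm G P (Suc \<tau>))"
      using k Suc.prems by (intro assoc_mult_mat[of _ Nn Nn _ Nn _ Nn] stage_carriers2(4) vphi_carrier) auto
    finally show ?thesis using k by simp
  qed
qed simp

text \<open>Row j stands for block row j+1, and the empty sum at j = 0 accounts for the zero first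
  row. The column index is that of \<open>vphi\<close>, so that the same family serves
  \<open>Phi1\<close> at t+1 and \<open>Phi2\<close> at t.\<close>

definition Phi1_blk :: "nat \<Rightarrow> nat \<Rightarrow> real mat" where
  "Phi1_blk j t = mat_sum n Nn (\<lambda>\<rho>. phi G P j \<rho> * Gbar G P \<rho> * vphi G P \<rho> t) {1..min j t}"

lemma Phi1_blk_carrier [simp]: "Phi1_blk j t \<in> carrier_mat n Nn"
  by (simp add: Phi1_blk_def)

lemma Phi1_blk_0 [simp]: "Phi1_blk 0 t = 0\<^sub>m n Nn" "Phi1_blk j 0 = 0\<^sub>m n Nn"
  by (simp_all add: Phi1_blk_def)

text \<open>The old summands gain the factor \<open>Gm G P j\<close> on the left; a new summand with
  index j+1 appears exactly when j < t.\<close>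

lemma Phi1_blk_Suc:
  assumes j: "j < K" and t: "t \<le> K"
  shows "Phi1_blk (Suc j) t = Gm G P j * Phi1_blk j t + Gbar G P (Suc j) * (if j < t then vphi G P (Suc j) t else 0\<^sub>m Nn Nn)"
proof -
  have Gbar: "Gbar G P \<rho> \<in> carrier_mat n Nn" if "1 \<le> \<rho>" "\<rho> \<le> K" for \<rho>
    using that stage_carriers(2)[of "\<rho> - 1"] by (cases \<rho>) auto
  have trm: "phi G P j \<rho> * Gbar G P \<rho> * vphi G P \<rho> t \<in> carrier_mat n Nn" if "1 \<le> \<rho>" "\<rho> \<le> j" for \<rho>
    using that j t by (intro mult_carrier_mat[of _ n Nn] mult_carrier_mat[of _ n n] phi_carrier vphi_carrier Gbar) auto
  have sum: "mat_sum n Nn (\<lambda>\<rho>. phi G P (Suc j) \<rho> * Gbar G P \<rho> * vphi G P \<rho> t) {1..min j t} = Gm G P j * Phi1_blk j t"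
  proof -
    have "mat_sum n Nn (\<lambda>\<rho>. phi G P (Suc j) \<rho> * Gbar G P \<rho> * vphi G P \<rho> t) {1..min j t} =
      mat_sum n Nn (\<lambda>\<rho>. Gm G P j * (phi G P j \<rho> * Gbar G P \<rho> * vphi G P \<rho> t)) {1..min j t}"
    proof (intro mat_sum_cong refl)
      fix \<rho> assume "\<rho> \<in> {1..min j t}"
      then have r: "1 \<le> \<rho>" "\<rho> \<le> j" "\<rho> \<le> K" using j by auto
      note c = stage_carriers(1)[OF j] phi_carrier[OF less_imp_le[OF j], of \<rho>] Gbar[OF r(1,3)] vphi_carrier[OF t, of \<rho>]
      have "phi G P (Suc j) \<rho> = Gm G P j * phi G P j \<rho>" using r by simp
      then show "phi G P (Suc j) \<rho> * Gbar G P \<rho> * vphi G P \<rho> t = Gm G P j * (phi G P j \<rho> * Gbar G P \<rho> * vphi G P \<rho> t)"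
        using assoc_mult_mat[OF c(1,2,3)] assoc_mult_mat[OF c(1) mult_carrier_mat[OF c(2,3)] c(4)] by simp
    qed
    also have "\<dots> = Gm G P j * Phi1_blk j t"
      unfolding Phi1_blk_def using trm by (intro mat_sum_mult_left[symmetric] stage_carriers(1) j) auto
    finally show ?thesis .
  qed
  show ?thesis
  proof (cases "j < t")
    case True
    have ins: "{1..min (Suc j) t} = insert (Suc j) {1..min j t}" using True by auto
    have last: "phi G P (Suc j) (Suc j) * Gbar G P (Suc j) * vphi G P (Suc j) t = Gbar G P (Suc j) * vphi G P (Suc j) t"
      using stage_carriers(2)[OF j] by simp
    have "Gbar G P (Suc j) * vphi G P (Suc j) t \<in> carrier_mat n Nn"
      by (rule mult_carrier_mat[OF stage_carriers(2)[OF j] vphi_carrier[OF t]])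
    then have "Phi1_blk (Suc j) t = mat_sum n Nn (\<lambda>\<rho>. phi G P (Suc j) \<rho> * Gbar G P \<rho> * vphi G P \<rho> t) {1..min j t}
      + phi G P (Suc j) (Suc j) * Gbar G P (Suc j) * vphi G P (Suc j) t"
      unfolding Phi1_blk_def ins by (intro mat_sum_insert) (use stage_carriers(2)[OF j] in \<open>auto simp del: phi.simps\<close>)
    then show ?thesis using True unfolding sum last by simp
  next
    case False
    then have "min (Suc j) t = min j t" by auto
    then show ?thesis using False sum stage_carriers(1,2)[OF j]
      unfolding Phi1_blk_def[of "Suc j"] by simp
  qed
qed

text \<open>Row j and column t stand for block (j+1, t+1), here and in the next two
  definitions.\<close>

definition "Psi1_blk j t = (if j \<le> t then vphi G P (Suc j) (Suc t) else 0\<^sub>m Nn Nn)"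
definition "Psi2_blk j t = (if j < t then vphi G P (Suc j) t * Hbar G P t else 0\<^sub>m Nn (nc_tot G))"
text \<open>One formula for all cases of \<open>Phi2\<close>: \<open>Phi1_blk\<close> vanishes for j
  = 0 and for t = 0, and its upper limit, the minimum of j and t, covers both ranges of
  summation.\<close>

definition "Phi2_blk j t = Phi1_blk j t * Hbar G P t + (if t < j then phi G P j (Suc t) * Gtil G P t else 0\<^sub>m n (nc_tot G))"

lemma Psi1_blk_carrier: "t < K \<Longrightarrow> Psi1_blk j t \<in> carrier_mat Nn Nn"
  unfolding Psi1_blk_def by (auto simp del: vphi.simps intro: vphi_carrier)

lemma Psi2_blk_carrier: "t < K \<Longrightarrow> Psi2_blk j t \<in> carrier_mat Nn (nc_tot G)"
  unfolding Psi2_blk_def by (auto intro!: mult_carrier_mat vphi_carrier stage_carriers2)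

lemma Phi2_blk_carrier: "t < K \<Longrightarrow> j \<le> K \<Longrightarrow> Phi2_blk j t \<in> carrier_mat n (nc_tot G)"
  unfolding Phi2_blk_def
  using mult_carrier_mat[OF Phi1_blk_carrier[of j t] stage_carriers2(5)[of t]]
    mult_carrier_mat[OF phi_carrier[of j "Suc t"] stage_carriers(3)[of t]] by simp

lemma Phi2_blk_0: "t < K \<Longrightarrow> Phi2_blk 0 t = 0\<^sub>m n (nc_tot G)"
  using stage_carriers2(5)[of t] by (auto simp: Phi2_blk_def)

text \<open>Row j is obtained from row j+1 by one backward step. The identity at t = j injects the
  linear cost vector of stage j+1 into its own offset.\<close>

lemma Psi1_blk_rec:
  assumes "Suc j < K" "t < K"
  shows "Psi1_blk j t = Hm G P (Suc (Suc j)) * Psi1_blk (Suc j) t + (if t = j then 1\<^sub>m Nn else 0\<^sub>m Nn Nn)"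
proof -
  have H: "Hm G P (Suc (Suc j)) \<in> carrier_mat Nn Nn" using stage_carriers2(4) assms by blast
  consider "Suc j \<le> t" | "t = j" | "t < j" by linarith
  then show ?thesis
  proof cases
    case 1
    have v: "vphi G P (Suc (Suc j)) (Suc t) \<in> carrier_mat Nn Nn" using assms by (intro vphi_carrier) simp
    show ?thesis using 1 assms vphi_left[of "Suc j" "Suc t"] H v
      by (simp add: Psi1_blk_def right_add_zero_mat[of _ Nn Nn] del: vphi.simps)
  next
    case 2
    then show ?thesis using H by (simp add: Psi1_blk_def del: vphi.simps)
  next
    case 3
    then show ?thesis using H by (simp add: Psi1_blk_def del: vphi.simps)
  qed
qed

lemma Psi2_blk_rec:
  assumes "Suc j < K" "t < K"
  shows "Psi2_blk j t = Hm G P (Suc (Suc j)) * Psi2_blk (Suc j) t + (if t = Suc j then Hbar G P (Suc j) else 0\<^sub>m Nn (nc_tot G))"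
proof -
  have H: "Hm G P (Suc (Suc j)) \<in> carrier_mat Nn Nn" using stage_carriers2(4) assms by blast
  have Hb: "Hbar G P t \<in> carrier_mat Nn (nc_tot G)" using stage_carriers2(5) assms by blast
  consider "Suc j < t" | "t = Suc j" | "t \<le> j" by linarith
  then show ?thesis
  proof cases
    case 1
    have v: "vphi G P (Suc (Suc j)) t \<in> carrier_mat Nn Nn" using assms by (intro vphi_carrier) simp
    show ?thesis using 1 assms vphi_left[of "Suc j" t] H v Hb assoc_mult_mat[OF H v Hb]
       right_add_zero_mat[OF mult_carrier_mat[OF H mult_carrier_mat[OF v Hb]]]
      by (simp add: Psi2_blk_def del: vphi.simps)
  next
    case 2
    then show ?thesis using H Hb left_add_zero_mat[OF Hb] by (simp add: Psi2_blk_def del: vphi.simps)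
  next
    case 3
    then show ?thesis using H by (simp add: Psi2_blk_def del: vphi.simps)
  qed
qed

text \<open>Multiplying \<open>Phi1_blk_Suc\<close> by \<open>Hbar\<close> produces the term with
  \<open>Psi2_blk\<close>; the direct effect of the multipliers starts at t = j with
  \<open>Gtil\<close> and is then propagated by \<open>Gm\<close>.\<close>

lemma Phi2_blk_rec:
  assumes j: "j < K" and t: "t < K"
  shows "Phi2_blk (Suc j) t = Gm G P j * Phi2_blk j t + Gbar G P (Suc j) * Psi2_blk j t + (if t = j then Gtil G P j else 0\<^sub>m n (nc_tot G))"
proof -
  note G = stage_carriers(1,2)[OF j] and Hb = stage_carriers2(5)[OF t] and Gt = stage_carriers(3)[OF t]
  let ?q = "nc_tot G"
  let ?v = "if j < t then vphi G P (Suc j) t else 0\<^sub>m Nn Nn"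
  have v: "?v \<in> carrier_mat Nn Nn" using vphi_carrier[of t "Suc j"] t by simp
  have ph: "phi G P j (Suc t) \<in> carrier_mat n n" using phi_carrier j by simp
  have c: "Gm G P j * Phi1_blk j t \<in> carrier_mat n Nn" "Phi1_blk j t * Hbar G P t \<in> carrier_mat n ?q"
    "Gbar G P (Suc j) * ?v \<in> carrier_mat n Nn" "phi G P j (Suc t) * Gtil G P t \<in> carrier_mat n ?q"
    using G Hb v ph Gt by (auto intro!: mult_carrier_mat[of _ n n] mult_carrier_mat[of _ n Nn])
  have Psi2_blk: "Psi2_blk j t = ?v * Hbar G P t" using Hb by (simp add: Psi2_blk_def)
  have "Phi1_blk (Suc j) t * Hbar G P t = (Gm G P j * Phi1_blk j t) * Hbar G P t + (Gbar G P (Suc j) * ?v) * Hbar G P t"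
    unfolding Phi1_blk_Suc[OF j less_imp_le[OF t]] by (rule add_mult_distrib_mat[OF c(1,3) Hb])
  also have "(Gm G P j * Phi1_blk j t) * Hbar G P t = Gm G P j * (Phi1_blk j t * Hbar G P t)"
    by (rule assoc_mult_mat[OF G(1) Phi1_blk_carrier Hb])
  also have "(Gbar G P (Suc j) * ?v) * Hbar G P t = Gbar G P (Suc j) * Psi2_blk j t"
    unfolding Psi2_blk by (rule assoc_mult_mat[OF G(2) v Hb])
  finally have 1: "Phi1_blk (Suc j) t * Hbar G P t = Gm G P j * (Phi1_blk j t * Hbar G P t) + Gbar G P (Suc j) * Psi2_blk j t" .
  let ?e = "if t < j then phi G P j (Suc t) * Gtil G P t else 0\<^sub>m n ?q"
  have e: "?e \<in> carrier_mat n ?q" using c by simp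
  have 2: "(if t < Suc j then phi G P (Suc j) (Suc t) * Gtil G P t else 0\<^sub>m n ?q)
    = Gm G P j * ?e + (if t = j then Gtil G P j else 0\<^sub>m n ?q)"
  proof -
    consider "t < j" | "t = j" | "j < t" by linarith
    then show ?thesis
    proof cases
      case 1
      have "phi G P (Suc j) (Suc t) = Gm G P j * phi G P j (Suc t)" using 1 by simp
      then show ?thesis using 1 assoc_mult_mat[OF G(1) ph Gt] right_add_zero_mat[OF mult_carrier_mat[OF G(1) c(4)]]
        by (simp del: phi.simps)
    next
      case 2
      then show ?thesis using G Gt left_add_zero_mat[OF Gt] by simp
    next
      case 3
      then show ?thesis using G by simp
    qed
  qed
  have GD: "Gm G P j * Phi2_blk j t = Gm G P j * (Phi1_blk j t * Hbar G P t) + Gm G P j * ?e"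
    unfolding Phi2_blk_def by (rule mult_add_distrib_mat[OF G(1) c(2) e])
  show ?thesis
    unfolding Phi2_blk_def[of "Suc j"] 1 2 GD
    using G Gt e c Psi2_blk_carrier[OF t, of j]
    by (intro add_mat_rearrange[of _ n ?q]) (auto intro!: mult_carrier_mat[of _ n n] mult_carrier_mat[of _ n Nn])
qed

section \<open>State trajectory and costate offsets\<close>

lemma bp_carrier: "k \<le> K \<Longrightarrow> bp G k \<in> carrier_vec Nn"
  unfolding bp_def using vec_stack_carrier[of N "\<lambda>i. pv G i k" "\<lambda>_. n"] carriers(8) by simp

text \<open>Superposition of the responses to the initial state, the linear cost terms and the
  multipliers. It is block row j+1 of the \<open>Phi\<close> operators and represents the state at
  stage j.\<close>

definition traj :: "(nat \<Rightarrow> real vec) \<Rightarrow> nat \<Rightarrow> real vec" where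
  "traj m j = phi G P j 0 *\<^sub>v x0 + vsum n (\<lambda>t. Phi1_blk j (Suc t) *\<^sub>v bp G (Suc t)) {..<K} + vsum n (\<lambda>t. Phi2_blk j t *\<^sub>v m t) {..<K}"

definition offset :: "(nat \<Rightarrow> real vec) \<Rightarrow> nat \<Rightarrow> real vec" where
  "offset m j = vsum Nn (\<lambda>t. Psi1_blk j t *\<^sub>v bp G (Suc t)) {..<K} + vsum Nn (\<lambda>t. Psi2_blk j t *\<^sub>v m t) {..<K}"

lemma traj_carrier [simp]: "traj m j \<in> carrier_vec n"
  by (intro carrier_vecI) (simp add: traj_def)

lemma offset_carrier [simp]: "offset m j \<in> carrier_vec Nn"
  by (intro carrier_vecI) (simp add: offset_def)

context
  fixes m :: "nat \<Rightarrow> real vec"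
  assumes m: "\<And>t. t < K \<Longrightarrow> m t \<in> carrier_vec (nc_tot G)"
begin

lemma traj_0: "traj m 0 = x0"
proof -
  have "vsum n (\<lambda>t. Phi1_blk 0 (Suc t) *\<^sub>v bp G (Suc t)) {..<K} = 0\<^sub>v n"
    using bp_carrier by (intro eq_vecI) (auto intro!: sum.neutral)
  moreover have "vsum n (\<lambda>t. Phi2_blk 0 t *\<^sub>v m t) {..<K} = 0\<^sub>v n"
    using m by (intro eq_vecI) (auto simp: Phi2_blk_0 intro!: sum.neutral)
  ultimately show ?thesis using x0 by (simp add: traj_def)
qed

text \<open>It suffices to match the block recursions: the \<open>Phi\<close> blocks advance by
  \<open>Gm\<close>, collect the offsets through \<open>Gbar\<close> and the \<open>Psi\<close>
  blocks, and pick up \<open>Gtil\<close> from the multipliers of the current stage.\<close>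

lemma traj_Suc:
  assumes j: "j < K"
  shows "traj m (Suc j) = next_state j (traj m j) (offset m j) (m j)"
proof -
  note G = stage_carriers(1-3)[OF j]
  let ?G = "Gm G P j" and ?B = "Gbar G P (Suc j)"
  have bp: "bp G (Suc t) \<in> carrier_vec Nn" if "t \<in> {..<K}" for t using that bp_carrier by simp
  have m': "m t \<in> carrier_vec (nc_tot G)" if "t \<in> {..<K}" for t using that m by simp
  let ?d1 = "vsum n (\<lambda>t. Phi1_blk j (Suc t) *\<^sub>v bp G (Suc t)) {..<K}" and ?d2 = "vsum n (\<lambda>t. Phi2_blk j t *\<^sub>v m t) {..<K}"
  let ?s1 = "vsum Nn (\<lambda>t. Psi1_blk j t *\<^sub>v bp G (Suc t)) {..<K}" and ?s2 = "vsum Nn (\<lambda>t. Psi2_blk j t *\<^sub>v m t) {..<K}"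
  have S1c: "Psi1_blk j t \<in> carrier_mat Nn Nn" if "t \<in> {..<K}" for t using that Psi1_blk_carrier by simp
  have S2c: "Psi2_blk j t \<in> carrier_mat Nn (nc_tot G)" if "t \<in> {..<K}" for t using that Psi2_blk_carrier by simp
  have D2c: "Phi2_blk j t \<in> carrier_mat n (nc_tot G)" if "t \<in> {..<K}" for t using that Phi2_blk_carrier j by simp
  have ph: "phi G P j 0 *\<^sub>v x0 \<in> carrier_vec n" using phi_carrier[of j 0] j by (intro carrier_vecI) auto
  have 1: "phi G P (Suc j) 0 *\<^sub>v x0 = ?G *\<^sub>v (phi G P j 0 *\<^sub>v x0)"
    using assoc_mult_mat_vec[OF G(1) phi_carrier[OF less_imp_le[OF j]] x0] by simp
  have 2: "vsum n (\<lambda>t. Phi1_blk (Suc j) (Suc t) *\<^sub>v bp G (Suc t)) {..<K} = ?G *\<^sub>v ?d1 + ?B *\<^sub>v ?s1"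
  proof -
    have "vsum n (\<lambda>t. Phi1_blk (Suc j) (Suc t) *\<^sub>v bp G (Suc t)) {..<K}
      = vsum n (\<lambda>t. (?G * Phi1_blk j (Suc t) + ?B * Psi1_blk j t) *\<^sub>v bp G (Suc t)) {..<K}"
    proof (intro vsum_cong refl)
      fix t assume "t \<in> {..<K}"
      then have "Phi1_blk (Suc j) (Suc t) = ?G * Phi1_blk j (Suc t) + ?B * Psi1_blk j t"
        using Phi1_blk_Suc[OF j, of "Suc t"] by (simp add: Psi1_blk_def less_Suc_eq_le del: vphi.simps)
      then show "Phi1_blk (Suc j) (Suc t) *\<^sub>v bp G (Suc t) = (?G * Phi1_blk j (Suc t) + ?B * Psi1_blk j t) *\<^sub>v bp G (Suc t)" by simp
    qed
    also have "\<dots> = ?G *\<^sub>v ?d1 + ?B *\<^sub>v ?s1" by (rule vsum_mat_lin[OF G(1,2) Phi1_blk_carrier S1c bp])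
    finally show ?thesis .
  qed
  have 3: "vsum n (\<lambda>t. Phi2_blk (Suc j) t *\<^sub>v m t) {..<K} = ?G *\<^sub>v ?d2 + ?B *\<^sub>v ?s2 + Gtil G P j *\<^sub>v m j"
  proof -
    let ?D = "\<lambda>t. if t = j then Gtil G P j else 0\<^sub>m n (nc_tot G)"
    have c: "?G * Phi2_blk j t \<in> carrier_mat n (nc_tot G)" "?B * Psi2_blk j t \<in> carrier_mat n (nc_tot G)" "?D t \<in> carrier_mat n (nc_tot G)"
      if "t \<in> {..<K}" for t using G S2c[OF that] D2c[OF that] by auto
    have "vsum n (\<lambda>t. Phi2_blk (Suc j) t *\<^sub>v m t) {..<K} = vsum n (\<lambda>t. (?G * Phi2_blk j t + ?B * Psi2_blk j t + ?D t) *\<^sub>v m t) {..<K}"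
      using Phi2_blk_rec[OF j] by (intro vsum_cong refl) simp
    also have "\<dots> = vsum n (\<lambda>t. (?G * Phi2_blk j t + ?B * Psi2_blk j t) *\<^sub>v m t) {..<K} + vsum n (\<lambda>t. ?D t *\<^sub>v m t) {..<K}"
      by (rule vsum_mat_add[OF add_carrier_mat[OF c(2)] c(3) m'])
    also have "vsum n (\<lambda>t. ?D t *\<^sub>v m t) {..<K} = Gtil G P j *\<^sub>v m j"
      by (rule vsum_mat_delta[OF j G(3) m])
    also have "vsum n (\<lambda>t. (?G * Phi2_blk j t + ?B * Psi2_blk j t) *\<^sub>v m t) {..<K} = ?G *\<^sub>v ?d2 + ?B *\<^sub>v ?s2"
      by (rule vsum_mat_lin[OF G(1,2) D2c S2c m'])
    finally show ?thesis .
  qed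
  have 4: "?G *\<^sub>v traj m j = ?G *\<^sub>v (phi G P j 0 *\<^sub>v x0) + ?G *\<^sub>v ?d1 + ?G *\<^sub>v ?d2"
    unfolding traj_def by (rule mult_mat_vec_add3[OF G(1) ph vsum_carrier vsum_carrier])
  have 5: "?B *\<^sub>v offset m j = ?B *\<^sub>v ?s1 + ?B *\<^sub>v ?s2"
    unfolding offset_def by (rule mult_add_distrib_mat_vec[OF G(2) vsum_carrier vsum_carrier])
  show ?thesis
    unfolding next_state_def traj_def[of m "Suc j"] 1 2 3 4 5
    by (intro eq_vecI) (use G in \<open>auto simp: algebra_simps simp del: index_mult_mat_vec\<close>)
qed

text \<open>In the last block row of \<open>Psi1\<close> only the diagonal identity survives, and
  that of \<open>Psi2\<close> is zero; this is the terminal condition of the costates with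
  \<open>P\<close> removed.\<close>

lemma offset_last:
  assumes "K = Suc j"
  shows "offset m j = bp G K"
proof -
  have "vsum Nn (\<lambda>t. Psi1_blk j t *\<^sub>v bp G (Suc t)) {..<K} = vsum Nn (\<lambda>t. (if t = j then 1\<^sub>m Nn else 0\<^sub>m Nn Nn) *\<^sub>v bp G (Suc t)) {..<K}"
    using assms by (intro vsum_cong refl) (auto simp: Psi1_blk_def simp del: vphi.simps)
  also have "\<dots> = 1\<^sub>m Nn *\<^sub>v bp G (Suc j)"
    using assms bp_carrier by (intro vsum_mat_delta[where v = "\<lambda>t. bp G (Suc t)"]) auto
  also have "\<dots> = bp G K" using assms bp_carrier[of K] by simp
  finally have 1: "vsum Nn (\<lambda>t. Psi1_blk j t *\<^sub>v bp G (Suc t)) {..<K} = bp G K" .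
  have "vsum Nn (\<lambda>t. Psi2_blk j t *\<^sub>v m t) {..<K} = 0\<^sub>v Nn"
    using m assms by (intro eq_vecI) (auto simp: Psi2_blk_def intro!: sum.neutral)
  then show ?thesis using bp_carrier[of K] by (simp add: offset_def 1)
qed

lemma offset_step:
  assumes j: "Suc j < K"
  shows "offset m j = Hm G P (Suc (Suc j)) *\<^sub>v offset m (Suc j) + Hbar G P (Suc j) *\<^sub>v m (Suc j) + bp G (Suc j)"
proof -
  have bp: "bp G (Suc t) \<in> carrier_vec Nn" if "t \<in> {..<K}" for t using that bp_carrier by simp
  have m': "m t \<in> carrier_vec (nc_tot G)" if "t \<in> {..<K}" for t using that m by simp
  let ?H = "Hm G P (Suc (Suc j))"
  note H = stage_carriers2(4,5)[OF j]
  let ?s1 = "vsum Nn (\<lambda>t. Psi1_blk (Suc j) t *\<^sub>v bp G (Suc t)) {..<K}" and ?s2 = "vsum Nn (\<lambda>t. Psi2_blk (Suc j) t *\<^sub>v m t) {..<K}"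
  have S1c: "Psi1_blk (Suc j) t \<in> carrier_mat Nn Nn" if "t \<in> {..<K}" for t using that Psi1_blk_carrier by simp
  have S2c: "Psi2_blk (Suc j) t \<in> carrier_mat Nn (nc_tot G)" if "t \<in> {..<K}" for t using that Psi2_blk_carrier by simp
  have 1: "vsum Nn (\<lambda>t. Psi1_blk j t *\<^sub>v bp G (Suc t)) {..<K} = ?H *\<^sub>v ?s1 + bp G (Suc j)"
  proof -
    let ?D = "\<lambda>t. if t = j then 1\<^sub>m Nn else 0\<^sub>m Nn Nn :: real mat"
    have "vsum Nn (\<lambda>t. Psi1_blk j t *\<^sub>v bp G (Suc t)) {..<K} = vsum Nn (\<lambda>t. (?H * Psi1_blk (Suc j) t + ?D t) *\<^sub>v bp G (Suc t)) {..<K}"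
      using Psi1_blk_rec[OF j] by (intro vsum_cong refl) simp
    also have "\<dots> = vsum Nn (\<lambda>t. (?H * Psi1_blk (Suc j) t) *\<^sub>v bp G (Suc t)) {..<K} + vsum Nn (\<lambda>t. ?D t *\<^sub>v bp G (Suc t)) {..<K}"
      by (rule vsum_mat_add[OF mult_carrier_mat[OF H(1) S1c] _ bp]) auto
    also have "vsum Nn (\<lambda>t. (?H * Psi1_blk (Suc j) t) *\<^sub>v bp G (Suc t)) {..<K} = ?H *\<^sub>v ?s1"
      by (rule vsum_mat_mult[OF H(1) S1c bp])
    also have "vsum Nn (\<lambda>t. ?D t *\<^sub>v bp G (Suc t)) {..<K} = 1\<^sub>m Nn *\<^sub>v bp G (Suc j)"
      using j bp_carrier by (intro vsum_mat_delta[where v = "\<lambda>t. bp G (Suc t)"]) auto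
    finally show ?thesis using bp_carrier[of "Suc j"] j by simp
  qed
  have 2: "vsum Nn (\<lambda>t. Psi2_blk j t *\<^sub>v m t) {..<K} = ?H *\<^sub>v ?s2 + Hbar G P (Suc j) *\<^sub>v m (Suc j)"
  proof -
    let ?D = "\<lambda>t. if t = Suc j then Hbar G P (Suc j) else 0\<^sub>m Nn (nc_tot G)"
    have D: "?D t \<in> carrier_mat Nn (nc_tot G)" for t using H by simp
    have "vsum Nn (\<lambda>t. Psi2_blk j t *\<^sub>v m t) {..<K} = vsum Nn (\<lambda>t. (?H * Psi2_blk (Suc j) t + ?D t) *\<^sub>v m t) {..<K}"
      using Psi2_blk_rec[OF j] by (intro vsum_cong refl) simp
    also have "\<dots> = vsum Nn (\<lambda>t. (?H * Psi2_blk (Suc j) t) *\<^sub>v m t) {..<K} + vsum Nn (\<lambda>t. ?D t *\<^sub>v m t) {..<K}"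
      by (rule vsum_mat_add[OF mult_carrier_mat[OF H(1) S2c] D m'])
    also have "vsum Nn (\<lambda>t. (?H * Psi2_blk (Suc j) t) *\<^sub>v m t) {..<K} = ?H *\<^sub>v ?s2"
      by (rule vsum_mat_mult[OF H(1) S2c m'])
    also have "vsum Nn (\<lambda>t. ?D t *\<^sub>v m t) {..<K} = Hbar G P (Suc j) *\<^sub>v m (Suc j)"
      by (rule vsum_mat_delta[OF j H(2) m])
    finally show ?thesis .
  qed
  have 3: "?H *\<^sub>v offset m (Suc j) = ?H *\<^sub>v ?s1 + ?H *\<^sub>v ?s2"
    unfolding offset_def by (rule mult_add_distrib_mat_vec[OF H(1) vsum_carrier vsum_carrier])
  show ?thesis
    unfolding offset_def[of m j] 1 2 3
    by (intro eq_vecI) (use H bp_carrier[of "Suc j"] j in \<open>auto simp: algebra_simps simp del: index_mult_mat_vec\<close>)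
qed

end

end

section \<open>The complementarity problem\<close>

context game_nash
begin

section \<open>Aggregated matrices acting on stacked vectors\<close>

lemma pK_carrier: "pK G \<in> carrier_vec (K * Nn)"
  unfolding pK_def using vec_stack_carrier[of K "\<lambda>k. bp G (Suc k)" "\<lambda>_. Nn"] bp_carrier by simp

lemma Phi0_props:
  "Phi0 G P \<in> carrier_mat (K * n) n"
  "Phi0 G P *\<^sub>v x0 = stack K (\<lambda>j. phi G P j 0 *\<^sub>v x0)"
proof -
  have e: "Phi0 G P = vstack n (map (\<lambda>k. phi G P k 0) [0..<K])"
    unfolding Phi0_def map_upt_1_Suc by simp
  have c: "phi G P k 0 \<in> carrier_mat n n" if "k < K" for k using that phi_carrier by simp
  show "Phi0 G P \<in> carrier_mat (K * n) n" unfolding e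
    using vstack_carrier[of K "\<lambda>k. phi G P k 0" "\<lambda>_. n" n] c by simp
  show "Phi0 G P *\<^sub>v x0 = stack K (\<lambda>j. phi G P j 0 *\<^sub>v x0)"
    unfolding e using c x0 by (rule vstack_mult_vec)
qed

lemma Phi1_props:
  "Phi1 G P \<in> carrier_mat (K * n) (K * Nn)"
  "Phi1 G P *\<^sub>v pK G = stack K (\<lambda>j. vsum n (\<lambda>t. Phi1_blk j (Suc t) *\<^sub>v bp G (Suc t)) {..<K})"
  unfolding Phi1_def Let_def pK_def
  by (rule block_array_cong_mult_vec_stack[where v = "\<lambda>t. bp G (Suc t)"], auto simp: Phi1_blk_def bp_carrier)+

lemma Psi1_props:
  "Psi1 G P \<in> carrier_mat (K * Nn) (K * Nn)"
  "Psi1 G P *\<^sub>v pK G = stack K (\<lambda>j. vsum Nn (\<lambda>t. Psi1_blk j t *\<^sub>v bp G (Suc t)) {..<K})"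
  unfolding Psi1_def Let_def pK_def
  by (rule block_array_cong_mult_vec_stack[where v = "\<lambda>t. bp G (Suc t)"], auto simp: Psi1_blk_def bp_carrier vphi_carrier simp del: vphi.simps)+

text \<open>The separate cases collapse because the sums are empty in the first row and column, and
  \<open>min k t\<close> selects the correct upper limit elsewhere.\<close>

lemma Phi2_block:
  assumes "k < K" "t < K"
  shows "(if Suc k = 1 then 0\<^sub>m n (nc_tot G)
     else if Suc t = 1 then phi G P (Suc k - 1) 1 * Gtil G P 0
     else if Suc t < Suc k then
       mat_sum n Nn (\<lambda>\<rho>. phi G P (Suc k - 1) \<rho> * Gbar G P \<rho> * vphi G P \<rho> (Suc t - 1)) {1..Suc t - 1}
         * Hbar G P (Suc t - 1)
       + phi G P (Suc k - 1) (Suc t) * Gtil G P (Suc t - 1)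
     else
       mat_sum n Nn (\<lambda>\<rho>. phi G P (Suc k - 1) \<rho> * Gbar G P \<rho> * vphi G P \<rho> (Suc t - 1)) {1..Suc k - 1}
         * Hbar G P (Suc t - 1)) = Phi2_blk k t"
proof -
  have H: "Hbar G P t \<in> carrier_mat Nn (nc_tot G)" by (rule stage_carriers2(5)[OF assms(2)])
  have c: "phi G P k (Suc t) * Gtil G P t \<in> carrier_mat n (nc_tot G)"
    using assms by (intro mult_carrier_mat[of _ n n] phi_carrier stage_carriers) auto
  have CH: "Phi1_blk k t * Hbar G P t \<in> carrier_mat n (nc_tot G)" by (rule mult_carrier_mat[OF Phi1_blk_carrier H])
  consider "k = 0" | "k > 0" "t = 0" | "0 < t" "t < k" | "0 < k" "0 < t" "k \<le> t" by linarith
  then show ?thesis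
  proof cases
    case 1
    then show ?thesis using Phi2_blk_0[OF assms(2)] by simp
  next
    case 2
    then show ?thesis using H c left_add_zero_mat[OF c] by (simp add: Phi2_blk_def)
  next
    case 3
    then have "min k t = t" by simp
    then show ?thesis using 3 by (simp add: Phi2_blk_def Phi1_blk_def)
  next
    case 4
    then have "min k t = k" by simp
    then show ?thesis using 4 right_add_zero_mat[OF CH] by (simp add: Phi2_blk_def Phi1_blk_def)
  qed
qed

lemma br_carrier: "k < K \<Longrightarrow> br G k \<in> carrier_vec (nc_tot G)"
  unfolding br_def nc_tot_def using carriers(5) by (intro vec_stack_carrier) auto

lemma dim_lcp_q: "dim_vec (lcp_q G P x0) = K * nc_tot G"
  using dim_vec_stack_map[of K "br G" "\<lambda>_. nc_tot G"] br_carrier by (simp add: lcp_q_def rK_def)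

definition "input_sol m k = Fm G P k *\<^sub>v traj m k + Fbar G P (Suc k) *\<^sub>v offset m k + Ftil G P k *\<^sub>v m k"

context
  fixes m :: "nat \<Rightarrow> real vec"
  assumes m: "\<And>t. t < K \<Longrightarrow> m t \<in> carrier_vec (nc_tot G)"
begin

abbreviation "mK \<equiv> stack K m"

lemma mK_carrier: "mK \<in> carrier_vec (K * nc_tot G)"
  using vec_stack_carrier[of K m "\<lambda>_. nc_tot G"] m by simp

lemma Phi2_props:
  "Phi2 G P \<in> carrier_mat (K * n) (K * nc_tot G)"
  "Phi2 G P *\<^sub>v mK = stack K (\<lambda>j. vsum n (\<lambda>t. Phi2_blk j t *\<^sub>v m t) {..<K})"
  unfolding Phi2_def Let_def
  by (rule block_array_cong_mult_vec_stack[where g = Phi2_blk];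
      ((rule Phi2_block; assumption) | (rule m, assumption) | simp add: Phi2_blk_carrier))+

lemma Psi2_props:
  "Psi2 G P \<in> carrier_mat (K * Nn) (K * nc_tot G)"
  "Psi2 G P *\<^sub>v mK = stack K (\<lambda>j. vsum Nn (\<lambda>t. Psi2_blk j t *\<^sub>v m t) {..<K})"
  unfolding Psi2_def Let_def
  by (rule block_array_cong_mult_vec_stack[where g = Psi2_blk];
      ((rule Psi2_blk_carrier, assumption) | (rule m, assumption) | simp add: Psi2_blk_def))+

text \<open>Arbitrary stage matrices X, Y, Z allow two uses: with the input gains it yields the
  profile, with the constraint gains the affine map of the complementarity problem.\<close>

lemma assembled:
  assumes X: "\<And>k. k < K \<Longrightarrow> X k \<in> carrier_mat r n" and Y: "\<And>k. k < K \<Longrightarrow> Y k \<in> carrier_mat r Nn"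
    and Z: "\<And>k. k < K \<Longrightarrow> Z k \<in> carrier_mat r (nc_tot G)"
  defines "DX \<equiv> diag_block_mat (map X [0..<K])" and "DY \<equiv> diag_block_mat (map Y [0..<K])"
    and "DZ \<equiv> diag_block_mat (map Z [0..<K])"
  shows "(DX * Phi2 G P + DY * Psi2 G P + DZ) *\<^sub>v mK + (DX * Phi0 G P *\<^sub>v x0 + (DX * Phi1 G P + DY * Psi1 G P) *\<^sub>v pK G)
    = stack K (\<lambda>k. X k *\<^sub>v traj m k + Y k *\<^sub>v offset m k + Z k *\<^sub>v m k)"
proof -
  have D: "DX \<in> carrier_mat (K * r) (K * n)" "DY \<in> carrier_mat (K * r) (K * Nn)" "DZ \<in> carrier_mat (K * r) (K * nc_tot G)"
    unfolding DX_def DY_def DZ_def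
    using diag_block_mat_carrier[of K X "\<lambda>_. r" "\<lambda>_. n"] diag_block_mat_carrier[of K Y "\<lambda>_. r" "\<lambda>_. Nn"]
      diag_block_mat_carrier[of K Z "\<lambda>_. r" "\<lambda>_. nc_tot G"] X Y Z by simp_all
  have ph: "phi G P j 0 *\<^sub>v x0 \<in> carrier_vec n" if "j < K" for j
    using phi_carrier[of j 0] that by (intro carrier_vecI) auto
  have traj: "Phi0 G P *\<^sub>v x0 + Phi1 G P *\<^sub>v pK G + Phi2 G P *\<^sub>v mK = stack K (traj m)"
    unfolding Phi0_props Phi1_props Phi2_props traj_def[abs_def]
    by (simp add: vec_stack_add[where d = "\<lambda>_. n"] ph)
  have offset: "Psi1 G P *\<^sub>v pK G + Psi2 G P *\<^sub>v mK = stack K (offset m)"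
    unfolding Psi1_props Psi2_props offset_def[abs_def]
    by (simp add: vec_stack_add[where d = "\<lambda>_. Nn"])
  have "(DX * Phi2 G P + DY * Psi2 G P + DZ) *\<^sub>v mK + (DX * Phi0 G P *\<^sub>v x0 + (DX * Phi1 G P + DY * Psi1 G P) *\<^sub>v pK G)
    = DX *\<^sub>v stack K (traj m) + DY *\<^sub>v stack K (offset m) + DZ *\<^sub>v mK"
    unfolding traj[symmetric] offset[symmetric]
    by (rule affine_assembly[OF D Phi0_props(1) Phi1_props(1) Phi2_props(1) Psi1_props(1) Psi2_props(1) x0 pK_carrier mK_carrier])
  also have "DX *\<^sub>v stack K (traj m) = stack K (\<lambda>k. X k *\<^sub>v traj m k)"
    unfolding DX_def using X by (intro diag_block_mat_mult_vec_stack[where r = "\<lambda>_. r" and c = "\<lambda>_. n"]) auto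
  also have "DY *\<^sub>v stack K (offset m) = stack K (\<lambda>k. Y k *\<^sub>v offset m k)"
    unfolding DY_def using Y by (intro diag_block_mat_mult_vec_stack[where r = "\<lambda>_. r" and c = "\<lambda>_. Nn"]) auto
  also have "DZ *\<^sub>v mK = stack K (\<lambda>k. Z k *\<^sub>v m k)"
    unfolding DZ_def using Z m by (intro diag_block_mat_mult_vec_stack[where r = "\<lambda>_. r" and c = "\<lambda>_. nc_tot G"]) auto
  also have "stack K (\<lambda>k. X k *\<^sub>v traj m k) + stack K (\<lambda>k. Y k *\<^sub>v offset m k)
    = stack K (\<lambda>k. X k *\<^sub>v traj m k + Y k *\<^sub>v offset m k)"
    using mult_mat_vec_carrier[OF X traj_carrier] mult_mat_vec_carrier[OF Y offset_carrier] by (rule vec_stack_add)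
  also have "\<dots> + stack K (\<lambda>k. Z k *\<^sub>v m k) = stack K (\<lambda>k. X k *\<^sub>v traj m k + Y k *\<^sub>v offset m k + Z k *\<^sub>v m k)"
    using add_carrier_vec[OF mult_mat_vec_carrier[OF X traj_carrier] mult_mat_vec_carrier[OF Y offset_carrier]] mult_mat_vec_carrier[OF Z m]
    by (rule vec_stack_add)
  finally show ?thesis .
qed

lemma input_sol_carrier: "k < K \<Longrightarrow> input_sol m k \<in> carrier_vec (nu_tot G)"
  using stage_carriers2(3)[of k] by (intro carrier_vecI) (simp add: input_sol_def)

lemma sol_eq: "sol_F G P *\<^sub>v mK + sol_P G P x0 = stack K (input_sol m)"
  unfolding sol_F_def sol_P_def FK_def FbarK_def FtilK_def input_sol_def
  by (rule assembled[where r = "nu_tot G"]) (auto intro: stage_carriers2)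

text \<open>The input gains inside \<open>MK\<close>, \<open>NK\<close> and \<open>NtilK\<close> are
  collected behind a common factor \<open>Nbar\<close>, so that each block becomes a constraint
  value along the trajectory.\<close>

lemma lcp_eq: "lcp_M G P *\<^sub>v mK + lcp_q G P x0
  = stack K (\<lambda>k. Mbar G k *\<^sub>v traj m k + Nbar G k *\<^sub>v input_sol m k + br G k)"
proof -
  let ?X = "\<lambda>k. Mbar G k + Nbar G k * Fm G P k" and ?Y = "\<lambda>k. Nbar G k * Fbar G P (Suc k)" and ?Z = "\<lambda>k. Nbar G k * Ftil G P k"
  have XYZ: "?X k \<in> carrier_mat (nc_tot G) n" "?Y k \<in> carrier_mat (nc_tot G) Nn" "?Z k \<in> carrier_mat (nc_tot G) (nc_tot G)"
    if "k < K" for k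
    using stage_carriers[OF that] stage_carriers2[OF that] by auto
  let ?w = "\<lambda>k. ?X k *\<^sub>v traj m k + ?Y k *\<^sub>v offset m k + ?Z k *\<^sub>v m k"
  let ?l1 = "lcp_M G P *\<^sub>v mK"
  let ?l2 = "MK G P * Phi0 G P *\<^sub>v x0 + (MK G P * Phi1 G P + NK G P * Psi1 G P) *\<^sub>v pK G"
  have w: "?w k \<in> carrier_vec (nc_tot G)" if "k < K" for k using XYZ(3)[OF that] by (intro carrier_vecI) auto
  have "?l1 + ?l2 = stack K ?w"
    unfolding lcp_M_def MK_def NK_def NtilK_def by (rule assembled[OF XYZ])
  moreover have "lcp_M G P *\<^sub>v mK + lcp_q G P x0 = (?l1 + ?l2) + rK G"
  proof -
    have "dim_row (lcp_M G P) = K * nc_tot G" "dim_row (NK G P) = K * nc_tot G" "dim_vec (rK G) = K * nc_tot G"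
      using dim_vec_stack_map[of K "br G" "\<lambda>_. nc_tot G"] br_carrier
        diag_block_mat_carrier[of K ?Z "\<lambda>_. nc_tot G" "\<lambda>_. nc_tot G"] diag_block_mat_carrier[of K ?Y "\<lambda>_. nc_tot G" "\<lambda>_. Nn"] XYZ
      by (auto simp: lcp_M_def NtilK_def NK_def rK_def)
    then show ?thesis unfolding lcp_q_def
      by (intro eq_vecI) (auto simp: algebra_simps simp del: index_mult_mat_vec)
  qed
  moreover have "stack K ?w + rK G = stack K (\<lambda>k. ?w k + br G k)"
    unfolding rK_def using w br_carrier by (rule vec_stack_add)
  moreover have "map (\<lambda>k. ?w k + br G k) [0..<K] = map (\<lambda>k. Mbar G k *\<^sub>v traj m k + Nbar G k *\<^sub>v input_sol m k + br G k) [0..<K]"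
  proof (rule map_cong[OF refl])
    fix k assume "k \<in> set [0..<K]"
    then have k: "k < K" by simp
    note c = stage_carriers(8,9)[OF k] stage_carriers2(1-3)[OF k]
    have v: "Fm G P k *\<^sub>v traj m k \<in> carrier_vec (nu_tot G)" "Fbar G P (Suc k) *\<^sub>v offset m k \<in> carrier_vec (nu_tot G)" "Ftil G P k *\<^sub>v m k \<in> carrier_vec (nu_tot G)"
      using c by (auto intro!: carrier_vecI)
    have NF: "Nbar G k * Fm G P k \<in> carrier_mat (nc_tot G) n" using c by auto
    have "?X k *\<^sub>v traj m k = Mbar G k *\<^sub>v traj m k + Nbar G k *\<^sub>v (Fm G P k *\<^sub>v traj m k)"
      unfolding add_mult_distrib_mat_vec[OF c(1) NF traj_carrier] assoc_mult_mat_vec[OF c(2,3) traj_carrier] ..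
    moreover have "?Y k *\<^sub>v offset m k = Nbar G k *\<^sub>v (Fbar G P (Suc k) *\<^sub>v offset m k)"
      by (rule assoc_mult_mat_vec[OF c(2,4) offset_carrier])
    moreover have "?Z k *\<^sub>v m k = Nbar G k *\<^sub>v (Ftil G P k *\<^sub>v m k)"
      by (rule assoc_mult_mat_vec[OF c(2,5) m[OF k]])
    moreover have "Nbar G k *\<^sub>v input_sol m k = Nbar G k *\<^sub>v (Fm G P k *\<^sub>v traj m k) + Nbar G k *\<^sub>v (Fbar G P (Suc k) *\<^sub>v offset m k) + Nbar G k *\<^sub>v (Ftil G P k *\<^sub>v m k)"
      unfolding input_sol_def by (rule mult_mat_vec_add3[OF c(2) v])
    ultimately show "?w k + br G k = Mbar G k *\<^sub>v traj m k + Nbar G k *\<^sub>v input_sol m k + br G k"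
      by (intro eq_vecI) (use c carrier_vecD[OF br_carrier[OF k]] in \<open>auto simp: algebra_simps simp del: index_mult_mat_vec\<close>)
  qed
  ultimately show ?thesis by simp
qed

end

text \<open>Invertibility of the own input weight makes stationarity solvable for the input.\<close>

lemma feedback_iff:
  assumes k: "k < K" and i: "i < N" and v: "v \<in> carrier_vec (nu G i)" and m: "m i \<in> carrier_vec (nc G i)"
  shows "v = feedback k z b m i \<longleftrightarrow>
    Rm G i i k *\<^sub>v v + (Bm G i k)\<^sup>T *\<^sub>v (P i (Suc k) *\<^sub>v z + b i) - (Nblk G i i k)\<^sup>T *\<^sub>v m i = 0\<^sub>v (nu G i)"
proof -
  let ?p = "(Bm G i k)\<^sup>T *\<^sub>v (P i (Suc k) *\<^sub>v z + b i)" and ?q = "(Nblk G i i k)\<^sup>T *\<^sub>v m i" and ?r = "Rm G i i k *\<^sub>v v"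
  have c: "?p \<in> carrier_vec (nu G i)" "?q \<in> carrier_vec (nu G i)" "?r \<in> carrier_vec (nu G i)"
    using carriers(2)[OF i k] carriers(9)[of i i k] carriers(6)[OF i i k] by (auto intro!: carrier_vecI)
  have "v = feedback k z b m i \<longleftrightarrow> ?r = ?q - ?p"
    unfolding feedback_def using c v by (intro minv_mult_eq_iff[OF carriers(6)[OF i i k] R_inv[OF i k]]) auto
  also have "\<dots> \<longleftrightarrow> ?r + ?p = ?q" using vec_eq_minus_iff[OF c(3,1,2)] .
  also have "\<dots> \<longleftrightarrow> ?r + ?p - ?q = 0\<^sub>v (nu G i)"
  proof -
    have "0\<^sub>v (nu G i) = ?r + ?p - ?q \<longleftrightarrow> 0\<^sub>v (nu G i) + ?q = ?r + ?p"
      by (rule vec_eq_minus_iff[OF zero_carrier_vec c(2) add_carrier_vec[OF c(3,1)]])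
    then show ?thesis unfolding left_zero_vec[OF c(2)] by (metis (no_types))
  qed
  finally show ?thesis .
qed

end

text \<open>Keeps \<open>state\<close> folded at successor stages, so that it is advanced only
  through \<open>state_Suc\<close>.\<close>

lemmas [simp del] = state.simps(2)

section \<open>Stationary profiles and the complementarity problem\<close>

locale game_nash_profile = game_nash + game_profile
begin

context
  fixes \<mu> :: "nat \<Rightarrow> nat \<Rightarrow> real vec"
  assumes \<mu>: "\<And>i k. i < N \<Longrightarrow> k < K \<Longrightarrow> \<mu> i k \<in> carrier_vec (nc G i)"
begin

abbreviation "mus k \<equiv> stack N (\<lambda>i. \<mu> i k)"

lemma mus_carrier: "k < K \<Longrightarrow> mus k \<in> carrier_vec (nc_tot G)"
  unfolding nc_tot_def using \<mu> by (intro vec_stack_carrier) auto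

lemma uK_eq_iff: "uK G u = sol_F G P *\<^sub>v stack K mus + sol_P G P x0 \<longleftrightarrow>
  (\<forall>k<K. ustage G u k = input_sol mus k)"
proof -
  have "sol_F G P *\<^sub>v stack K mus + sol_P G P x0 = stack K (input_sol mus)"
    by (rule sol_eq[OF mus_carrier])
  moreover have "input_sol mus k \<in> carrier_vec (nu_tot G)" if "k < K" for k by (rule input_sol_carrier[OF mus_carrier that])
  ultimately show ?thesis
    unfolding uK_def using vec_stack_eq_iff[of K "ustage G u" "\<lambda>_. nu_tot G" "input_sol mus"] ustage_carrier by simp
qed

text \<open>The costates are \<open>P\<^sub>k\<^sup>i x\<^sub>k + \<beta>\<^sub>k\<^sup>i\<close>, where the stacked vectors \<open>\<beta>\<^sub>k\<^sub>+\<^sub>1\<close> are \<open>offset mus k\<close>.\<close>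

lemma state_xi:
  assumes U: "\<And>k. k < K \<Longrightarrow> ustage G u k = input_sol mus k"
    and b: "\<And>k i. i < N \<Longrightarrow> b k i \<in> carrier_vec n" "\<And>k. offset mus k = stack N (b k)"
  shows "k \<le> K \<Longrightarrow> state G x0 u k = traj mus k"
    and "k < K \<Longrightarrow> i < N \<Longrightarrow> u i k = feedback k (traj mus (Suc k)) (b k) (\<lambda>i. \<mu> i k) i"
proof -
  \<comment> \<open>The stacked input determines the input of each player, so the stacked formula
    can be read off block by block.\<close>
  have u_ctrl: "u i k = feedback k (traj mus (Suc k)) (b k) (\<lambda>i. \<mu> i k) i" if k: "k < K" and i: "i < N" for i k
  proof -
    have "stack N (\<lambda>i. u i k) = input_sol mus k" using U[OF k] by (simp add: ustage_def)
    also have "\<dots> = stack N (feedback k (next_state k (traj mus k) (offset mus k) (mus k)) (b k) (\<lambda>i. \<mu> i k))"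
      unfolding input_sol_def b(2) using k b(1) \<mu> by (intro feedback_stack_eq) auto
    also have "next_state k (traj mus k) (offset mus k) (mus k) = traj mus (Suc k)"
      by (rule traj_Suc[of mus, OF mus_carrier k, symmetric])
    finally have e: "stack N (\<lambda>i. u i k) = stack N (feedback k (traj mus (Suc k)) (b k) (\<lambda>i. \<mu> i k))" .
    have "feedback k (traj mus (Suc k)) (b k) (\<lambda>i. \<mu> i k) i \<in> carrier_vec (nu G i)" if "i < N" for i
      using Ri_carrier[OF that k] by (intro carrier_vecI) (auto simp: feedback_def)
    then show ?thesis using e u_carrier k i by (subst (asm) vec_stack_eq_iff[where d = "nu G"]) auto
  qed
  show "k < K \<Longrightarrow> i < N \<Longrightarrow> u i k = feedback k (traj mus (Suc k)) (b k) (\<lambda>i. \<mu> i k) i" by (rule u_ctrl)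
  show "k \<le> K \<Longrightarrow> state G x0 u k = traj mus k"
  proof (induction k)
    case 0
    show ?case using traj_0[of mus, OF mus_carrier] by simp
  next
    case (Suc k)
    then have k: "k < K" and IH: "state G x0 u k = traj mus k" by auto
    have "traj mus (Suc k) = next_state k (traj mus k) (stack N (b k)) (mus k)"
      using traj_Suc[of mus, OF mus_carrier k] b(2) by simp
    \<comment> \<open>The explicit next state solves the implicit equation, and the inputs occurring
      there are the actual ones.\<close>
    then have "traj mus (Suc k) = Am G k *\<^sub>v traj mus k + vsum n (\<lambda>i. Bm G i k *\<^sub>v feedback k (traj mus (Suc k)) (b k) (\<lambda>i. \<mu> i k) i) {..<N}"
      by (subst fixpoint_iff[OF k traj_carrier b(1) \<mu>[OF _ k] traj_carrier])
    also have "vsum n (\<lambda>i. Bm G i k *\<^sub>v feedback k (traj mus (Suc k)) (b k) (\<lambda>i. \<mu> i k) i) {..<N} = vsum n (\<lambda>i. Bm G i k *\<^sub>v u i k) {..<N}"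
      using u_ctrl[OF k] by (intro vsum_cong refl) simp
    finally show ?case unfolding state_Suc[OF k] IH by simp
  qed
qed

lemma ex_bet_blocks: "\<exists>b. (\<forall>k. \<forall>i<N. b k i \<in> carrier_vec n) \<and> (\<forall>k. offset mus k = stack N (b k))"
proof -
  have "\<forall>k. \<exists>w. (\<forall>i<N. w i \<in> carrier_vec n) \<and> offset mus k = stack N w"
    using vec_stack_surj[of "offset mus _" "\<lambda>_. n" N] by simp
  then show ?thesis by (metis (mono_tags))
qed

text \<open>Joins \<open>offset_step\<close> and \<open>costate_eq\<close>: it is the adjoint
  equation of each player, expressed for the costate minus \<open>P\<close> times the state.\<close>

lemma offset_blocks_step:
  assumes j: "Suc j < K" and b: "\<And>i. i < N \<Longrightarrow> b i \<in> carrier_vec n" and offset: "offset mus (Suc j) = stack N b"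
    and next_state: "state G x0 u (Suc (Suc j)) = next_state (Suc j) (state G x0 u (Suc j)) (offset mus (Suc j)) (mus (Suc j))"
  shows "offset mus j = stack N (\<lambda>i. (Am G (Suc j))\<^sup>T *\<^sub>v (P i (Suc (Suc j)) *\<^sub>v state G x0 u (Suc (Suc j)) + b i)
    + Qm G i (Suc j) *\<^sub>v state G x0 u (Suc j) - (Mm G i (Suc j))\<^sup>T *\<^sub>v \<mu> i (Suc j)
    - P i (Suc j) *\<^sub>v state G x0 u (Suc j) + pv G i (Suc j))"
    (is "_ = vec_stack (map (\<lambda>i. ?c i + _) _)")
proof -
  let ?k = "Suc j"
  have "offset mus j = Hm G P (Suc ?k) *\<^sub>v stack N b + Hbar G P ?k *\<^sub>v mus ?k + bp G ?k"
    unfolding offset[symmetric] by (rule offset_step[of mus, OF mus_carrier j])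
  also have "Hm G P (Suc ?k) *\<^sub>v stack N b + Hbar G P ?k *\<^sub>v mus ?k = stack N ?c"
    using costate_eq[of ?k "state G x0 u ?k" b "\<lambda>i. \<mu> i ?k"] j b \<mu> state_carrier[of ?k]
    unfolding next_state[unfolded offset, symmetric] by simp
  also have "\<dots> + bp G ?k = stack N (\<lambda>i. ?c i + pv G i ?k)"
    unfolding bp_def using carriers(8) j P_carrier carrier_matD(1)[OF P_carrier]
    by (intro vec_stack_add[where d = "\<lambda>_. n"]) (auto intro!: carrier_vecI)
  finally show ?thesis .
qed

lemma grad_terminal: "grad G x0 u i (\<mu> i) K = Qm G i K *\<^sub>v state G x0 u K + pv G i K"
  by (simp add: grad_def)

lemma P_terminal: "i < N \<Longrightarrow> P i K = Qm G i K"
  using P_ric by (auto simp: riccati_nash_def)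

lemma solution_imp_stationary:
  assumes "uK G u = sol_F G P *\<^sub>v stack K mus + sol_P G P x0" and i: "i < N"
  shows "stationary G x0 u i (\<mu> i)"
proof -
  have U: "\<And>k. k < K \<Longrightarrow> ustage G u k = input_sol mus k" using assms(1) uK_eq_iff by blast
  obtain b where b: "\<And>k i. i < N \<Longrightarrow> b k i \<in> carrier_vec n" "\<And>k. offset mus k = stack N (b k)"
    using ex_bet_blocks by blast
  let ?x = "state G x0 u"
  have st1: "?x k = traj mus k" if "k \<le> K" for k by (rule state_xi(1)[OF U b that])
  have st2: "u i k = feedback k (traj mus (Suc k)) (b k) (\<lambda>i. \<mu> i k) i" if "k < K" for k
    by (rule state_xi(2)[OF U b that i])
  \<comment> \<open>The offset for stage k carries index k - 1. The value at stage 0 is chosen so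
    that the terminal condition also holds for an empty horizon.\<close>
  define lam where "lam k = (if k = 0 then grad G x0 u i (\<mu> i) 0 else P i k *\<^sub>v ?x k + b (k - 1) i)" for k
  have Qx: "Qm G i k *\<^sub>v ?x k \<in> carrier_vec n" if "k \<le> K" for k
    using carriers(7)[OF i that] by (intro carrier_vecI) auto
  have Px: "P i k *\<^sub>v ?x k \<in> carrier_vec n" if "k \<le> K" for k
    using P_carrier[OF i that] by (intro carrier_vecI) auto
  have Mm: "(Mm G i k)\<^sup>T *\<^sub>v \<mu> i k \<in> carrier_vec n" if "k < K" for k
    using carriers(3)[OF i that] by (intro carrier_vecI) auto
  have pvc: "pv G i k \<in> carrier_vec n" if "k \<le> K" for k using carriers(8)[OF i that] .
  have "grad G x0 u i (\<mu> i) k \<in> carrier_vec n" if "k \<le> K" for k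
    using Qx[OF that] Mm[of k] pvc[OF that] by (auto simp: grad_def Let_def)
  then have lam_c: "lam k \<in> carrier_vec n" if "k \<le> K" for k
    using that Px b(1)[OF i] by (auto simp: lam_def)
  have lam_K: "lam K = grad G x0 u i (\<mu> i) K"
  proof (cases K)
    case (Suc j)
    have "stack N (b j) = stack N (\<lambda>i. pv G i K)"
      using offset_last[of mus, OF mus_carrier Suc] b(2)[of j] by (simp add: bp_def)
    then have "b j i = pv G i K"
      using b(1) carriers(8) i by (subst (asm) vec_stack_eq_iff[where d = "\<lambda>_. n"]) auto
    then show ?thesis unfolding grad_terminal using Suc P_terminal[OF i] by (simp add: lam_def)
  qed (simp add: lam_def)
  have lam_step: "lam (Suc j) = (Am G (Suc j))\<^sup>T *\<^sub>v lam (Suc (Suc j)) + grad G x0 u i (\<mu> i) (Suc j)" if j: "Suc j < K" for j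
  proof -
    let ?k = "Suc j"
    let ?Al = "\<lambda>i. (Am G ?k)\<^sup>T *\<^sub>v (P i (Suc ?k) *\<^sub>v ?x (Suc ?k) + b ?k i)"
    let ?c = "\<lambda>i. ?Al i + Qm G i ?k *\<^sub>v ?x ?k - (Mm G i ?k)\<^sup>T *\<^sub>v \<mu> i ?k - P i ?k *\<^sub>v ?x ?k"
    have "?x (Suc ?k) = next_state ?k (?x ?k) (offset mus ?k) (mus ?k)"
      using traj_Suc[of mus, OF mus_carrier j] st1[of ?k] st1[of "Suc ?k"] j by simp
    then have "stack N (b j) = stack N (\<lambda>i. ?c i + pv G i ?k)"
      unfolding b(2)[symmetric] using j b by (intro offset_blocks_step) auto
    then have "b j i = ?c i + pv G i ?k"
      using b(1) carriers(8) i j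
      by (subst (asm) vec_stack_eq_iff[where d = "\<lambda>_. n"]) (auto intro!: carrier_vecI simp: carrier_vecD[OF carriers(8)])
    \<comment> \<open>Adding \<open>P\<close> times the state back cancels the subtracted term and
      leaves the adjoint equation.\<close>
    then have "lam ?k = P i ?k *\<^sub>v ?x ?k + (?c i + pv G i ?k)" by (simp add: lam_def)
    also have "\<dots> = ?Al i + (Qm G i ?k *\<^sub>v ?x ?k + pv G i ?k - (Mm G i ?k)\<^sup>T *\<^sub>v \<mu> i ?k)"
      using carriers(1)[OF j] carriers(7)[OF i less_imp_le[OF j]] carriers(8)[OF i less_imp_le[OF j]] carriers(3)[OF i j] P_carrier[OF i less_imp_le[OF j]]
      by (intro eq_vecI) (auto simp: algebra_simps simp del: index_mult_mat_vec)
    finally show ?thesis using j by (simp add: lam_def grad_def)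
  qed
  have "costate G x0 u i (\<mu> i) lam"
    unfolding costate_def using lam_c lam_K lam_step by (metis One_nat_def Suc_le_D)
  moreover have "hamiltonian_grad G u i (\<mu> i) lam k = 0\<^sub>v (nu G i)" if k: "k < K" for k
    using st2[OF k] feedback_iff[OF k i u_carrier[OF i k], of "\<lambda>i. \<mu> i k" "traj mus (Suc k)" "b k"] \<mu>[OF i k] st1[of "Suc k"] k
    by (simp add: hamiltonian_grad_def lam_def)
  ultimately show ?thesis by (auto simp: stationary_def)
qed

text \<open>Uniqueness argument: whatever costates are supplied, subtracting \<open>P\<close> times
  the state leaves vectors with the same terminal value and backward recursion as the offsets. They
  coincide, then so do states and inputs.\<close>

lemma stationary_imp_solution:
  assumes "\<And>i. i < N \<Longrightarrow> stationary G x0 u i (\<mu> i)"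
  shows "uK G u = sol_F G P *\<^sub>v stack K mus + sol_P G P x0"
proof -
  let ?x = "state G x0 u"
  have "\<forall>i. \<exists>lam. i < N \<longrightarrow> costate G x0 u i (\<mu> i) lam \<and> (\<forall>k<K. hamiltonian_grad G u i (\<mu> i) lam k = 0\<^sub>v (nu G i))"
    using assms by (auto simp: stationary_def)
  then obtain lam where lam: "\<And>i. i < N \<Longrightarrow> costate G x0 u i (\<mu> i) (lam i)"
    "\<And>i k. i < N \<Longrightarrow> k < K \<Longrightarrow> hamiltonian_grad G u i (\<mu> i) (lam i) k = 0\<^sub>v (nu G i)" by metis
  have lam_c: "lam i k \<in> carrier_vec n" if "i < N" "k \<le> K" for i k
    using lam(1)[OF that(1)] that(2) by (simp add: costate_def)
  define b where "b k i = lam i (Suc k) - P i (Suc k) *\<^sub>v ?x (Suc k)" for k i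
  have Px: "P i k *\<^sub>v ?x k \<in> carrier_vec n" if "i < N" "k \<le> K" for k i
    using P_carrier[OF that] by (intro carrier_vecI) auto
  have bc: "b k i \<in> carrier_vec n" if "i < N" "k < K" for k i
    using P_carrier[OF that(1), of "Suc k"] that by (intro carrier_vecI) (auto simp: b_def)
  have lam_b: "lam i (Suc k) = P i (Suc k) *\<^sub>v ?x (Suc k) + b k i" if "i < N" "k < K" for i k
    using P_carrier[OF that(1), of "Suc k"] lam_c[OF that(1), of "Suc k"] that unfolding b_def
    by (intro eq_vecI) auto
  have u_ctrl: "u i k = feedback k (?x (Suc k)) (b k) (\<lambda>i. \<mu> i k) i" if k: "k < K" and i: "i < N" for i k
    using lam(2)[OF i k] feedback_iff[OF k i u_carrier[OF i k], of "\<lambda>i. \<mu> i k" "?x (Suc k)" "b k"] \<mu>[OF i k] lam_b[OF i k]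
    by (simp add: hamiltonian_grad_def)
  \<comment> \<open>Established for b before it is known to be the offset, since the backward
    induction below relies on it.\<close>
  have x_nxt: "?x (Suc k) = next_state k (?x k) (stack N (b k)) (mus k)" if k: "k < K" for k
  proof -
    have "?x (Suc k) = Am G k *\<^sub>v ?x k + vsum n (\<lambda>i. Bm G i k *\<^sub>v u i k) {..<N}" by (rule state_Suc[OF k])
    also have "vsum n (\<lambda>i. Bm G i k *\<^sub>v u i k) {..<N} = vsum n (\<lambda>i. Bm G i k *\<^sub>v feedback k (?x (Suc k)) (b k) (\<lambda>i. \<mu> i k) i) {..<N}"
      using u_ctrl[OF k] by (intro vsum_cong refl) simp
    finally show ?thesis
      using fixpoint_iff[of k "?x k" "b k" "\<lambda>i. \<mu> i k" "?x (Suc k)"] k bc[OF _ k] \<mu> state_carrier[of k] state_carrier[of "Suc k"] by simp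
  qed
  have offset: "k < K \<Longrightarrow> offset mus k = stack N (b k)" for k
  proof (induction "K - Suc k" arbitrary: k)
    case 0
    then have K: "K = Suc k" by simp
    have "b k i = pv G i K" if i: "i < N" for i
    proof -
      have "lam i K = P i K *\<^sub>v ?x K + pv G i K"
        using lam(1)[OF i] P_terminal[OF i] by (simp add: costate_def grad_terminal)
      then show ?thesis using P_carrier[OF i order_refl] carriers(8)[OF i order_refl]
        unfolding b_def K[symmetric] by (intro eq_vecI) (auto simp del: index_mult_mat_vec)
    qed
    then have e: "map (b k) [0..<N] = map (\<lambda>i. pv G i K) [0..<N]" by auto
    show ?case unfolding e using offset_last[of mus, OF mus_carrier K] by (simp add: bp_def)
  next
    case (Suc l)
    let ?k = "Suc k"
    have j: "?k < K" using Suc by simp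
    let ?Al = "\<lambda>i. (Am G ?k)\<^sup>T *\<^sub>v (P i (Suc ?k) *\<^sub>v ?x (Suc ?k) + b ?k i)"
    let ?c = "\<lambda>i. ?Al i + Qm G i ?k *\<^sub>v ?x ?k - (Mm G i ?k)\<^sup>T *\<^sub>v \<mu> i ?k - P i ?k *\<^sub>v ?x ?k"
    have IH: "offset mus ?k = stack N (b ?k)" using Suc by simp
    have "offset mus k = stack N (\<lambda>i. ?c i + pv G i ?k)"
      using x_nxt[OF j] IH bc[OF _ j] j by (intro offset_blocks_step) auto
    also have "map (\<lambda>i. ?c i + pv G i ?k) [0..<N] = map (b k) [0..<N]"
    proof (rule map_cong[OF refl])
      fix i assume "i \<in> set [0..<N]"
      then have i: "i < N" by simp
      have "lam i ?k = ?Al i + (Qm G i ?k *\<^sub>v ?x ?k + pv G i ?k - (Mm G i ?k)\<^sup>T *\<^sub>v \<mu> i ?k)"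
        using lam(1)[OF i] j lam_b[OF i j] by (simp add: costate_def grad_def)
      then show "?c i + pv G i ?k = b k i"
        unfolding b_def
        using carriers(1)[OF j] carriers(7)[OF i less_imp_le[OF j]] carriers(8)[OF i less_imp_le[OF j]] carriers(3)[OF i j] P_carrier[OF i less_imp_le[OF j]]
        by (intro eq_vecI) (auto simp: algebra_simps simp del: index_mult_mat_vec)
    qed
    finally show ?case .
  qed
  have traj: "k \<le> K \<Longrightarrow> traj mus k = ?x k" for k
  proof (induction k)
    case 0
    show ?case using traj_0[of mus, OF mus_carrier] by simp
  next
    case (Suc k)
    then show ?case using traj_Suc[of mus, OF mus_carrier, of k] offset[of k] x_nxt[of k] by simp
  qed
  have "ustage G u k = input_sol mus k" if k: "k < K" for k
  proof -
    have "input_sol mus k = stack N (feedback k (next_state k (?x k) (stack N (b k)) (mus k)) (b k) (\<lambda>i. \<mu> i k))"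
      unfolding input_sol_def offset[OF k] traj[OF less_imp_le[OF k]]
      using k bc[OF _ k] \<mu> state_carrier[of k] by (intro feedback_stack_eq) auto
    also have "\<dots> = ustage G u k"
      unfolding x_nxt[OF k, symmetric] ustage_def using u_ctrl[OF k] by (intro arg_cong[of _ _ vec_stack] map_cong refl) simp
    finally show ?thesis by simp
  qed
  then show ?thesis using uK_eq_iff by blast
qed

text \<open>Identifies the slack of the complementarity problem; the profile relation makes the
  trajectory and inputs built from the multipliers the actual ones.\<close>

lemma lcp_cval:
  assumes "uK G u = sol_F G P *\<^sub>v stack K mus + sol_P G P x0"
  shows "lcp_M G P *\<^sub>v stack K mus + lcp_q G P x0
    = stack K (\<lambda>k. stack N (\<lambda>i. cval G x0 u i k))"
proof -
  have U: "\<And>k. k < K \<Longrightarrow> ustage G u k = input_sol mus k" using assms uK_eq_iff by blast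
  obtain b where b: "\<And>k i. i < N \<Longrightarrow> b k i \<in> carrier_vec n" "\<And>k. offset mus k = stack N (b k)"
    using ex_bet_blocks by blast
  have st: "state G x0 u k = traj mus k" if "k \<le> K" for k by (rule state_xi(1)[OF U b that])
  have "lcp_M G P *\<^sub>v stack K mus + lcp_q G P x0
    = stack K (\<lambda>k. Mbar G k *\<^sub>v traj mus k + Nbar G k *\<^sub>v input_sol mus k + br G k)"
    by (rule lcp_eq[OF mus_carrier])
  also have "\<dots> = stack K (\<lambda>k. stack N (\<lambda>i. cval G x0 u i k))"
  proof (intro arg_cong[of _ _ vec_stack] map_cong refl)
    fix k assume "k \<in> set [0..<K]"
    then have k: "k < K" by simp
    have "Mbar G k *\<^sub>v traj mus k = stack N (\<lambda>i. Mm G i k *\<^sub>v state G x0 u k)"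
      unfolding Mbar_def st[OF less_imp_le[OF k], symmetric] using carriers(3)[OF _ k] state_carrier[OF less_imp_le[OF k]] by (rule vstack_mult_vec)
    moreover have "Nbar G k *\<^sub>v input_sol mus k = stack N (\<lambda>i. Nm G i k *\<^sub>v ustage G u k)"
      unfolding Nbar_def U[OF k, symmetric] using carriers(4)[OF _ k] ustage_carrier[OF k] by (rule vstack_mult_vec)
    moreover have c: "Mm G i k *\<^sub>v state G x0 u k \<in> carrier_vec (nc G i)" "Nm G i k *\<^sub>v ustage G u k \<in> carrier_vec (nc G i)"
       "rv G i k \<in> carrier_vec (nc G i)" if "i < N" for i
      using carriers(3-5)[OF that k] by (auto intro!: carrier_vecI)
    ultimately show "Mbar G k *\<^sub>v traj mus k + Nbar G k *\<^sub>v input_sol mus k + br G k = stack N (\<lambda>i. cval G x0 u i k)"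
      unfolding br_def cval_def
      using vec_stack_add[of N _ "nc G", OF c(1,2)] vec_stack_add[of N _ "nc G", OF add_carrier_vec[OF c(1,2)] c(3)] by simp
  qed
  finally show ?thesis .
qed

text \<open>Componentwise signs make every summand of the scalar product nonnegative, so the single
  orthogonality condition splits into one for each stage and player.\<close>

lemma lcp_solution_iff:
  assumes "uK G u = sol_F G P *\<^sub>v stack K mus + sol_P G P x0"
  shows "lcp_solution (lcp_M G P) (lcp_q G P x0) (stack K mus) \<longleftrightarrow>
    (\<forall>k<K. \<forall>i<N. 0\<^sub>v (nc G i) \<le> cval G x0 u i k \<and> 0\<^sub>v (nc G i) \<le> \<mu> i k \<and> cval G x0 u i k \<bullet> \<mu> i k = 0)"
proof -
  let ?q = "nc_tot G" and ?m = "stack K mus"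
  let ?cs = "\<lambda>k. stack N (\<lambda>i. cval G x0 u i k)"
  have cs: "?cs k \<in> carrier_vec ?q" if "k < K" for k
    unfolding nc_tot_def using cval_carrier[OF _ that] by (intro vec_stack_carrier) auto
  have nn_c: "0\<^sub>v (K * ?q) \<le> stack K ?cs \<longleftrightarrow> (\<forall>k<K. \<forall>i<N. 0\<^sub>v (nc G i) \<le> cval G x0 u i k)"
    using vec_stack_nonneg_iff[of K ?cs "\<lambda>_. ?q"] vec_stack_nonneg_iff[of N _ "nc G"] cs cval_carrier by (simp add: nc_tot_def)
  have nn_m: "0\<^sub>v (K * ?q) \<le> ?m \<longleftrightarrow> (\<forall>k<K. \<forall>i<N. 0\<^sub>v (nc G i) \<le> \<mu> i k)"
    using vec_stack_nonneg_iff[of K mus "\<lambda>_. ?q"] vec_stack_nonneg_iff[of N _ "nc G"] mus_carrier \<mu> by (simp add: nc_tot_def)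
  have prod: "stack K ?cs \<bullet> ?m = (\<Sum>k<K. \<Sum>i<N. cval G x0 u i k \<bullet> \<mu> i k)"
    using cval_carrier \<mu> vec_stack_scalar_prod[of N _ "nc G"]
    by (subst vec_stack_scalar_prod[OF cs mus_carrier]) (auto intro!: sum.cong)
  have zero: "(\<Sum>k<K. \<Sum>i<N. cval G x0 u i k \<bullet> \<mu> i k) = 0 \<longleftrightarrow> (\<forall>k<K. \<forall>i<N. cval G x0 u i k \<bullet> \<mu> i k = 0)"
    if nn: "\<And>k i. k < K \<Longrightarrow> i < N \<Longrightarrow> 0\<^sub>v (nc G i) \<le> cval G x0 u i k" "\<And>k i. k < K \<Longrightarrow> i < N \<Longrightarrow> 0\<^sub>v (nc G i) \<le> \<mu> i k"
  proof -
    have p: "0 \<le> cval G x0 u i k \<bullet> \<mu> i k" if "k < K" "i < N" for i k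
      using nn[OF that] cval_carrier[OF that(2,1)] \<mu>[OF that(2,1)]
      by (auto simp: scalar_prod_def less_eq_vec_def intro!: sum_nonneg mult_nonneg_nonneg)
    have "(\<Sum>k<K. \<Sum>i<N. cval G x0 u i k \<bullet> \<mu> i k) = 0 \<longleftrightarrow> (\<forall>k\<in>{..<K}. (\<Sum>i<N. cval G x0 u i k \<bullet> \<mu> i k) = 0)"
      using p by (intro sum_nonneg_eq_0_iff sum_nonneg) auto
    also have "\<dots> \<longleftrightarrow> (\<forall>k\<in>{..<K}. \<forall>i\<in>{..<N}. cval G x0 u i k \<bullet> \<mu> i k = 0)"
      using p by (intro ball_cong refl sum_nonneg_eq_0_iff) auto
    finally show ?thesis by auto
  qed
  show ?thesis
    unfolding lcp_solution_def lcp_cval[OF assms] dim_lcp_q nn_c nn_m prod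
    using mK_carrier[of mus, OF mus_carrier] zero by auto
qed

end

theorem own_equilibrium_iff_lcp:
  assumes E: "riccati_symmetric G E" and Y: "\<And>i k. i < N \<Longrightarrow> k < K \<Longrightarrow> pos_def (Ym G E i k)"
  shows "golne_own G x0 u \<longleftrightarrow>
    (\<exists>\<mu>. lcp_solution (lcp_M G P) (lcp_q G P x0) \<mu> \<and> uK G u = sol_F G P *\<^sub>v \<mu> + sol_P G P x0)"
proof -
  have pl: "player G x0 u i" if "i < N" for i by unfold_locales (rule that)
  have curv: "0 \<le> lq_path.curvature K n (Am G) (Bm G i) (Qm G i) (Rm G i i) d"
    if i: "i < N" and d: "d \<in> lq_path.dirs K (nu G i)" for i d
  proof -
    interpret player G x0 u i by (rule pl[OF i])
    show ?thesis using E Y[OF i] i d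
      by (intro curvature_nonneg[of "E i"]) (auto simp: riccati_symmetric_def Ym_def)
  qed
  have feas: "u \<in> feasible G x0 \<longleftrightarrow> (\<forall>i<N. \<forall>k<K. 0\<^sub>v (nc G i) \<le> cval G x0 u i k)"
    using u by (auto simp: feasible_def constr_def cval_def)
  have own: "golne_own G x0 u \<longleftrightarrow> u \<in> feasible G x0 \<and> (\<forall>i<N. player.own_optimal G x0 u i)"
    using player.own_optimal_def[OF pl] by (auto simp: golne_own_def)
  show ?thesis
  proof
    assume g: "golne_own G x0 u"
    have "\<exists>\<mu>. player.kkt G x0 u i \<mu>" if i: "i < N" for i
    proof -
      interpret player G x0 u i by (rule pl[OF i])
      show ?thesis using g own feas i curv[OF i] by (intro optimal_imp_kkt) (auto simp: own_feasible_def)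
    qed
    then obtain \<mu> where \<mu>: "\<And>i. i < N \<Longrightarrow> player.kkt G x0 u i (\<mu> i)" by metis
    have kkt: "(\<forall>k<K. \<mu> i k \<in> carrier_vec (nc G i) \<and> 0\<^sub>v (nc G i) \<le> \<mu> i k \<and> cval G x0 u i k \<bullet> \<mu> i k = 0)
      \<and> stationary G x0 u i (\<mu> i)" if "i < N" for i
      using \<mu>[OF that] by (simp add: player.kkt_def[OF pl[OF that]])
    have \<mu>c: "\<mu> i k \<in> carrier_vec (nc G i)" if "i < N" "k < K" for i k using kkt[OF that(1)] that by blast
    have sol: "uK G u = sol_F G P *\<^sub>v stack K (\<lambda>k. stack N (\<lambda>i. \<mu> i k)) + sol_P G P x0"
      by (rule stationary_imp_solution[OF \<mu>c]) (use kkt in blast)+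
    moreover have "lcp_solution (lcp_M G P) (lcp_q G P x0) (stack K (\<lambda>k. stack N (\<lambda>i. \<mu> i k)))"
      using lcp_solution_iff[of \<mu>, OF \<mu>c sol] kkt g own feas by blast
    ultimately show "\<exists>\<mu>. lcp_solution (lcp_M G P) (lcp_q G P x0) \<mu> \<and> uK G u = sol_F G P *\<^sub>v \<mu> + sol_P G P x0" by blast
  next
    assume "\<exists>\<mu>. lcp_solution (lcp_M G P) (lcp_q G P x0) \<mu> \<and> uK G u = sol_F G P *\<^sub>v \<mu> + sol_P G P x0"
    then obtain \<nu> where \<nu>: "lcp_solution (lcp_M G P) (lcp_q G P x0) \<nu>" "uK G u = sol_F G P *\<^sub>v \<nu> + sol_P G P x0" by blast
    \<comment> \<open>The given solution is cut first into stages and then into players, which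
      recovers individual multipliers.\<close>
    have "dim_vec (lcp_q G P x0) = (\<Sum>k<K. nc_tot G)"
      using dim_lcp_q by simp
    then have "\<nu> \<in> carrier_vec (\<Sum>k<K. nc_tot G)" using \<nu>(1) by (simp add: lcp_solution_def)
    then obtain m where m: "\<And>k. k < K \<Longrightarrow> m k \<in> carrier_vec (nc_tot G)" "\<nu> = stack K m"
      using vec_stack_surj[of \<nu> "\<lambda>_. nc_tot G" K] by blast
    have "\<forall>k. \<exists>w. k < K \<longrightarrow> (\<forall>i<N. w i \<in> carrier_vec (nc G i)) \<and> m k = stack N w"
      using vec_stack_surj[of "m _" "nc G" N] m(1) unfolding nc_tot_def by blast
    then obtain w where w: "\<And>k. k < K \<Longrightarrow> (\<forall>i<N. w k i \<in> carrier_vec (nc G i)) \<and> m k = stack N (w k)"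
      by metis
    define \<mu> where "\<mu> i k = w k i" for i k
    have \<mu>c: "\<mu> i k \<in> carrier_vec (nc G i)" if "i < N" "k < K" for i k using w[OF that(2)] that(1) by (simp add: \<mu>_def)
    have "\<nu> = stack K (\<lambda>k. stack N (\<lambda>i. \<mu> i k))"
      unfolding m(2) using w by (intro arg_cong[of _ _ vec_stack] map_cong refl) (simp add: \<mu>_def)
    note \<nu> = \<nu>[unfolded this]
    have all: "\<forall>k<K. \<forall>i<N. 0\<^sub>v (nc G i) \<le> cval G x0 u i k \<and> 0\<^sub>v (nc G i) \<le> \<mu> i k \<and> cval G x0 u i k \<bullet> \<mu> i k = 0"
      using lcp_solution_iff[of \<mu>, OF \<mu>c \<nu>(2)] \<nu>(1) by blast
    have "player.own_optimal G x0 u i" if i: "i < N" for i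
    proof -
      interpret player G x0 u i by (rule pl[OF i])
      have "kkt (\<mu> i)"
        unfolding kkt_def using all i \<mu>c[OF i] solution_imp_stationary[of \<mu>, OF \<mu>c \<nu>(2) i] by blast
      then show ?thesis using kkt_imp_optimal[OF curv[OF i]] by blast
    qed
    then show "golne_own G x0 u" using own feas all by blast
  qed
qed

end

text \<open>A deviation that keeps all constraints keeps the deviator's own ones, so
  \<open>golne\<close> has fewer deviations to beat.\<close>

lemma golne_own_imp_golne: "golne_own G x0 u \<Longrightarrow> golne G x0 u"
  unfolding golne_own_def golne_def
proof (elim conjE, intro conjI allI impI ballI)
  fix i v assume h: "\<forall>i<npl G. \<forall>v\<in>admissible_own G x0 i u. cost G x0 i u \<le> cost G x0 i (u(i := v))"
    and i: "i < npl G" and v: "v \<in> admissible G x0 i u"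
  have "u(i := v) \<in> feasible G x0" using v by (simp add: admissible_def)
  then have "v \<in> admissible_own G x0 i u"
    using i by (auto simp: feasible_def admissible_own_def split: if_splits)
  then show "cost G x0 i u \<le> cost G x0 i (u(i := v))" using h i by blast
qed

text \<open>The equivalence concerns \<open>golne_own\<close>, the notion to which own-constraint
  multipliers correspond. For \<open>golne\<close> one direction is asserted, as constraints of
  others may rule out deviations that would improve the own cost.\<close>

theorem theorem6:
  fixes G :: dgc and E P :: "nat \<Rightarrow> nat \<Rightarrow> real mat" and x0 :: "real vec" and u :: profile
  assumes "dgc_wf G"
    and "assumption1 G"
    and "riccati_symmetric G E"
    and "riccati_nash G P"
    and "x0 \<in> X0 G"
    and "\<And>i k. i < npl G \<Longrightarrow> k < hor G \<Longrightarrow> pos_def (Ym G E i k)"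
    and "\<And>i. i < npl G \<Longrightarrow> u i \<in> strategies G i"
  shows "(golne_own G x0 u \<longleftrightarrow>
            (\<exists>\<mu>. lcp_solution (lcp_M G P) (lcp_q G P x0) \<mu> \<and>
                 uK G u = sol_F G P *\<^sub>v \<mu> + sol_P G P x0)) \<and>
         ((\<exists>\<mu>. lcp_solution (lcp_M G P) (lcp_q G P x0) \<mu> \<and>
                 uK G u = sol_F G P *\<^sub>v \<mu> + sol_P G P x0) \<longrightarrow> golne G x0 u)"
proof -
  interpret game_nash_profile G x0 P u
    using assms by unfold_locales (auto simp: assumption1_def X0_def)
  show ?thesis
    using own_equilibrium_iff_lcp[OF assms(3,6)] golne_own_imp_golne by blast
qed

end
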